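(* Let $J=J_0\oplus J_1$ be a nilpotent Jordan superalgebra over $\mathbb{C}$ of type $(2,3)$. Then $J$ is isomorphic to one of the following nilpotent Jordan superalgebras, each given on a homogeneous basis $\{e_1,e_2\}\cup\{f_1,f_2,f_3\}$ ($e_i$ even, $f_j$ odd) by its multiplication table: \begin{itemize} \item $(2,3)_{1}$: all products are zero; \item $(2,3)_{2}$: $f_1f_2=e_1$; \item $(2,3)_{3}$: $f_1f_2=e_1,\ f_1f_3=e_2$; \item $(2,3)_{4}$: $e_1f_2=f_1$; \item $(2,3)_{5}$: $e_1f_2=f_1,\ f_1f_2=e_2$; \item $(2,3)_{6}$: $e_1f_2=f_1,\ f_2f_3=e_2$; \item $(2,3)_{7}$: $e_1f_2=f_1,\ f_1f_3=e_2$; \item $(2,3)_{8}$: $e_1f_2=f_1,\ f_2f_3=e_1$; \item $(2,3)_{9}$: $e_1f_2=f_1,\ f_1f_2=e_2,\ f_2f_3=e_1$; \item $(2,3)_{10}$: $e_1f_2=f_1,\ f_1f_3=e_2,\ f_2f_3=e_1$; \item $(2,3)_{11}$: $e_1f_2=f_1,\ e_2f_3=f_1$; \item $(2,3)_{12}$: $e_1f_2=f_1,\ e_2f_3=f_1,\ f_2f_3=e_2$; \item $(2,3)_{13}$: $e_1f_2=f_1,\ e_2f_2=f_3$; \item $(2,3)_{14}$: $e_1f_2=f_1,\ e_2f_2=f_3,\ f_1f_2=e_2$; \item $(2,3)_{15}$: $e_1f_2=f_1,\ e_2f_3=f_2$; \item $(2,3)_{16}$: $e_1f_2=f_1,\ e_1f_3=f_2$;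 \item $(2,3)_{17}$: $e_1f_2=f_1,\ e_1f_3=f_2,\ f_2f_3=e_2$; \item $(2,3)_{18}$: $e_1f_2=f_1,\ e_1f_3=f_2,\ f_1f_3=e_2$; \item $(2,3)_{19}$: $e_1f_2=e_2f_3=f_1,\ e_1f_3=f_2$; \item $(2,3)_{20}$: $e_1f_2=e_2f_3=f_1,\ e_1f_3=f_2,\ f_2f_3=e_2$; \item $(2,3)_{21}$: $e_1^2=e_2$; \item $(2,3)_{22}$: $e_1^2=e_2,\ f_1f_2=e_1$; \item $(2,3)_{23}$: $e_1^2=e_2,\ f_1f_2=e_2$; \item $(2,3)_{24}$: $e_1^2=e_2,\ f_1f_2=e_1,\ f_1f_3=e_2$; \item $(2,3)_{25}$: $e_1^2=e_2,\ e_1f_2=f_1$; \item $(2,3)_{26}$: $e_1^2=e_2,\ e_1f_2=f_1,\ f_2f_3=e_2$; \item $(2,3)_{27}$: $e_1^2=e_2,\ e_1f_2=f_1,\ f_1f_2=e_2$; \item $(2,3)_{28}$: $e_1^2=e_2,\ e_1f_2=f_1,\ f_1f_3=e_2$; \item $(2,3)_{29}$: $e_1^2=e_2,\ e_1f_2=f_1,\ f_2f_3=e_1$; \item $(2,3)_{30}$: $e_1^2=e_2,\ e_1f_2=f_1,\ f_1f_2=e_2,\ f_2f_3=e_1$; \item $(2,3)_{31}^{\lambda}$, $\lambda\in\mathbb{C}\setminus\{0\}$: $e_1^2=e_2,\ e_1f_2=f_1,\ f_1f_3=\lambda e_2,\ f_2f_3=e_1$; \item $(2,3)_{32}$: $e_1^2=e_2,\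 e_1f_2=f_1,\ e_1f_3=f_2$; \item $(2,3)_{33}$: $e_1^2=e_2,\ e_1f_2=f_1,\ e_1f_3=f_2,\ f_1f_3=e_2$; \item $(2,3)_{34}$: $e_1^2=e_2,\ e_1f_2=f_1,\ e_1f_3=f_2,\ f_2f_3=e_2$; \item $(2,3)_{35}$: $e_1^2=e_2,\ e_2f_2=f_1$; \item $(2,3)_{36}$: $e_1^2=e_2,\ e_2f_2=f_1,\ f_2f_3=e_2$; \item $(2,3)_{37}$: $e_1^2=e_2,\ e_2f_2=f_1,\ f_2f_3=e_1$; \item $(2,3)_{38}$: $e_1^2=e_2,\ e_1f_2=e_2f_2=f_1,\ f_2f_3=e_1$; \item $(2,3)_{39}$: $e_1^2=e_2,\ e_1f_3=e_2f_2=f_1$; \item $(2,3)_{40}$: $e_1^2=e_2,\ e_1f_3=e_2f_2=f_1,\ f_2f_3=e_2$; \item $(2,3)_{41}$: $e_1^2=e_2,\ e_1f_3=e_2f_2=f_1,\ f_2f_3=e_1$; \item $(2,3)_{42}$: $e_1^2=e_2,\ e_1f_2=f_3,\ e_2f_2=f_1$; \item $(2,3)_{43}^{\gamma}$, $\gamma\in\mathbb{C}\setminus\{0\}$: $e_1^2=e_2,\ e_1f_2=f_3,\ e_1f_3=\gamma f_1,\ e_2f_2=f_1$; \item $(2,3)_{44}^{\phi}$, $\phi\in\mathbb{C}$: $e_1^2=e_2,\ e_1f_2=f_3,\ e_1f_3=\phi f_1,\ e_2f_2=f_1,\ f_2f_3=e_2$. \end{itemize} Moreover, superalgebras with different subscripts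 in this list are non-isomorphic, and within the families: $(2,3)_{31}^{\lambda_1}\cong(2,3)_{31}^{\lambda_2}$ if and only if $\lambda_1=\lambda_2$; $(2,3)_{43}^{\gamma_1}\cong(2,3)_{43}^{\gamma_2}$ if and only if $\gamma_1=\gamma_2$; $(2,3)_{44}^{\phi_1}\cong(2,3)_{44}^{\phi_2}$ if and only if $\phi_1=\phi_2$.
   Context: All vector spaces are over $\mathbb{C}$. A superalgebra $J=J_0\oplus J_1$ is a $\mathbb{Z}_2$-graded (not necessarily associative) algebra: $J_iJ_j\subseteq J_{i+j \bmod 2}$; $|x|=i$ denotes the parity of a nonzero $x\in J_i$. A Jordan superalgebra is a superalgebra satisfying, for all nonzero homogeneous $x,y,z,w$, supercommutativity $xy=(-1)^{|x||y|}yx$ and the Jordan superidentity $$(wx)(yz)+(-1)^{|x||y|}(wy)(xz)+(-1)^{(|x|+|y|)|z|}(wz)(xy)-(-1)^{|w||x|}x(w(yz))-(-1)^{|y|(|w|+|x|)}y(w(xz))-(-1)^{|z|(|w|+|x|+|y|)}z(w(xy))=0.$$ $J$ is of type $(m,n)$ if $\dim J_0=m$ and $\dim J_1=n$. Put $J^1=J$ and $J^{k+1}=J^kJ+J^{k-1}J^2+\cdots+JJ^k$ for $k\ge 1$; $J$ is nilpotent if $J^k=0$ for some $k\geq 1$. Two superalgebras are isomorphic ($\cong$) if there is an algebra isomorphism between them preserving the grading (even part to even part, odd part to odd part). In multiplication tables, products of basis elements that are neither listed nor obtained from listed ones by supercommutativity ($e_if_j=f_je_i$, $f_if_j=-f_jf_i$,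 $e_ie_j=e_je_i$) are zero. *)

theory Defs
  imports "HOL-Analysis.Analysis" "HOL-Library.Z2"
begin

text \<open>The underlying vector space of a superalgebra is a whole type; \<open>part A i\<close> is the
  homogeneous component of parity \<open>i\<close>, with \<open>bit\<close> (the field with two elements) as the grading group.\<close>

record 'a superalgebra =
  scl :: "complex \<Rightarrow> 'a \<Rightarrow> 'a"
  mult :: "'a \<Rightarrow> 'a \<Rightarrow> 'a"
  part :: "bit \<Rightarrow> 'a set"

definition superalgebra :: "'a::ab_group_add superalgebra \<Rightarrow> bool" where
  "superalgebra A \<longleftrightarrow>
     vector_space (scl A) \<and>
     (\<forall>x. Vector_Spaces.linear (scl A) (scl A) (\<lambda>y. mult A x y)) \<and>
     (\<forall>y. Vector_Spaces.linear (scl A) (scl A) (\<lambda>x. mult A x y)) \<and>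
     (\<forall>i. module.subspace (scl A) (part A i)) \<and>
     part A 0 \<inter> part A 1 = {0} \<and>
     (\<forall>x. \<exists>y\<in>part A 0. \<exists>z\<in>part A 1. x = y + z) \<and>
     (\<forall>i j. \<forall>x\<in>part A i. \<forall>y\<in>part A j. mult A x y \<in> part A (i + j))"

definition psign :: "bit \<Rightarrow> complex" where
  "psign i = (if i = 0 then 1 else - 1)"

text \<open>Requiring the identities also for \<open>0\<close>, which lies in both components, is harmless, since they
  hold trivially as soon as one argument is \<open>0\<close>.\<close>

definition supercommutative :: "'a::ab_group_add superalgebra \<Rightarrow> bool" where
  "supercommutative A \<longleftrightarrow>
     (\<forall>i j. \<forall>x\<in>part A i. \<forall>y\<in>part A j. mult A x y = scl A (psign (i * j)) (mult A y x))"

definition jordan_superidentity :: "'a::ab_group_add superalgebra \<Rightarrow> bool" where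
  "jordan_superidentity A \<longleftrightarrow>
     (let m = mult A; s = (\<lambda>i. scl A (psign i)) in
      \<forall>pw px py pz. \<forall>w\<in>part A pw. \<forall>x\<in>part A px. \<forall>y\<in>part A py. \<forall>z\<in>part A pz.
        m (m w x) (m y z)
        + s (px * py) (m (m w y) (m x z))
        + s ((px + py) * pz) (m (m w z) (m x y))
        - s (pw * px) (m x (m w (m y z)))
        - s (py * (pw + px)) (m y (m w (m x z)))
        - s (pz * (pw + px + py)) (m z (m w (m x y))) = 0)"

definition jordan_superalgebra :: "'a::ab_group_add superalgebra \<Rightarrow> bool" where
  "jordan_superalgebra A \<longleftrightarrow> superalgebra A \<and> supercommutative A \<and> jordan_superidentity A"

text \<open>\<open>dim\<close> is \<open>0\<close> on infinite-dimensional spaces, so finiteness has to be demanded separately.\<close>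

definition has_type :: "'a::ab_group_add superalgebra \<Rightarrow> nat \<Rightarrow> nat \<Rightarrow> bool" where
  "has_type A m n \<longleftrightarrow>
     (\<exists>B. finite B \<and> module.span (scl A) B = UNIV) \<and>
     vector_space.dim (scl A) (part A 0) = m \<and>
     vector_space.dim (scl A) (part A 1) = n"

text \<open>\<open>J\<^sup>k = J\<^sup>k\<^sup>-\<^sup>1 J + \<dots> + J J\<^sup>k\<^sup>-\<^sup>1\<close>: the sum of the subspaces \<open>J\<^sup>i J\<^sup>k\<^sup>-\<^sup>i\<close>, each spanned by
  products, is the span of all these products. The value at \<open>k = 0\<close> is a dummy.\<close>

fun alg_power :: "'a::ab_group_add superalgebra \<Rightarrow> nat \<Rightarrow> 'a set" where
  "alg_power A k =
     (if k \<le> 1 then UNIV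
      else module.span (scl A)
        (\<Union>i\<in>{1..<k}. (\<lambda>(x, y). mult A x y) ` (alg_power A i \<times> alg_power A (k - i))))"

declare alg_power.simps [simp del]

definition nilpotent_alg :: "'a::ab_group_add superalgebra \<Rightarrow> bool" where
  "nilpotent_alg A \<longleftrightarrow> (\<exists>k\<ge>1. alg_power A k = {0})"

definition isomorphic ::
  "'a::ab_group_add superalgebra \<Rightarrow> 'b::ab_group_add superalgebra \<Rightarrow> bool" (infix "\<cong>\<^sub>s" 50) where
  "A \<cong>\<^sub>s B \<longleftrightarrow>
     (\<exists>\<phi>. Vector_Spaces.linear (scl A) (scl B) \<phi> \<and> bij \<phi> \<and>
          (\<forall>x y. \<phi> (mult A x y) = mult B (\<phi> x) (\<phi> y)) \<and>
          (\<forall>i. \<phi> ` part A i = part B i))"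

datatype gen = E1 | E2 | F1 | F2 | F3

instance gen :: finite
proof
  have "x \<in> {E1, E2, F1, F2, F3}" for x :: gen
    by (cases x) auto
  then have "(UNIV :: gen set) \<subseteq> {E1, E2, F1, F2, F3}" by blast
  then show "finite (UNIV :: gen set)"
    by (rule finite_subset) simp
qed

fun gen_parity :: "gen \<Rightarrow> bit" where
  "gen_parity E1 = 0" | "gen_parity E2 = 0"
| "gen_parity F1 = 1" | "gen_parity F2 = 1" | "gen_parity F3 = 1"

definition bv :: "gen \<Rightarrow> complex ^ gen" where
  "bv g = axis g 1"

type_synonym table = "((gen \<times> gen) \<times> (complex ^ gen)) list"

definition basis_prod :: "table \<Rightarrow> gen \<Rightarrow> gen \<Rightarrow> complex ^ gen" where
  "basis_prod T g h =
     (case map_of T (g, h) of Some v \<Rightarrow> v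
      | None \<Rightarrow> (case map_of T (h, g) of Some v \<Rightarrow> psign (gen_parity g * gen_parity h) *s v
                 | None \<Rightarrow> 0))"

definition table_alg :: "table \<Rightarrow> (complex ^ gen) superalgebra" where
  "table_alg T =
     \<lparr> scl = (*s),
       mult = (\<lambda>x y. \<Sum>g\<in>UNIV. \<Sum>h\<in>UNIV. (x $ g * y $ h) *s basis_prod T g h),
       part = (\<lambda>i. {x. \<forall>g. x $ g \<noteq> 0 \<longrightarrow> gen_parity g = i}) \<rparr>"

text \<open>The parameter \<open>t\<close> only matters for the three families, with numbers 31, 43 and 44.\<close>

definition tables :: "complex \<Rightarrow> (nat \<times> table) list" where
  "tables t =
    [(1, []),
     (2, [((F1, F2), bv E1)]),
     (3, [((F1, F2), bv E1), ((F1, F3), bv E2)]),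
     (4, [((E1, F2), bv F1)]),
     (5, [((E1, F2), bv F1), ((F1, F2), bv E2)]),
     (6, [((E1, F2), bv F1), ((F2, F3), bv E2)]),
     (7, [((E1, F2), bv F1), ((F1, F3), bv E2)]),
     (8, [((E1, F2), bv F1), ((F2, F3), bv E1)]),
     (9, [((E1, F2), bv F1), ((F1, F2), bv E2), ((F2, F3), bv E1)]),
     (10, [((E1, F2), bv F1), ((F1, F3), bv E2), ((F2, F3), bv E1)]),
     (11, [((E1, F2), bv F1), ((E2, F3), bv F1)]),
     (12, [((E1, F2), bv F1), ((E2, F3), bv F1), ((F2, F3), bv E2)]),
     (13, [((E1, F2), bv F1), ((E2, F2), bv F3)]),
     (14, [((E1, F2), bv F1), ((E2, F2), bv F3), ((F1, F2), bv E2)]),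
     (15, [((E1, F2), bv F1), ((E2, F3), bv F2)]),
     (16, [((E1, F2), bv F1), ((E1, F3), bv F2)]),
     (17, [((E1, F2), bv F1), ((E1, F3), bv F2), ((F2, F3), bv E2)]),
     (18, [((E1, F2), bv F1), ((E1, F3), bv F2), ((F1, F3), bv E2)]),
     (19, [((E1, F2), bv F1), ((E2, F3), bv F1), ((E1, F3), bv F2)]),
     (20, [((E1, F2), bv F1), ((E2, F3), bv F1), ((E1, F3), bv F2), ((F2, F3), bv E2)]),
     (21, [((E1, E1), bv E2)]),
     (22, [((E1, E1), bv E2), ((F1, F2), bv E1)]),
     (23, [((E1, E1), bv E2), ((F1, F2), bv E2)]),
     (24, [((E1, E1), bv E2), ((F1, F2), bv E1), ((F1, F3), bv E2)]),
     (25, [((E1, E1), bv E2), ((E1, F2), bv F1)]),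
     (26, [((E1, E1), bv E2), ((E1, F2), bv F1), ((F2, F3), bv E2)]),
     (27, [((E1, E1), bv E2), ((E1, F2), bv F1), ((F1, F2), bv E2)]),
     (28, [((E1, E1), bv E2), ((E1, F2), bv F1), ((F1, F3), bv E2)]),
     (29, [((E1, E1), bv E2), ((E1, F2), bv F1), ((F2, F3), bv E1)]),
     (30, [((E1, E1), bv E2), ((E1, F2), bv F1), ((F1, F2), bv E2), ((F2, F3), bv E1)]),
     (31, [((E1, E1), bv E2), ((E1, F2), bv F1), ((F1, F3), t *s bv E2), ((F2, F3), bv E1)]),
     (32, [((E1, E1), bv E2), ((E1, F2), bv F1), ((E1, F3), bv F2)]),
     (33, [((E1, E1), bv E2), ((E1, F2), bv F1), ((E1, F3), bv F2), ((F1, F3), bv E2)]),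
     (34, [((E1, E1), bv E2), ((E1, F2), bv F1), ((E1, F3), bv F2), ((F2, F3), bv E2)]),
     (35, [((E1, E1), bv E2), ((E2, F2), bv F1)]),
     (36, [((E1, E1), bv E2), ((E2, F2), bv F1), ((F2, F3), bv E2)]),
     (37, [((E1, E1), bv E2), ((E2, F2), bv F1), ((F2, F3), bv E1)]),
     (38, [((E1, E1), bv E2), ((E1, F2), bv F1), ((E2, F2), bv F1), ((F2, F3), bv E1)]),
     (39, [((E1, E1), bv E2), ((E1, F3), bv F1), ((E2, F2), bv F1)]),
     (40, [((E1, E1), bv E2), ((E1, F3), bv F1), ((E2, F2), bv F1), ((F2, F3), bv E2)]),
     (41, [((E1, E1), bv E2), ((E1, F3), bv F1), ((E2, F2), bv F1), ((F2, F3), bv E1)]),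
     (42, [((E1, E1), bv E2), ((E1, F2), bv F3), ((E2, F2), bv F1)]),
     (43, [((E1, E1), bv E2), ((E1, F2), bv F3), ((E1, F3), t *s bv F1), ((E2, F2), bv F1)]),
     (44, [((E1, E1), bv E2), ((E1, F2), bv F3), ((E1, F3), t *s bv F1), ((E2, F2), bv F1), ((F2, F3), bv E2)])]"

definition J23 :: "nat \<Rightarrow> complex \<Rightarrow> (complex ^ gen) superalgebra" where
  "J23 k t = table_alg (the (map_of (tables t) k))"

text \<open>Admissible pairs (subscript, parameter); the parameter is \<open>0\<close> by convention outside
  the families.\<close>

definition labels :: "(nat \<times> complex) set" where
  "labels =
     {(k, 0) | k. k \<in> {1..44} - {31, 43, 44}}
     \<union> {(31, t) | t. t \<noteq> 0} \<union> {(43, t) | t. t \<noteq> 0} \<union> {(44, t) | t. True}"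

end

theory Submission
  imports Defs
begin

text \<open>
  In a homogeneous basis \<open>e\<^sub>1, e\<^sub>2, f\<^sub>1, f\<^sub>2, f\<^sub>3\<close> a supercommutative superalgebra of type \<open>(2,3)\<close> consists of
  three pieces: the commutative product of \<open>J\<^sub>0\<close>, the multiplication operators \<open>L\<^sub>e\<close> of \<open>J\<^sub>0\<close> on \<open>J\<^sub>1\<close>, and
  the alternating product \<open>J\<^sub>1 \<times> J\<^sub>1 \<rightarrow> J\<^sub>0\<close>. The classification first normalises the two pieces that
  involve \<open>J\<^sub>0\<close> and then lets the Jordan identity and nilpotency cut down the third.

  A nonzero subspace \<open>S\<close> of a nilpotent algebra is never contained in \<open>S J\<close>
  (\<open>nilpotent_no_fixed_set\<close>). Hence every nonzero \<open>J\<^sub>0\<close>-stable subspace \<open>S\<close> has a hyperplane containing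
  \<open>S J\<^sub>0\<close>, and descending through such hyperplanes yields a basis in which \<open>e\<^sub>1\<^sup>2 = m e\<^sub>2\<close>, all other even
  products vanish, and \<open>L\<^sub>1, L\<^sub>2\<close> are strictly upper triangular (\<open>triangular_frame\<close>). From there on,
  nilpotency is used only in the form that \<open>(x y) z = c x\<close> with \<open>x \<noteq> 0\<close> forces \<open>c = 0\<close> (\<open>loop_free\<close>);
  this property and the Jordan identity pass to isomorphic algebras.

  If \<open>m = 0\<close>, the even vectors may be recombined freely. The span of
  \<open>L\<^sub>1, L\<^sub>2\<close> is then zero, a line spanned by an operator of rank one or two, or one of four planes of
  strictly upper triangular matrices (\<open>classified_square_zero\<close>). If \<open>m \<noteq> 0\<close>, rescaling gives \<open>m = 1\<close>,
  and the Jordan identity yields \<open>L\<^sub>1 L\<^sub>2 = L\<^sub>2 L\<^sub>1 = L\<^sub>2\<^sup>2 = 0\<close>: either \<open>L\<^sub>2 = 0\<close> and one operator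
  remains, or \<open>L\<^sub>2\<close> has rank one and \<open>L\<^sub>1\<close> can be brought to the form of \<open>classified_square_acts\<close>.

  If \<open>J\<^sub>0\<close> annihilates \<open>J\<^sub>1\<close>, the odd product is a pair of alternating forms on a three-dimensional space.
  For every other action, a few instances of the Jordan identity on basis vectors together with
  \<open>loop_free\<close> leave at most four free coefficients of \<open>J\<^sub>1 \<times> J\<^sub>1 \<rightarrow> J\<^sub>0\<close>. Explicit
  changes of basis, which sometimes need a complex square root, remove them or scale them to \<open>1\<close>; only
  the parameters of the three families survive.

  That no two of the subscripts belong to isomorphic algebras is seen from ten multilinear identities and
  three conditions on annihilators (\<open>signatures_separate\<close>). The parameter of a family is recovered as the
  constant in an identity that holds in the algebra: \<open>a (a f) = t (a a) f\<close> for even \<open>a\<close> and odd \<open>f\<close> in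
  the families 43 and 44, and \<open>((f g) f) g - ((f g) g) f = t (f g) (f g)\<close> for odd \<open>f, g\<close> in the family
  31. That the tables define nilpotent Jordan superalgebras is checked on basis vectors, the Jordan
  identity being multilinear, and by weights of the basis vectors.
\<close>

section \<open>Coordinates\<close>

lemma UNIV_gen: "UNIV = {E1, E2, F1, F2, F3}"
  using gen.exhaust by blast

lemma sum_gen: "(\<Sum>g\<in>UNIV. f g) = f E1 + (f E2 + (f F1 + (f F2 + f F3)))"
  for f :: "gen \<Rightarrow> 'a::comm_monoid_add"
  by (simp add: UNIV_gen)

lemma all_gen: "(\<forall>g. P g) \<longleftrightarrow> P E1 \<and> P E2 \<and> P F1 \<and> P F2 \<and> P F3"
  by (metis gen.exhaust)

lemma vec_gen_eq: "x = y \<longleftrightarrow> x $ E1 = y $ E1 \<and> x $ E2 = y $ E2 \<and> x $ F1 = y $ F1 \<and> x $ F2 = y $ F2 \<and> x $ F3 = y $ F3"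
  by (simp add: vec_eq_iff all_gen)

lemma bv_nth: "bv g $ h = (if g = h then 1 else 0)"
  by (simp add: bv_def axis_def)

section \<open>Superalgebras and their isomorphisms\<close>

lemma linear_scl_I:
  assumes "vector_space s" "vector_space t" "\<And>x y. f (x + y) = f x + f y" "\<And>c x. f (s c x) = t c (f x)"
  shows "Vector_Spaces.linear s t f"
  using assms by (auto simp: Vector_Spaces.linear_iff)

lemma superalgebra_vs: "superalgebra A \<Longrightarrow> vector_space (scl A)"
  by (simp add: superalgebra_def)

lemma superalgebra_mult:
  assumes "superalgebra A"
  shows "mult A (x + y) z = mult A x z + mult A y z"
    and "mult A z (x + y) = mult A z x + mult A z y"
    and "mult A (scl A c x) z = scl A c (mult A x z)"
    and "mult A z (scl A c x) = scl A c (mult A z x)"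
  using assms by (simp_all add: superalgebra_def Vector_Spaces.linear_iff)

lemma superalgebra_mult_0:
  assumes "superalgebra A"
  shows "mult A 0 z = 0" and "mult A z 0 = 0"
proof -
  have "mult A (0 + 0) z = mult A 0 z + mult A 0 z" "mult A z (0 + 0) = mult A z 0 + mult A z 0"
    using superalgebra_mult[OF assms] by blast+
  then show "mult A 0 z = 0" and "mult A z 0 = 0" by simp_all
qed

lemma superalgebra_mult_sum:
  assumes "superalgebra A"
  shows "mult A (sum f S) z = (\<Sum>i\<in>S. mult A (f i) z)"
    and "mult A z (sum f S) = (\<Sum>i\<in>S. mult A z (f i))"
  by (induction S rule: infinite_finite_induct)
     (simp_all add: superalgebra_mult[OF assms] superalgebra_mult_0[OF assms])

lemma superalgebra_part:
  assumes "superalgebra A"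
  shows "module.subspace (scl A) (part A i)" "part A 0 \<inter> part A 1 = {0}"
    "\<exists>y\<in>part A 0. \<exists>z\<in>part A 1. x = y + z"
    "x \<in> part A i \<Longrightarrow> y \<in> part A j \<Longrightarrow> mult A x y \<in> part A (i + j)"
  using assms by (simp_all add: superalgebra_def)

lemma isomorphic_refl: "superalgebra A \<Longrightarrow> A \<cong>\<^sub>s A"
  unfolding isomorphic_def
  by (rule exI[of _ id]) (auto simp: superalgebra_def Vector_Spaces.linear_iff)

lemma isomorphic_sym:
  assumes "A \<cong>\<^sub>s B"
  shows "B \<cong>\<^sub>s A"
proof -
  obtain f where f: "Vector_Spaces.linear (scl A) (scl B) f" "bij f"
    "\<And>x y. f (mult A x y) = mult B (f x) (f y)" "\<And>i. f ` part A i = part B i"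
    using assms unfolding isomorphic_def by blast
  define g where "g = inv f"
  have fg: "f (g y) = y" for y
    unfolding g_def using f(2) by (simp add: bij_is_surj surj_f_inv_f)
  have gf: "g (f x) = x" for x
    unfolding g_def using f(2) by (simp add: bij_is_inj)
  have inj: "x = y" if "f x = f y" for x y
    using that gf by metis
  have fl: "f (x + y) = f x + f y" "f (scl A c x) = scl B c (f x)" for x y c
    using f(1) by (auto simp: Vector_Spaces.linear_iff)
  have "Vector_Spaces.linear (scl B) (scl A) g"
  proof (rule linear_scl_I)
    show "vector_space (scl B)" "vector_space (scl A)"
      using f(1) by (auto simp: Vector_Spaces.linear_iff)
    show "g (x + y) = g x + g y" for x y by (rule inj) (simp add: fl fg)
    show "g (scl B c x) = scl A c (g x)" for c x by (rule inj) (simp add: fl fg)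
  qed
  moreover have "bij g"
    unfolding g_def using f(2) by (rule bij_imp_bij_inv)
  moreover have "g (mult B x y) = mult A (g x) (g y)" for x y
    by (rule inj) (simp add: f(3) fg)
  moreover have "g ` part B i = part A i" for i
    unfolding f(4)[of i, symmetric] by (simp add: image_image gf)
  ultimately show ?thesis
    unfolding isomorphic_def by blast
qed

lemma isomorphic_trans:
  assumes "A \<cong>\<^sub>s B" and "B \<cong>\<^sub>s C"
  shows "A \<cong>\<^sub>s C"
proof -
  obtain f where f: "Vector_Spaces.linear (scl A) (scl B) f" "bij f"
    "\<And>x y. f (mult A x y) = mult B (f x) (f y)" "\<And>i. f ` part A i = part B i"
    using assms(1) unfolding isomorphic_def by blast
  obtain g where g: "Vector_Spaces.linear (scl B) (scl C) g" "bij g"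
    "\<And>x y. g (mult B x y) = mult C (g x) (g y)" "\<And>i. g ` part B i = part C i"
    using assms(2) unfolding isomorphic_def by blast
  have "Vector_Spaces.linear (scl A) (scl C) (g \<circ> f)"
    using f(1) g(1) by (simp add: Vector_Spaces.linear_iff)
  moreover have "bij (g \<circ> f)"
    using f(2) g(2) by (rule bij_comp)
  moreover have "(g \<circ> f) ` part A i = part C i" for i
    using f(4)[of i] g(4)[of i] by (simp only: image_comp[symmetric])
  ultimately show ?thesis
    unfolding isomorphic_def using f(3) g(3) by (intro exI[of _ "g \<circ> f"]) simp
qed

text \<open>The form in which isomorphisms are applied: properties of an algebra that are expressed by sums,
  scalings, products, parities and comparison with zero can be rewritten along \<open>f\<close>.\<close>

lemma isomorphicE:
  assumes "A \<cong>\<^sub>s B"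
  obtains f where "\<And>x y. f (x + y) = f x + f y" "\<And>c x. f (scl A c x) = scl B c (f x)" "f 0 = 0"
    "\<And>x y. f x = f y \<longleftrightarrow> x = y" "\<And>x. f x = 0 \<longleftrightarrow> x = 0"
    "\<And>x y. f (mult A x y) = mult B (f x) (f y)"
    "\<And>x i. f x \<in> part B i \<longleftrightarrow> x \<in> part A i" "\<And>y. \<exists>x. f x = y"
proof -
  obtain f where f: "Vector_Spaces.linear (scl A) (scl B) f" "bij f"
    "\<And>x y. f (mult A x y) = mult B (f x) (f y)" "\<And>i. f ` part A i = part B i"
    using assms unfolding isomorphic_def by blast
  have fl: "f (x + y) = f x + f y" "f (scl A c x) = scl B c (f x)" for x y c
    using f(1) by (auto simp: Vector_Spaces.linear_iff)
  have 0: "f 0 = 0" using fl(1)[of 0 0] by simp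
  have inj: "f x = f y \<longleftrightarrow> x = y" for x y
    using f(2) by (meson bij_is_inj inj_eq)
  have part: "f x \<in> part B i \<longleftrightarrow> x \<in> part A i" for x i
    using f(2) by (simp add: f(4)[symmetric] inj_image_mem_iff bij_is_inj)
  show thesis
  proof (rule that)
    show "f x = 0 \<longleftrightarrow> x = 0" for x using inj[of x 0] 0 by simp
    show "\<exists>x. f x = y" for y using bij_is_surj[OF f(2)] by (metis surjD)
  qed (fact fl 0 inj part f(3))+
qed

section \<open>Nilpotency and the Jordan identity under isomorphism\<close>

lemma alg_power_Suc_mult:
  assumes "superalgebra A" "x \<in> alg_power A k" "1 \<le> k"
  shows "mult A x y \<in> alg_power A (Suc k)"
proof -
  interpret vector_space "scl A" using assms(1) by (rule superalgebra_vs)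
  have "y \<in> alg_power A 1" by (subst alg_power.simps) simp
  then have "mult A x y \<in> (\<Union>i\<in>{1..<Suc k}. (\<lambda>(x, y). mult A x y) ` (alg_power A i \<times> alg_power A (Suc k - i)))"
    using assms(2,3) by (intro UN_I[of k]) (auto intro!: image_eqI[of _ _ "(x, y)"])
  then show ?thesis
    using assms(3) by (subst alg_power.simps) (simp del: UN_iff add: span_base)
qed

text \<open>If \<open>S\<close> lies in the span of \<open>S J\<close>, then by induction \<open>S\<close> lies in every power of the algebra, because
  multiplying an element of \<open>J\<^sup>k\<close> by anything lands in \<open>J\<^sup>k\<^sup>+\<^sup>1\<close>.\<close>

lemma nilpotent_no_fixed_set:
  assumes A: "superalgebra A" and n: "nilpotent_alg A"
    and S: "S \<subseteq> module.span (scl A) {mult A s y |s y. s \<in> S}"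
  shows "S \<subseteq> {0}"
proof -
  interpret vector_space "scl A" using A by (rule superalgebra_vs)
  have "S \<subseteq> alg_power A (Suc k)" for k
  proof (induction k)
    case 0
    show ?case by (subst alg_power.simps) simp
  next
    case (Suc k)
    have sub: "subspace (alg_power A (Suc (Suc k)))"
      by (subst alg_power.simps) simp
    have "{mult A s y |s y. s \<in> S} \<subseteq> alg_power A (Suc (Suc k))"
      using Suc alg_power_Suc_mult[OF A, of _ "Suc k"] by auto
    then have "span {mult A s y |s y. s \<in> S} \<subseteq> alg_power A (Suc (Suc k))"
      using sub by (simp add: span_minimal)
    with S show ?case by blast
  qed
  moreover obtain k where "k \<ge> 1" "alg_power A k = {0}"
    using n unfolding nilpotent_alg_def by blast
  ultimately show ?thesis by (metis One_nat_def Suc_le_D)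
qed

text \<open>The part of nilpotency that the case analysis uses: two right multiplications in succession have no
  nonzero eigenvalue. Unlike the powers \<open>J\<^sup>k\<close>, it is refuted by a single computation with structure
  constants.\<close>

definition loop_free :: "'a::ab_group_add superalgebra \<Rightarrow> bool" where
  "loop_free A \<longleftrightarrow> (\<forall>x y z c. mult A (mult A x y) z = scl A c x \<longrightarrow> c = 0 \<or> x = 0)"

text \<open>With \<open>c \<noteq> 0\<close> the set \<open>{x, x y}\<close> would be contained in the span of its own products.\<close>

lemma nilpotent_loop_free:
  assumes A: "superalgebra A" and n: "nilpotent_alg A"
  shows "loop_free A"
  unfolding loop_free_def
proof (intro allI impI)
  fix x y z c
  assume eq: "mult A (mult A x y) z = scl A c x"
  interpret vector_space "scl A" using A by (rule superalgebra_vs)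
  show "c = 0 \<or> x = 0"
  proof (rule ccontr)
    assume neg: "\<not> (c = 0 \<or> x = 0)"
    let ?S = "{x, mult A x y}"
    have "x = scl A (1 / c) (mult A (mult A x y) z)"
      using neg eq by simp
    moreover have "scl A (1 / c) (mult A (mult A x y) z) \<in> span {mult A s y |s y. s \<in> ?S}"
      by (intro span_scale span_base) blast
    ultimately have "x \<in> span {mult A s y |s y. s \<in> ?S}" by metis
    moreover have "mult A x y \<in> span {mult A s y |s y. s \<in> ?S}"
      by (intro span_base) blast
    ultimately have "?S \<subseteq> {0}"
      by (intro nilpotent_no_fixed_set[OF A n]) blast
    with neg show False by simp
  qed
qed

lemma loop_free_iso:
  assumes "A \<cong>\<^sub>s B" "loop_free A"
  shows "loop_free B"
proof -
  obtain f where scl: "\<And>c x. f (scl B c x) = scl A c (f x)" and zero: "\<And>x. f x = 0 \<longleftrightarrow> x = 0"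
    and mult: "\<And>x y. f (mult B x y) = mult A (f x) (f y)"
    by (rule isomorphicE[OF isomorphic_sym[OF assms(1)]]) blast
  show ?thesis
    unfolding loop_free_def
  proof (intro allI impI)
    fix x y z c
    assume "mult B (mult B x y) z = scl B c x"
    then have "f (mult B (mult B x y) z) = f (scl B c x)" by simp
    then have "c = 0 \<or> f x = 0"
      using assms(2) unfolding scl mult loop_free_def by blast
    then show "c = 0 \<or> x = 0"
      unfolding zero .
  qed
qed

lemma jordan_superidentity_iso:
  assumes "A \<cong>\<^sub>s B" "jordan_superidentity A"
  shows "jordan_superidentity B"
proof -
  obtain f where add: "\<And>x y. f (x + y) = f x + f y" and scl: "\<And>c x. f (scl B c x) = scl A c (f x)"
    and zero: "\<And>x. f x = 0 \<longleftrightarrow> x = 0"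
    and mult: "\<And>x y. f (mult B x y) = mult A (f x) (f y)"
    and part: "\<And>x i. f x \<in> part A i \<longleftrightarrow> x \<in> part B i"
    by (rule isomorphicE[OF isomorphic_sym[OF assms(1)]]) blast
  have diff: "f (x - y) = f x - f y" for x y
    using add[of "x - y" y] by (simp add: algebra_simps)
  show ?thesis
    unfolding jordan_superidentity_def Let_def
  proof (intro allI ballI)
    fix pw px py pz w x y z
    assume "w \<in> part B pw" "x \<in> part B px" "y \<in> part B py" "z \<in> part B pz"
    then have "f w \<in> part A pw" "f x \<in> part A px" "f y \<in> part A py" "f z \<in> part A pz"
      by (simp_all add: part)
    note assms(2)[unfolded jordan_superidentity_def Let_def, rule_format, OF this]
    then show "mult B (mult B w x) (mult B y z)
        + scl B (psign (px * py)) (mult B (mult B w y) (mult B x z))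
        + scl B (psign ((px + py) * pz)) (mult B (mult B w z) (mult B x y))
        - scl B (psign (pw * px)) (mult B x (mult B w (mult B y z)))
        - scl B (psign (py * (pw + px))) (mult B y (mult B w (mult B x z)))
        - scl B (psign (pz * (pw + px + py))) (mult B z (mult B w (mult B x y))) = 0"
      by (subst zero[symmetric]) (simp only: add scl mult diff)
  qed
qed

section \<open>Algebras given by multiplication tables\<close>

lemma table_alg_scl [simp]: "scl (table_alg T) = (*s)"
  by (simp add: table_alg_def)

lemma table_alg_mult_nth:
  "mult (table_alg T) x y $ k = (\<Sum>g\<in>UNIV. \<Sum>h\<in>UNIV. x $ g * y $ h * basis_prod T g h $ k)"
  by (simp add: table_alg_def)

lemma table_alg_part: "x \<in> part (table_alg T) i \<longleftrightarrow> (\<forall>g. x $ g \<noteq> 0 \<longrightarrow> gen_parity g = i)"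
  by (simp add: table_alg_def)

lemma even_part_table: "x \<in> part (table_alg T) 0 \<longleftrightarrow> x $ F1 = 0 \<and> x $ F2 = 0 \<and> x $ F3 = 0"
  and odd_part_table: "x \<in> part (table_alg T) 1 \<longleftrightarrow> x $ E1 = 0 \<and> x $ E2 = 0"
  by (auto simp: table_alg_part all_gen)

lemma bv_in_part: "bv g \<in> part (table_alg T) (gen_parity g)"
  by (auto simp: table_alg_part bv_nth)

lemma vector_space_vec: "vector_space ((*s) :: complex \<Rightarrow> complex ^ gen \<Rightarrow> complex ^ gen)"
  by (rule vec.vector_space_axioms)

text \<open>A list of products is only a table if no entry contradicts the grading or supercommutativity, for
  instance by listing a nonzero square of an odd basis vector.\<close>

definition wf_table :: "table \<Rightarrow> bool" where
  "wf_table T \<longleftrightarrow>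
    (\<forall>g h k. basis_prod T g h $ k \<noteq> 0 \<longrightarrow> gen_parity k = gen_parity g + gen_parity h) \<and>
    (\<forall>g h. basis_prod T g h = psign (gen_parity g * gen_parity h) *s basis_prod T h g)"

lemma superalgebra_table_alg:
  assumes "wf_table T"
  shows "superalgebra (table_alg T)"
  unfolding superalgebra_def
proof (intro conjI allI ballI)
  let ?A = "table_alg T"
  show "vector_space (scl ?A)" by (simp add: vector_space_vec)
  show "Vector_Spaces.linear (scl ?A) (scl ?A) (mult ?A x)" for x
    by (rule linear_scl_I) (simp_all add: vector_space_vec vec_eq_iff table_alg_mult_nth
      algebra_simps sum.distrib sum_distrib_left)
  show "Vector_Spaces.linear (scl ?A) (scl ?A) (\<lambda>x. mult ?A x y)" for y
    by (rule linear_scl_I) (simp_all add: vector_space_vec vec_eq_iff table_alg_mult_nth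
      algebra_simps sum.distrib sum_distrib_left)
  have "vec.subspace (part ?A i)" for i
    unfolding vec.subspace_def by (auto simp: table_alg_part) (metis add.right_neutral)+
  then show "module.subspace (scl ?A) (part ?A i)" for i by simp
  show "part ?A 0 \<inter> part ?A 1 = {0}"
    by (auto simp: even_part_table odd_part_table vec_gen_eq)
  show "\<exists>y\<in>part ?A 0. \<exists>z\<in>part ?A 1. x = y + z" for x
    by (rule bexI[of _ "\<chi> g. if gen_parity g = 0 then x $ g else 0"],
        rule bexI[of _ "\<chi> g. if gen_parity g = 0 then 0 else x $ g"])
       (auto simp: even_part_table odd_part_table vec_eq_iff)
  show "mult ?A x y \<in> part ?A (i + j)" if x: "x \<in> part ?A i" and y: "y \<in> part ?A j" for i j x y
    unfolding table_alg_part table_alg_mult_nth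
  proof (intro allI impI)
    fix k
    assume "(\<Sum>g\<in>UNIV. \<Sum>h\<in>UNIV. x $ g * y $ h * basis_prod T g h $ k) \<noteq> 0"
    then obtain g where "(\<Sum>h\<in>UNIV. x $ g * y $ h * basis_prod T g h $ k) \<noteq> 0"
      by (meson sum.not_neutral_contains_not_neutral)
    then obtain h where "x $ g * y $ h * basis_prod T g h $ k \<noteq> 0"
      by (meson sum.not_neutral_contains_not_neutral)
    then have "x $ g \<noteq> 0" "y $ h \<noteq> 0" "basis_prod T g h $ k \<noteq> 0" by auto
    then have "gen_parity g = i" "gen_parity h = j" "gen_parity k = gen_parity g + gen_parity h"
      using x y assms unfolding table_alg_part wf_table_def by blast+
    then show "gen_parity k = i + j" by simp
  qed
qed

lemma supercommutative_table_alg: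
  assumes "wf_table T"
  shows "supercommutative (table_alg T)"
  unfolding supercommutative_def
proof (intro allI ballI)
  fix i j x y
  assume x: "x \<in> part (table_alg T) i" and y: "y \<in> part (table_alg T) j"
  have "mult (table_alg T) x y $ k = (psign (i * j) *s mult (table_alg T) y x) $ k" for k
  proof -
    have eq: "x $ g * y $ h * basis_prod T g h $ k = psign (i * j) * (y $ h * x $ g * basis_prod T h g $ k)" for g h
    proof (cases "x $ g = 0 \<or> y $ h = 0")
      case False
      then have "gen_parity g = i" "gen_parity h = j"
        using x y by (auto simp: table_alg_part)
      moreover have "basis_prod T g h $ k = (psign (gen_parity g * gen_parity h) *s basis_prod T h g) $ k"
        using assms unfolding wf_table_def by metis
      ultimately show ?thesis by simp
    qed auto
    show ?thesis
      unfolding table_alg_mult_nth vector_smult_component sum_distrib_left eq by (rule sum.swap)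
  qed
  then show "mult (table_alg T) x y = scl (table_alg T) (psign (i * j)) (mult (table_alg T) y x)"
    by (simp add: vec_eq_iff)
qed

text \<open>The linear map from coordinate vectors to the algebra that belongs to a family of five vectors; the
  family is a basis exactly when this map is bijective.\<close>

definition comb :: "'a::ab_group_add superalgebra \<Rightarrow> (gen \<Rightarrow> 'a) \<Rightarrow> complex ^ gen \<Rightarrow> 'a" where
  "comb A b x = (\<Sum>g\<in>UNIV. scl A (x $ g) (b g))"

lemma bit_neq: "p \<noteq> i \<Longrightarrow> p = i + 1" for p i :: bit
  by (cases p; cases i) simp_all

text \<open>The map \<open>comb A b\<close> is multiplicative because it is so on basis vectors. It maps the homogeneous
  components onto each other, not just into each other, because the components of \<open>A\<close> meet only in \<open>0\<close>.\<close>

lemma frame_isomorphic: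
  assumes A: "superalgebra A"
    and hom: "\<And>g. b g \<in> part A (gen_parity g)"
    and bij: "bij (comb A b)"
    and prod: "\<And>g h. mult A (b g) (b h) = comb A b (basis_prod T g h)"
  shows "A \<cong>\<^sub>s table_alg T"
proof (rule isomorphic_sym)
  interpret vector_space "scl A" using A by (rule superalgebra_vs)
  let ?f = "comb A b" and ?T = "table_alg T"
  have add: "?f (x + y) = ?f x + ?f y" for x y
    by (simp add: comb_def scale_left_distrib sum.distrib)
  have scl: "?f (c *s x) = scl A c (?f x)" for c x
    by (simp add: comb_def scale_sum_right)
  have sums: "?f (sum h S) = (\<Sum>i\<in>S. ?f (h i))" if "finite S" for h and S :: "gen set"
    using that by induction (simp_all add: add comb_def[of _ _ 0])
  have inj: "x = y" if "?f x = ?f y" for x y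
    using bij that by (meson bij_is_inj injD)
  have lin: "Vector_Spaces.linear (scl ?T) (scl A) ?f"
    by (rule linear_scl_I) (simp_all add: vector_space_vec vector_space_axioms add scl)
  have mul: "?f (mult ?T x y) = mult A (?f x) (?f y)" for x y
  proof -
    have "mult ?T x y = (\<Sum>g\<in>UNIV. \<Sum>h\<in>UNIV. (x $ g * y $ h) *s basis_prod T g h)"
      by (simp add: table_alg_def)
    then have "?f (mult ?T x y) = (\<Sum>g\<in>UNIV. \<Sum>h\<in>UNIV. scl A (x $ g * y $ h) (?f (basis_prod T g h)))"
      by (simp add: sums scl)
    also have "\<dots> = mult A (?f x) (?f y)"
      by (simp add: comb_def[of A b x] comb_def[of A b y] superalgebra_mult_sum[OF A]
        superalgebra_mult[OF A] prod[symmetric] scale_sum_right)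
         (subst sum.swap, simp add: mult.commute)
    finally show ?thesis .
  qed
  have im: "?f x \<in> part A i" if "x \<in> part ?T i" for x i
    unfolding comb_def
  proof (rule subspace_sum)
    show sub: "subspace (part A i)" using superalgebra_part(1)[OF A] .
    show "scl A (x $ g) (b g) \<in> part A i" for g
      using that hom[of g] subspace_0[OF sub] by (cases "x $ g = 0") (auto simp: table_alg_part sub subspace_scale)
  qed
  have "?f ` part ?T i = part A i" for i
  proof
    show "?f ` part ?T i \<subseteq> part A i" using im by blast
    show "part A i \<subseteq> ?f ` part ?T i"
    proof
      fix y assume y: "y \<in> part A i"
      obtain x where x: "?f x = y" using bij by (metis bij_pointE)
      define u where "u = (\<chi> g. if gen_parity g = i then x $ g else 0)"
      define v where "v = (\<chi> g. if gen_parity g = i then 0 else x $ g)"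
      have xuv: "x = u + v" by (simp add: u_def v_def vec_eq_iff)
      have u: "u \<in> part ?T i" by (simp add: u_def table_alg_part)
      have v: "v \<in> part ?T (i + 1)"
        unfolding v_def table_alg_part using bit_neq by auto
      have "?f v = y - ?f u" using x xuv add by (metis add_diff_cancel_left')
      then have "?f v \<in> part A i"
        using im[OF u] y superalgebra_part(1)[OF A] by (simp add: subspace_diff)
      moreover have "?f v \<in> part A (i + 1)" using im[OF v] .
      ultimately have "?f v = 0"
        using superalgebra_part(2)[OF A] by (cases i) auto
      then have "?f u = y" using \<open>?f v = y - ?f u\<close> by simp
      with u show "y \<in> ?f ` part ?T i" by blast
    qed
  qed
  with lin bij mul show "?T \<cong>\<^sub>s A" unfolding isomorphic_def by blast
qed

section \<open>The tables define nilpotent Jordan superalgebras of type (2,3)\<close>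

text \<open>The bilinear extension of a product of basis vectors. Working with it instead of the multiplication of
  a table keeps the table out of the terms that are rewritten.\<close>

definition bilin :: "(gen \<Rightarrow> gen \<Rightarrow> complex ^ gen) \<Rightarrow> complex ^ gen \<Rightarrow> complex ^ gen \<Rightarrow> complex ^ gen" where
  "bilin P x y = (\<Sum>g\<in>UNIV. \<Sum>h\<in>UNIV. (x $ g * y $ h) *s P g h)"

lemma mult_table_alg: "mult (table_alg T) = bilin (basis_prod T)"
  by (simp add: table_alg_def bilin_def fun_eq_iff)

lemma bilin_bv: "bilin P (bv g) (bv h) = P g h"
  unfolding vec_eq_iff bilin_def sum_gen by (cases g; cases h) (simp_all add: bv_nth)

lemma bilin_simps:
  "bilin P (x + y) z = bilin P x z + bilin P y z"
  "bilin P z (x + y) = bilin P z x + bilin P z y"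
  "bilin P (c *s x) z = c *s bilin P x z"
  "bilin P z (c *s x) = c *s bilin P z x"
  "bilin P (- x) z = - bilin P x z"
  "bilin P z (- x) = - bilin P z x"
  "bilin P 0 z = 0"
  "bilin P z 0 = 0"
  by (simp_all add: bilin_def vec_eq_iff algebra_simps sum.distrib sum_distrib_left sum_negf)

lemma bilin_diff:
  "bilin P (x - y) z = bilin P x z - bilin P y z"
  "bilin P z (x - y) = bilin P z x - bilin P z y"
  by (simp_all add: bilin_def vec_eq_iff algebra_simps sum_subtractf)

definition jordan_expr where
  "jordan_expr m pw px py pz w x y z =
     m (m w x) (m y z)
     + psign (px * py) *s m (m w y) (m x z)
     + psign ((px + py) * pz) *s m (m w z) (m x y)
     - psign (pw * px) *s m x (m w (m y z))
     - psign (py * (pw + px)) *s m y (m w (m x z))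
     - psign (pz * (pw + px + py)) *s m z (m w (m x y))"

text \<open>Multilinear identities for homogeneous elements are reduced to basis vectors one argument at a time.
  Only the basis vectors of the right parity occur, which matters because the signs in the Jordan
  superidentity depend on the parities.\<close>

lemma vanishes_on_part:
  assumes add: "\<And>x y. f (x + y) = f x + f y" and scl: "\<And>c x. f (c *s x) = c *s f x"
    and bv: "\<And>g. gen_parity g = i \<Longrightarrow> f (bv g) = 0" and x: "x \<in> part (table_alg T) i"
  shows "f x = (0 :: complex ^ gen)"
proof -
  have term0: "f (x $ g *s bv g) = 0" for g
    using bv[of g] x scl[of 0 0] by (cases "x $ g = 0") (auto simp: table_alg_part scl)
  have "x = x $ E1 *s bv E1 + (x $ E2 *s bv E2 + (x $ F1 *s bv F1 + (x $ F2 *s bv F2 + x $ F3 *s bv F3)))"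
    by (simp add: vec_gen_eq bv_nth)
  then have "f x = f (x $ E1 *s bv E1 + (x $ E2 *s bv E2 + (x $ F1 *s bv F1 + (x $ F2 *s bv F2 + x $ F3 *s bv F3))))"
    by (rule arg_cong)
  also have "\<dots> = 0" by (simp only: add term0 add_0)
  finally show ?thesis .
qed

lemma jordan_superidentity_on_basis:
  assumes "\<And>w x y z. jordan_expr (bilin (basis_prod T)) (gen_parity w) (gen_parity x) (gen_parity y) (gen_parity z)
      (bv w) (bv x) (bv y) (bv z) = 0"
  shows "jordan_superidentity (table_alg T)"
proof -
  let ?J = "jordan_expr (bilin (basis_prod T))" and ?P = "part (table_alg T)"
  have lin: "?J a b c d (u + w) x y z = ?J a b c d u x y z + ?J a b c d w x y z"
     "?J a b c d w (u + x) y z = ?J a b c d w u y z + ?J a b c d w x y z"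
     "?J a b c d w x (u + y) z = ?J a b c d w x u z + ?J a b c d w x y z"
     "?J a b c d w x y (u + z) = ?J a b c d w x y u + ?J a b c d w x y z"
     "?J a b c d (r *s w) x y z = r *s ?J a b c d w x y z"
     "?J a b c d w (r *s x) y z = r *s ?J a b c d w x y z"
     "?J a b c d w x (r *s y) z = r *s ?J a b c d w x y z"
     "?J a b c d w x y (r *s z) = r *s ?J a b c d w x y z" for a b c d u w x y z r
    by (simp_all add: jordan_expr_def bilin_simps algebra_simps)
  have 1: "?J a (gen_parity x) (gen_parity y) (gen_parity z) w (bv x) (bv y) (bv z) = 0" if "w \<in> ?P a" for a w x y z
    by (rule vanishes_on_part[OF _ _ _ that]) (auto simp: lin assms)
  have 2: "?J a b (gen_parity y) (gen_parity z) w x (bv y) (bv z) = 0" if "w \<in> ?P a" "x \<in> ?P b" for a b w x y z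
    by (rule vanishes_on_part[OF _ _ _ that(2)]) (auto simp: lin 1 that)
  have 3: "?J a b c (gen_parity z) w x y (bv z) = 0" if "w \<in> ?P a" "x \<in> ?P b" "y \<in> ?P c" for a b c w x y z
    by (rule vanishes_on_part[OF _ _ _ that(3)]) (auto simp: lin 2 that)
  have "?J a b c d w x y z = 0" if "w \<in> ?P a" "x \<in> ?P b" "y \<in> ?P c" "z \<in> ?P d" for a b c d w x y z
    by (rule vanishes_on_part[OF _ _ _ that(4)]) (auto simp: lin 3 that)
  then show ?thesis
    unfolding jordan_superidentity_def Let_def jordan_expr_def mult_table_alg table_alg_scl by blast
qed

text \<open>The values on the twelve increasing pairs, extended by supercommutativity. In this form a table is
  evaluated without searching its list of entries.\<close>

fun gprod :: "complex ^ gen \<Rightarrow> complex ^ gen \<Rightarrow> complex ^ gen \<Rightarrow> complex ^ gen \<Rightarrow> complex ^ gen \<Rightarrow> complex ^ gen \<Rightarrow>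
    complex ^ gen \<Rightarrow> complex ^ gen \<Rightarrow> complex ^ gen \<Rightarrow> complex ^ gen \<Rightarrow> complex ^ gen \<Rightarrow> complex ^ gen \<Rightarrow>
    gen \<Rightarrow> gen \<Rightarrow> complex ^ gen" where
  "gprod a11 a12 a22 b11 b12 b13 b21 b22 b23 c12 c13 c23 E1 h =
    (case h of E1 \<Rightarrow> a11 | E2 \<Rightarrow> a12 | F1 \<Rightarrow> b11 | F2 \<Rightarrow> b12 | F3 \<Rightarrow> b13)"
| "gprod a11 a12 a22 b11 b12 b13 b21 b22 b23 c12 c13 c23 E2 h =
    (case h of E1 \<Rightarrow> a12 | E2 \<Rightarrow> a22 | F1 \<Rightarrow> b21 | F2 \<Rightarrow> b22 | F3 \<Rightarrow> b23)"
| "gprod a11 a12 a22 b11 b12 b13 b21 b22 b23 c12 c13 c23 F1 h =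
    (case h of E1 \<Rightarrow> b11 | E2 \<Rightarrow> b21 | F1 \<Rightarrow> 0 | F2 \<Rightarrow> c12 | F3 \<Rightarrow> c13)"
| "gprod a11 a12 a22 b11 b12 b13 b21 b22 b23 c12 c13 c23 F2 h =
    (case h of E1 \<Rightarrow> b12 | E2 \<Rightarrow> b22 | F1 \<Rightarrow> - c12 | F2 \<Rightarrow> 0 | F3 \<Rightarrow> c23)"
| "gprod a11 a12 a22 b11 b12 b13 b21 b22 b23 c12 c13 c23 F3 h =
    (case h of E1 \<Rightarrow> b13 | E2 \<Rightarrow> b23 | F1 \<Rightarrow> - c13 | F2 \<Rightarrow> - c23 | F3 \<Rightarrow> 0)"

text \<open>The assumptions have the shape in which the values of a concrete table are obtained by evaluation, so
  that the twelve right-hand sides can be left as unknowns when this rule is applied.\<close>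

lemma basis_prod_gprod:
  assumes "wf_table T"
    and "basis_prod T E1 E1 = a11" "basis_prod T E1 E2 = a12" "basis_prod T E2 E2 = a22"
    and "basis_prod T E1 F1 = b11" "basis_prod T E1 F2 = b12" "basis_prod T E1 F3 = b13"
    and "basis_prod T E2 F1 = b21" "basis_prod T E2 F2 = b22" "basis_prod T E2 F3 = b23"
    and "basis_prod T F1 F2 = c12" "basis_prod T F1 F3 = c13" "basis_prod T F2 F3 = c23"
  shows "basis_prod T = gprod a11 a12 a22 b11 b12 b13 b21 b22 b23 c12 c13 c23"
proof (intro ext)
  fix g h
  have s: "basis_prod T g h = psign (gen_parity g * gen_parity h) *s basis_prod T h g" for g h
    using assms(1) unfolding wf_table_def by blast
  have "basis_prod T g g = 0" if "gen_parity g = 1" for g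
    using arg_cong[OF s[of g g], of "\<lambda>v. v $ k" for k] that by (simp add: psign_def vec_eq_iff)
  then show "basis_prod T g h = gprod a11 a12 a22 b11 b12 b13 b21 b22 b23 c12 c13 c23 g h"
    using assms(2-) s[of g h] by (cases g; cases h) (simp_all add: psign_def)
qed

lemma wf_tables: "(k, T) \<in> set (tables t) \<Longrightarrow> wf_table T"
  unfolding tables_def
  by (simp only: list.set insert_iff empty_iff prod.inject simp_thms, elim disjE; clarify)
     (simp add: wf_table_def all_gen basis_prod_def bv_nth psign_def)+

lemma jordan_superidentityI:
  assumes "wf_table T"
    and "basis_prod T E1 E1 = a11" "basis_prod T E1 E2 = a12" "basis_prod T E2 E2 = a22"
    and "basis_prod T E1 F1 = b11" "basis_prod T E1 F2 = b12" "basis_prod T E1 F3 = b13"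
    and "basis_prod T E2 F1 = b21" "basis_prod T E2 F2 = b22" "basis_prod T E2 F3 = b23"
    and "basis_prod T F1 F2 = c12" "basis_prod T F1 F3 = c13" "basis_prod T F2 F3 = c23"
    and "\<And>w x y z. jordan_expr (bilin (gprod a11 a12 a22 b11 b12 b13 b21 b22 b23 c12 c13 c23))
       (gen_parity w) (gen_parity x) (gen_parity y) (gen_parity z) (bv w) (bv x) (bv y) (bv z) = 0"
  shows "jordan_superidentity (table_alg T)"
  by (rule jordan_superidentity_on_basis) (simp only: basis_prod_gprod[OF assms(1-13)] assms(14))

lemma jordan_tables: "(k, T) \<in> set (tables t) \<Longrightarrow> jordan_superidentity (table_alg T)"
  apply (frule wf_tables)
  unfolding tables_def
  apply (simp only: list.set insert_iff empty_iff prod.inject simp_thms, elim disjE; clarify)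
  apply (rule jordan_superidentityI, assumption, (simp add: basis_prod_def; fail)+,
   (case_tac w; case_tac x; case_tac y; case_tac z; 
    simp only: jordan_expr_def bilin_bv bilin_simps gprod.simps gen.case vec.scale_zero_right minus_zero add_0 diff_0; simp add: psign_def))+
  done

text \<open>With positive weights that are superadditive along products, \<open>J\<^sup>n\<close> only involves basis vectors of
  weight at least \<open>n\<close>, and these run out.\<close>

lemma nilpotent_table_algI:
  assumes wt: "\<And>g h k. basis_prod T g h $ k \<noteq> 0 \<Longrightarrow> wt g + wt h \<le> (wt k :: nat)" and pos: "\<And>g. 1 \<le> wt g"
  shows "nilpotent_alg (table_alg T)"
proof -
  \<comment> \<open>the filtration by weight\<close>
  define F where "F n = {x :: complex ^ gen. \<forall>k. x $ k \<noteq> 0 \<longrightarrow> n \<le> wt k}" for n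
  have sub: "vec.subspace (F n)" for n
    unfolding vec.subspace_def F_def by (auto) (metis add_cancel_right_right add.right_neutral)
  have mult: "mult (table_alg T) x y \<in> F (i + j)" if "x \<in> F i" "y \<in> F j" for x y i j
    unfolding F_def mem_Collect_eq table_alg_mult_nth
  proof (intro allI impI)
    fix k
    assume "(\<Sum>g\<in>UNIV. \<Sum>h\<in>UNIV. x $ g * y $ h * basis_prod T g h $ k) \<noteq> 0"
    then obtain g where "(\<Sum>h\<in>UNIV. x $ g * y $ h * basis_prod T g h $ k) \<noteq> 0"
      by (meson sum.not_neutral_contains_not_neutral)
    then obtain h where "x $ g * y $ h * basis_prod T g h $ k \<noteq> 0"
      by (meson sum.not_neutral_contains_not_neutral)
    then have "i \<le> wt g" "j \<le> wt h" "wt g + wt h \<le> wt k"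
      using that wt by (auto simp: F_def)
    then show "i + j \<le> wt k" by simp
  qed
  have pow: "alg_power (table_alg T) n \<subseteq> F n" for n
  proof (induction n rule: less_induct)
    case (less n)
    show ?case
    proof (cases "n \<le> 1")
      case True
      then have "F n = UNIV" using pos by (auto simp: F_def intro: order_trans)
      then show ?thesis by simp
    next
      case False
      have "(\<Union>i\<in>{1..<n}. (\<lambda>(x, y). mult (table_alg T) x y) `
          (alg_power (table_alg T) i \<times> alg_power (table_alg T) (n - i))) \<subseteq> F n"
      proof clarify
        fix i x y
        assume i: "i \<in> {1..<n}" and xy: "x \<in> alg_power (table_alg T) i" "y \<in> alg_power (table_alg T) (n - i)"
        have "x \<in> F i" "y \<in> F (n - i)" using xy i less.IH[of i] less.IH[of "n - i"] by auto
        then show "mult (table_alg T) x y \<in> F n" using mult[of x i y "n - i"] i by simp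
      qed
      then have "vec.span (\<Union>i\<in>{1..<n}. (\<lambda>(x, y). mult (table_alg T) x y) `
          (alg_power (table_alg T) i \<times> alg_power (table_alg T) (n - i))) \<subseteq> F n"
        using sub by (rule vec.span_minimal)
      then show ?thesis using False by (subst alg_power.simps) simp
    qed
  qed
  define N where "N = Suc (Max (range wt))"
  have "wt k < N" for k by (simp add: N_def le_imp_less_Suc)
  then have "\<not> N \<le> wt k" for k by (simp add: not_le)
  then have "F N = {0}" by (auto simp: F_def vec_eq_iff)
  moreover have "0 \<in> alg_power (table_alg T) N"
    by (subst alg_power.simps) (simp add: vec.span_zero)
  ultimately have "alg_power (table_alg T) N = {0}" using pow[of N] by auto
  moreover have "1 \<le> N" by (simp add: N_def)
  ultimately show ?thesis unfolding nilpotent_alg_def by blast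
qed

lemma has_type_table_alg: "has_type (table_alg T) 2 3"
proof -
  have ind: "vec.independent (bv ` S)" for S :: "gen set"
    by (rule vec.independent_mono[OF independent_cart_basis]) (auto simp: bv_def cart_basis_def)
  have inj: "card (bv ` S) = card S" for S :: "gen set"
    by (rule card_image) (auto simp: inj_on_def bv_def axis_eq_axis)
  have span: "x \<in> vec.span (bv ` S)" if "\<And>g. x $ g \<noteq> 0 \<Longrightarrow> g \<in> S" for x S
  proof -
    have "x = x $ E1 *s bv E1 + (x $ E2 *s bv E2 + (x $ F1 *s bv F1 + (x $ F2 *s bv F2 + x $ F3 *s bv F3)))"
      by (simp add: vec_gen_eq bv_nth)
    moreover have "x $ g *s bv g \<in> vec.span (bv ` S)" for g
      using that[of g] by (cases "x $ g = 0") (simp_all add: vec.span_scale vec.span_base vec.span_zero)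
    ultimately show ?thesis by (metis vec.span_add)
  qed
  have "vec.span (bv ` UNIV) = UNIV" using span[of _ UNIV] by auto
  moreover have "vec.dim (part (table_alg T) i) = card {g. gen_parity g = i}" for i
  proof (rule vec.dim_unique)
    show "bv ` {g. gen_parity g = i} \<subseteq> part (table_alg T) i" using bv_in_part by auto
    show "part (table_alg T) i \<subseteq> vec.span (bv ` {g. gen_parity g = i})"
      using span by (auto simp: table_alg_part)
  qed (fact ind inj)+
  moreover have "{g. gen_parity g = 0} = {E1, E2}" "{g. gen_parity g = 1} = {F1, F2, F3}"
    by (auto simp: set_eq_iff all_gen)
  ultimately show ?thesis
    unfolding has_type_def table_alg_scl by (intro conjI exI[of _ "bv ` UNIV"]) auto
qed

definition weights :: "nat list \<Rightarrow> gen \<Rightarrow> nat" where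
  "weights w g = w ! (case g of E1 \<Rightarrow> 0 | E2 \<Rightarrow> 1 | F1 \<Rightarrow> 2 | F2 \<Rightarrow> 3 | F3 \<Rightarrow> 4)"

text \<open>Weights of \<open>e\<^sub>1, e\<^sub>2, f\<^sub>1, f\<^sub>2, f\<^sub>3\<close>; each table admits one of these nine lists. No single list serves
  all tables: table 13 needs \<open>f\<^sub>3\<close> heavier than \<open>f\<^sub>2\<close>, and table 16 needs the opposite.\<close>

definition weight_lists :: "nat list list" where
  "weight_lists = [[1, 3, 5, 2, 1], [2, 4, 3, 1, 1], [2, 4, 1, 1, 1], [1, 2, 4, 1, 3], [2, 4, 5, 1, 1],
    [1, 4, 3, 2, 1], [1, 1, 3, 2, 1], [1, 3, 2, 1, 4], [1, 3, 4, 1, 2]]"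

lemma weights_tables: "(k, T) \<in> set (tables t) \<Longrightarrow> \<exists>w \<in> set weight_lists. \<forall>((g, h), v) \<in> set T.
    \<forall>k. v $ k \<noteq> 0 \<longrightarrow> weights w g + weights w h \<le> weights w k"
  unfolding tables_def
  by (simp only: list.set insert_iff empty_iff prod.inject simp_thms, elim disjE; clarify)
     (simp add: weight_lists_def weights_def all_gen bv_nth; fail | force simp: weight_lists_def)+

lemma nilpotent_tables:
  assumes "(k, T) \<in> set (tables t)"
  shows "nilpotent_alg (table_alg T)"
proof -
  obtain w where pos: "w \<in> set weight_lists"
    and w: "\<And>g h v k. ((g, h), v) \<in> set T \<Longrightarrow> v $ k \<noteq> 0 \<Longrightarrow> weights w g + weights w h \<le> weights w k"
    using weights_tables[OF assms] by fast
  show ?thesis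
  proof (rule nilpotent_table_algI)
    show "1 \<le> weights w g" for g
      using pos by (cases g) (auto simp: weight_lists_def weights_def)
    fix g h k assume "basis_prod T g h $ k \<noteq> 0"
    then obtain v where "((g, h), v) \<in> set T \<or> ((h, g), v) \<in> set T" "v $ k \<noteq> 0"
      unfolding basis_prod_def by (auto split: option.splits dest: map_of_SomeD)
    then show "weights w g + weights w h \<le> weights w k"
      using w[of g h v k] w[of h g v k] by auto
  qed
qed

section \<open>Invariants separating the tables\<close>

text \<open>Multilinear identities are invariant under isomorphism and can be decided on basis vectors. The tables
  that agree on these ten are told apart by \<open>annihilator_invariants\<close> and the parameters.\<close>

definition word_invariants :: "'a::ab_group_add superalgebra \<Rightarrow> bool list" where
  "word_invariants A = (let m = mult A; U = part A 0; V = part A 1 in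
    [\<forall>a\<in>U. \<forall>b\<in>U. m a b = 0,
     \<forall>a\<in>U. \<forall>f\<in>V. m a f = 0,
     \<forall>f\<in>V. \<forall>g\<in>V. m f g = 0,
     \<forall>a\<in>U. \<forall>b\<in>U. \<forall>f\<in>V. m a (m b f) = 0,
     \<forall>a\<in>U. \<forall>f\<in>V. \<forall>g\<in>V. m (m a f) g = 0,
     \<forall>f\<in>V. \<forall>g\<in>V. \<forall>h\<in>V. m (m f g) h = 0,
     \<forall>a\<in>U. \<forall>f\<in>V. \<forall>g\<in>V. m a (m f g) = 0,
     \<forall>a\<in>U. \<forall>b\<in>U. \<forall>f\<in>V. m (m a b) f = 0,
     \<forall>a\<in>U. \<forall>b\<in>U. \<forall>f\<in>V. m a (m b f) - m b (m a f) = 0,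
     \<forall>a\<in>U. \<forall>f\<in>V. \<forall>g\<in>V. m (m a f) g - m (m a g) f = 0])"

text \<open>Tables such as 2 and 3, or 11 and 13, agree on all of \<open>word_invariants\<close>. They differ in the ranks of
  their products, which these conditions detect through annihilators.\<close>

definition annihilator_invariants :: "'a::ab_group_add superalgebra \<Rightarrow> bool list" where
  "annihilator_invariants A = (let m = mult A; U = part A 0; V = part A 1 in
    [\<exists>a\<in>U. a \<noteq> 0 \<and> (\<forall>f\<in>V. m a f = 0),
     \<exists>f\<in>V. f \<noteq> 0 \<and> (\<forall>g\<in>V. m f g = 0),
     \<forall>f\<in>V. \<exists>a\<in>U. a \<noteq> 0 \<and> m a f = 0])"

lemma invariants_iso:
  assumes "A \<cong>\<^sub>s B"
  shows "word_invariants A = word_invariants B" "annihilator_invariants A = annihilator_invariants B"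
proof -
  obtain f where add: "\<And>x y. f (x + y) = f x + f y"
    and zero: "\<And>x. f x = 0 \<longleftrightarrow> x = 0"
    and mult: "\<And>x y. f (mult A x y) = mult B (f x) (f y)"
    and part: "\<And>x i. f x \<in> part B i \<longleftrightarrow> x \<in> part A i" and surj: "\<And>y. \<exists>x. f x = y"
    by (rule isomorphicE[OF assms]) blast
  have diff: "f (x - y) = f x - f y" for x y
    using add[of "x - y" y] by (simp add: algebra_simps)
  have ball: "(\<forall>y\<in>part B i. Q y) \<longleftrightarrow> (\<forall>x\<in>part A i. Q (f x))" for i Q
    by (metis part surj)
  have bex: "(\<exists>y\<in>part B i. Q y) \<longleftrightarrow> (\<exists>x\<in>part A i. Q (f x))" for i Q
    by (metis part surj)
  show "word_invariants A = word_invariants B"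
    unfolding word_invariants_def Let_def ball by (simp only: mult[symmetric] diff[symmetric] zero)
  show "annihilator_invariants A = annihilator_invariants B"
    unfolding annihilator_invariants_def Let_def ball bex by (simp only: mult[symmetric] zero)
qed

definition vec_lin :: "(complex ^ gen \<Rightarrow> complex ^ gen) \<Rightarrow> bool" where
  "vec_lin f \<longleftrightarrow> (\<forall>x y. f (x + y) = f x + f y) \<and> (\<forall>c x. f (c *s x) = c *s f x)"

text \<open>As rewrite rules, these replace a quantifier over a homogeneous component by finitely many basis
  vectors, provided that the quantified variable occurs linearly.\<close>

lemma ball_part_lin:
  assumes "vec_lin f"
  shows "(\<forall>x\<in>part (table_alg T) 0. f x = 0) \<longleftrightarrow> f (bv E1) = 0 \<and> f (bv E2) = 0"
    and "(\<forall>x\<in>part (table_alg T) 1. f x = 0) \<longleftrightarrow> f (bv F1) = 0 \<and> f (bv F2) = 0 \<and> f (bv F3) = 0"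
proof -
  have *: "f (x + y) = f x + f y" "f (c *s x) = c *s f x" for x y c
    using assms by (auto simp: vec_lin_def)
  have "(\<forall>x\<in>part (table_alg T) i. f x = 0) \<longleftrightarrow> (\<forall>g. gen_parity g = i \<longrightarrow> f (bv g) = 0)" for i
    using vanishes_on_part[of f, OF *] bv_in_part by blast
  then show "(\<forall>x\<in>part (table_alg T) 0. f x = 0) \<longleftrightarrow> f (bv E1) = 0 \<and> f (bv E2) = 0"
    and "(\<forall>x\<in>part (table_alg T) 1. f x = 0) \<longleftrightarrow> f (bv F1) = 0 \<and> f (bv F2) = 0 \<and> f (bv F3) = 0"
    by (simp_all add: all_gen)
qed

lemma vec_lin_bilin:
  "vec_lin (\<lambda>x. bilin P x y)" "vec_lin (\<lambda>x. bilin P y x)"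
  "vec_lin (\<lambda>x. bilin P (bilin P x y) z)" "vec_lin (\<lambda>x. bilin P (bilin P y x) z)"
  "vec_lin (\<lambda>x. bilin P y (bilin P x z))" "vec_lin (\<lambda>x. bilin P y (bilin P z x))"
  "vec_lin (\<lambda>x. bilin P y (bilin P z x) - bilin P z (bilin P y x))"
  "vec_lin (\<lambda>x. bilin P x (bilin P z y) - bilin P z (bilin P x y))"
  "vec_lin (\<lambda>x. bilin P z (bilin P x y) - bilin P x (bilin P z y))"
  "vec_lin (\<lambda>x. bilin P (bilin P x y) z - bilin P (bilin P x z) y)"
  "vec_lin (\<lambda>x. bilin P (bilin P y x) z - bilin P (bilin P y z) x)"
  "vec_lin (\<lambda>x. bilin P (bilin P y z) x - bilin P (bilin P y x) z)"
  by (simp_all add: vec_lin_def bilin_simps algebra_simps)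

lemmas ball_part_words =
  ball_part_lin[OF vec_lin_bilin(1)] ball_part_lin[OF vec_lin_bilin(2)] ball_part_lin[OF vec_lin_bilin(3)]
  ball_part_lin[OF vec_lin_bilin(4)] ball_part_lin[OF vec_lin_bilin(5)] ball_part_lin[OF vec_lin_bilin(6)]
  ball_part_lin[OF vec_lin_bilin(7)] ball_part_lin[OF vec_lin_bilin(8)] ball_part_lin[OF vec_lin_bilin(9)]
  ball_part_lin[OF vec_lin_bilin(10)] ball_part_lin[OF vec_lin_bilin(11)] ball_part_lin[OF vec_lin_bilin(12)]

lemma even_odd_expand:
  "(\<exists>x\<in>part (table_alg T) 0. Q x) \<longleftrightarrow> (\<exists>a b. Q (a *s bv E1 + b *s bv E2))"
  "(\<forall>x\<in>part (table_alg T) 1. Q x) \<longleftrightarrow> (\<forall>a b c. Q (a *s bv F1 + b *s bv F2 + c *s bv F3))"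
  "(\<exists>x\<in>part (table_alg T) 1. Q x) \<longleftrightarrow> (\<exists>a b c. Q (a *s bv F1 + b *s bv F2 + c *s bv F3))"
proof -
  have 0: "x = x $ E1 *s bv E1 + x $ E2 *s bv E2" if "x \<in> part (table_alg T) 0" for x
    using that by (simp add: even_part_table vec_gen_eq bv_nth)
  have 1: "x = x $ F1 *s bv F1 + x $ F2 *s bv F2 + x $ F3 *s bv F3" if "x \<in> part (table_alg T) 1" for x
    using that by (simp add: odd_part_table vec_gen_eq bv_nth)
  have 2: "a *s bv E1 + b *s bv E2 \<in> part (table_alg T) 0"
    "a *s bv F1 + b *s bv F2 + c *s bv F3 \<in> part (table_alg T) 1" for a b c
    by (simp_all add: even_part_table odd_part_table bv_nth)
  show "(\<exists>x\<in>part (table_alg T) 0. Q x) \<longleftrightarrow> (\<exists>a b. Q (a *s bv E1 + b *s bv E2))" using 0 2(1) by metis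
  show "(\<forall>x\<in>part (table_alg T) 1. Q x) \<longleftrightarrow> (\<forall>a b c. Q (a *s bv F1 + b *s bv F2 + c *s bv F3))" using 1 2(2) by metis
  show "(\<exists>x\<in>part (table_alg T) 1. Q x) \<longleftrightarrow> (\<exists>a b c. Q (a *s bv F1 + b *s bv F2 + c *s bv F3))" using 1 2(2) by metis
qed

lemma mult_table_alg_gprod:
  assumes "wf_table T"
    and "basis_prod T E1 E1 = a11" "basis_prod T E1 E2 = a12" "basis_prod T E2 E2 = a22"
    and "basis_prod T E1 F1 = b11" "basis_prod T E1 F2 = b12" "basis_prod T E1 F3 = b13"
    and "basis_prod T E2 F1 = b21" "basis_prod T E2 F2 = b22" "basis_prod T E2 F3 = b23"
    and "basis_prod T F1 F2 = c12" "basis_prod T F1 F3 = c13" "basis_prod T F2 F3 = c23"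
    and "Q (bilin (gprod a11 a12 a22 b11 b12 b13 b21 b22 b23 c12 c13 c23))"
  shows "Q (mult (table_alg T))"
  using assms(14) by (simp only: basis_prod_gprod[OF assms(1-13)] mult_table_alg)

lemma bv_nonzero: "bv g \<noteq> 0"
  by (auto simp: vec_eq_iff bv_nth)

lemma ex_nonzero: "\<exists>x::complex. x \<noteq> 0"
  by (rule exI[of _ 1]) simp

text \<open>The truth values of \<open>word_invariants\<close> on table number \<open>k\<close>. The fourth one, \<open>J\<^sub>0 (J\<^sub>0 J\<^sub>1) = 0\<close>, depends
  on the parameter in the tables 43 and 44, where \<open>e\<^sub>1 (e\<^sub>1 f\<^sub>2) = t f\<^sub>1\<close>.\<close>

definition word_signature :: "nat \<Rightarrow> complex \<Rightarrow> bool list" where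
  "word_signature k t =
    [k \<notin> {21..44},
     k \<in> {1, 2, 3, 21, 22, 23, 24},
     k \<in> {1, 4, 11, 13, 15, 16, 19, 21, 25, 32, 35, 39, 42, 43},
     k \<notin> {15..20} \<union> {32, 33, 34} \<and> (k \<in> {43, 44} \<longrightarrow> t = 0),
     k \<notin> {5, 7, 9, 10, 14, 17, 18, 20, 27, 28, 30, 31, 33, 34, 44},
     k \<notin> {8, 9, 10, 12, 14, 20, 29, 30, 31, 36, 38, 40, 41, 44},
     k \<notin> {22, 24, 29, 30, 31, 37, 38, 41},
     k \<notin> {35..44},
     k \<noteq> 15,
     k \<notin> {7, 10, 18, 28, 31, 33}]"

lemma word_invariants_tables:
  "(k, T) \<in> set (tables t) \<Longrightarrow> (k = 31 \<longrightarrow> t \<noteq> 0) \<Longrightarrow> word_invariants (table_alg T) = word_signature k t"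
  apply (frule wf_tables)
  unfolding tables_def
  apply (simp only: list.set insert_iff empty_iff prod.inject simp_thms, elim disjE; clarify)
  unfolding word_invariants_def Let_def word_signature_def
  apply (rule mult_table_alg_gprod, assumption, (simp add: basis_prod_def; fail)+,
     simp only: ball_part_words ball_conj_distrib,
     simp only: bilin_bv bilin_simps gprod.simps gen.case,
     simp add: bilin_bv bilin_simps bv_nonzero)+
  done

definition annihilator_signature :: "nat \<Rightarrow> bool list" where
  "annihilator_signature k =
    [k \<notin> {11..15} \<union> {19, 20} \<union> {39..44},
     k \<notin> {3, 9, 10, 24, 30, 31},
     k \<notin> {13, 14, 15, 19, 20, 42, 43, 44}]"

lemma ex_nonzeros: 
  "\<exists>a b::complex. a \<noteq> 0 \<or> b \<noteq> 0" 
  "\<exists>a b c::complex. a \<noteq> 0 \<or> b \<noteq> 0 \<or> c \<noteq> 0" 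
  "\<exists>x::complex. x \<noteq> 0 \<and> -x \<noteq> 0" 
  by (metis one_neq_zero neg_equal_0_iff_equal)+

lemma ex_linear_relation:
  "\<exists>a b::complex. (a = 0 \<longrightarrow> b \<noteq> 0) \<and> x * a + y * b = 0"
  "\<exists>a b::complex. (a = 0 \<longrightarrow> b \<noteq> 0) \<and> y * b + x * a = 0"
proof -
  show "\<exists>a b::complex. (a = 0 \<longrightarrow> b \<noteq> 0) \<and> x * a + y * b = 0"
  proof (cases "x = 0")
    case True
    then show ?thesis by (intro exI[of _ 1] exI[of _ 0]) simp
  next
    case False
    then show ?thesis by (intro exI[of _ y] exI[of _ "- x"]) simp
  qed
  then show "\<exists>a b::complex. (a = 0 \<longrightarrow> b \<noteq> 0) \<and> y * b + x * a = 0"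
    by (simp only: add.commute)
qed

lemma combination_eq_0: "a *s bv E1 + b *s bv E2 = 0 \<longleftrightarrow> a = 0 \<and> b = 0"
  "a *s bv F1 + b *s bv F2 + c *s bv F3 = 0 \<longleftrightarrow> a = 0 \<and> b = 0 \<and> c = 0"
  by (auto simp: vec_gen_eq bv_nth)

lemma annihilator_invariants_tables:
  "(k, T) \<in> set (tables t) \<Longrightarrow> (k = 31 \<longrightarrow> t \<noteq> 0) \<Longrightarrow> annihilator_invariants (table_alg T) = annihilator_signature k"
  apply (frule wf_tables)
  unfolding tables_def
  apply (simp only: list.set insert_iff empty_iff prod.inject simp_thms, elim disjE; clarify)
  unfolding annihilator_invariants_def Let_def annihilator_signature_def
  apply (rule mult_table_alg_gprod, assumption, (simp add: basis_prod_def; fail)+,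
     simp only: ball_part_words even_odd_expand combination_eq_0,
     simp only: bilin_bv bilin_simps gprod.simps gen.case,
     (simp add: bilin_bv bilin_simps bv_nonzero vec_gen_eq bv_nth ex_nonzero ex_nonzeros ex_linear_relation ex_linear_relation(1)[of 1 1, simplified])?,
     ((intro allI exI[of _ 0], (simp; fail)) | (rule allI, rule exI[of _ 1], rule exI[of _ 0], (simp; fail)) | ((rule exI[of _ 1])+, (auto simp: add_eq_0_iff; fail)))?)+
  done

lemma upt_1_45: "[1..<45] = [1, 2, 3, 4, 5, 6, 7, 8, 9, 10, 11, 12, 13, 14, 15, 16, 17, 18, 19,
    20, 21, 22, 23, 24, 25, 26, 27, 28, 29, 30, 31, 32, 33, 34, 35, 36, 37, 38, 39, 40, 41, 42, 43, 44]"
proof -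
  have "[1..<45] = 1 # [2..<45]"
    by (simp add: upt_conv_Cons numeral_2_eq_2)
  then show ?thesis by (simp add: upt_rec_numeral)
qed

lemma J23_table:
  assumes "(k, t) \<in> labels"
  obtains T where "(k, T) \<in> set (tables t)" "J23 k t = table_alg T" "k = 31 \<or> k = 43 \<longrightarrow> t \<noteq> 0"
proof -
  have "k \<in> {1..44}" "k = 31 \<or> k = 43 \<longrightarrow> t \<noteq> 0" using assms by (auto simp: labels_def)
  moreover have "map fst (tables t) = [1..<45]"
    by (simp add: tables_def upt_1_45[simplified])
  then have "fst ` set (tables t) = set [1..<45]"
    by (metis set_map)
  then have "fst ` set (tables t) = {1..44}"
    by auto
  ultimately have "k \<in> fst ` set (tables t)" by simp
  then obtain T where "map_of (tables t) k = Some T"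
    by (metis domD dom_map_of_conv_image_fst)
  then show thesis
    using that[of T] \<open>k = 31 \<or> k = 43 \<longrightarrow> t \<noteq> 0\<close> by (auto simp: J23_def dest: map_of_SomeD)
qed

text \<open>The fourth entry of \<open>word_signature\<close> is left out because it is the only one that depends on the
  parameter.\<close>

definition plain_signature :: "nat \<Rightarrow> bool list" where
  "plain_signature k = take 3 (word_signature k 0) @ drop 4 (word_signature k 0) @ annihilator_signature k"

text \<open>Without the fourth entry, table 44 is still unique, and table 43 can only be confused with 42, in which
  the parameter of 43 has become \<open>0\<close>.\<close>

lemma plain_signature_43_44:
  assumes "k \<in> {1..44}"
  shows "plain_signature k = plain_signature 44 \<Longrightarrow> k = 44"
    and "plain_signature k = plain_signature 43 \<Longrightarrow> k \<in> {42, 43}"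
proof -
  have "plain_signature 44 \<notin> set (map plain_signature (filter (\<lambda>k. k \<noteq> 44) [1..<45]))"
    by (simp add: upt_1_45[simplified] plain_signature_def word_signature_def annihilator_signature_def)
  moreover have "plain_signature k \<in> set (map plain_signature (filter (\<lambda>k. k \<noteq> 44) [1..<45]))" if "k \<noteq> 44"
    unfolding set_map using assms that by (intro imageI) auto
  ultimately show "plain_signature k = plain_signature 44 \<Longrightarrow> k = 44"
    by metis
  have "plain_signature 43 \<notin> set (map plain_signature (filter (\<lambda>k. k \<noteq> 42 \<and> k \<noteq> 43) [1..<45]))"
    by (simp add: upt_1_45[simplified] plain_signature_def word_signature_def annihilator_signature_def)
  moreover have "plain_signature k \<in> set (map plain_signature (filter (\<lambda>k. k \<noteq> 42 \<and> k \<noteq> 43) [1..<45]))"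
    if "k \<noteq> 42" "k \<noteq> 43"
    unfolding set_map using assms that by (intro imageI) auto
  ultimately show "plain_signature k = plain_signature 43 \<Longrightarrow> k \<in> {42, 43}"
    by (metis insert_iff)
qed

lemma full_signature_inj:
  "inj_on (\<lambda>k. word_signature k 0 @ annihilator_signature k) {1..42}"
proof -
  have "distinct (map (\<lambda>k. word_signature k 0 @ annihilator_signature k) (take 42 [1..<45]))"
    by (simp add: upt_1_45[simplified] word_signature_def annihilator_signature_def)
  then have "inj_on (\<lambda>k. word_signature k 0 @ annihilator_signature k) (set (take 42 [1..<45]))"
    by (simp only: distinct_map)
  moreover have "set (take 42 [1..<45]) = {1..42}"
    by (simp add: take_upt) auto
  ultimately show ?thesis by (simp only:)
qed

lemma signatures_separate:
  assumes "(k, t) \<in> labels" "(l, u) \<in> labels"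
    and word: "word_signature k t = word_signature l u" and ann: "annihilator_signature k = annihilator_signature l"
  shows "k = l"
proof -
  have k: "k \<in> {1..44}" "k = 43 \<longrightarrow> t \<noteq> 0" and l: "l \<in> {1..44}" "l = 43 \<longrightarrow> u \<noteq> 0"
    using assms(1,2) by (auto simp: labels_def)
  have plain: "plain_signature k = take 3 (word_signature k t) @ drop 4 (word_signature k t) @ annihilator_signature k" for k t
    by (simp add: plain_signature_def word_signature_def)
  have eq: "plain_signature k = plain_signature l"
    using word ann plain by metis
  have fourth: "word_signature 42 t ! 3" "word_signature 43 t ! 3 \<longleftrightarrow> t = 0" for t
    by (simp_all add: word_signature_def)
  consider "k = 44 \<or> l = 44" | "k = 43" | "l = 43" | "k \<in> {1..42}" "l \<in> {1..42}"
    using k l by fastforce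
  then show ?thesis
  proof cases
    case 1
    then show ?thesis using plain_signature_43_44(1)[of k] plain_signature_43_44(1)[of l] k l eq by auto
  next
    case 2
    then have "l = 42 \<or> l = 43" using plain_signature_43_44(2)[of l] l eq by simp
    then show ?thesis using 2 k word fourth by metis
  next
    case 3
    then have "k = 42 \<or> k = 43" using plain_signature_43_44(2)[of k] k eq by simp
    then show ?thesis using 3 l word fourth by metis
  next
    case 4
    have "word_signature j r = word_signature j 0" if "j \<in> {1..42}" for j r
      using that by (auto simp: word_signature_def)
    then have "word_signature k 0 @ annihilator_signature k = word_signature l 0 @ annihilator_signature l"
      using 4 word ann by metis
    then show ?thesis using 4 by (rule inj_onD[OF full_signature_inj])
  qed
qed

lemma J23_nonisomorphic:
  assumes "(k, t) \<in> labels" "(l, u) \<in> labels" "J23 k t \<cong>\<^sub>s J23 l u"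
  shows "k = l"
proof -
  obtain S where S: "(k, S) \<in> set (tables t)" "J23 k t = table_alg S" "k = 31 \<or> k = 43 \<longrightarrow> t \<noteq> 0"
    using J23_table[OF assms(1)] .
  obtain T where T: "(l, T) \<in> set (tables u)" "J23 l u = table_alg T" "l = 31 \<or> l = 43 \<longrightarrow> u \<noteq> 0"
    using J23_table[OF assms(2)] .
  have "word_signature k t = word_signature l u" "annihilator_signature k = annihilator_signature l"
    using invariants_iso[OF assms(3)] S T
      word_invariants_tables[OF S(1)] word_invariants_tables[OF T(1)]
      annihilator_invariants_tables[OF S(1)] annihilator_invariants_tables[OF T(1)] by simp_all
  with assms(1,2) show ?thesis by (rule signatures_separate)
qed

text \<open>Both identities involve a constant \<open>c\<close>. If it is determined by the algebra, then it is an invariant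
  of the isomorphism class.\<close>

lemma parameter_identities_iso:
  assumes "A \<cong>\<^sub>s B"
  shows "(\<forall>f\<in>part A 1. \<forall>g\<in>part A 1. mult A (mult A (mult A f g) f) g - mult A (mult A (mult A f g) g) f
      = scl A c (mult A (mult A f g) (mult A f g))) \<Longrightarrow>
    (\<forall>f\<in>part B 1. \<forall>g\<in>part B 1. mult B (mult B (mult B f g) f) g - mult B (mult B (mult B f g) g) f
      = scl B c (mult B (mult B f g) (mult B f g)))"
    and "(\<forall>a\<in>part A 0. \<forall>f\<in>part A 1. mult A a (mult A a f) = scl A c (mult A (mult A a a) f)) \<Longrightarrow>
      (\<forall>a\<in>part B 0. \<forall>f\<in>part B 1. mult B a (mult B a f) = scl B c (mult B (mult B a a) f))"
proof -
  obtain f where add: "\<And>x y. f (x + y) = f x + f y" and scl: "\<And>c x. f (scl A c x) = scl B c (f x)"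
    and inj: "\<And>x y. f x = f y \<longleftrightarrow> x = y"
    and mult: "\<And>x y. f (mult A x y) = mult B (f x) (f y)"
    and part: "\<And>x i. f x \<in> part B i \<longleftrightarrow> x \<in> part A i" and surj: "\<And>y. \<exists>x. f x = y"
    by (rule isomorphicE[OF assms]) blast
  have diff: "f (x - y) = f x - f y" for x y
    using add[of "x - y" y] by (simp add: algebra_simps)
  have ball: "(\<forall>y\<in>part B i. Q y) \<longleftrightarrow> (\<forall>x\<in>part A i. Q (f x))" for i Q
    by (metis part surj)
  show "(\<forall>f\<in>part A 1. \<forall>g\<in>part A 1. mult A (mult A (mult A f g) f) g - mult A (mult A (mult A f g) g) f
      = scl A c (mult A (mult A f g) (mult A f g))) \<Longrightarrow>
    (\<forall>f\<in>part B 1. \<forall>g\<in>part B 1. mult B (mult B (mult B f g) f) g - mult B (mult B (mult B f g) g) f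
      = scl B c (mult B (mult B f g) (mult B f g)))"
    unfolding ball by (simp only: mult[symmetric] diff[symmetric] scl[symmetric] inj)
  show "(\<forall>a\<in>part A 0. \<forall>f\<in>part A 1. mult A a (mult A a f) = scl A c (mult A (mult A a a) f)) \<Longrightarrow>
      (\<forall>a\<in>part B 0. \<forall>f\<in>part B 1. mult B a (mult B a f) = scl B c (mult B (mult B a a) f))"
    unfolding ball by (simp only: mult[symmetric] diff[symmetric] scl[symmetric] inj)
qed

lemma table_alg_mult_coords:
  "mult (table_alg T) x y $ k =
   (let p = (\<lambda>g h. x $ g * y $ h * basis_prod T g h $ k) in
     p E1 E1 + p E1 E2 + p E1 F1 + p E1 F2 + p E1 F3
   + p E2 E1 + p E2 E2 + p E2 F1 + p E2 F2 + p E2 F3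
   + p F1 E1 + p F1 E2 + p F1 F1 + p F1 F2 + p F1 F3
   + p F2 E1 + p F2 E2 + p F2 F1 + p F2 F2 + p F2 F3
   + p F3 E1 + p F3 E2 + p F3 F1 + p F3 F2 + p F3 F3)"
  by (simp only: table_alg_mult_nth sum_gen Let_def add.assoc)

text \<open>The identity \<open>((f g) f) g - ((f g) g) f = c (f g) (f g)\<close> for odd \<open>f, g\<close> holds with \<open>c = t\<close>, and
  \<open>f = f\<^sub>2\<close>, \<open>g = f\<^sub>3\<close> shows that it holds for no other \<open>c\<close>, since then \<open>(f g) (f g) = e\<^sub>2\<close>.\<close>

lemma J23_31_iso:
  assumes "J23 31 s \<cong>\<^sub>s J23 31 t"
  shows "s = t"
proof -
  let ?J = "J23 31"
  have m: "mult (?J t) x y $ E1 = x $ F2 * y $ F3 - x $ F3 * y $ F2"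
   "mult (?J t) x y $ E2 = x $ E1 * y $ E1 + t * (x $ F1 * y $ F3 - x $ F3 * y $ F1)"
   "mult (?J t) x y $ F1 = x $ E1 * y $ F2 + x $ F2 * y $ E1"
   "mult (?J t) x y $ F2 = 0" "mult (?J t) x y $ F3 = 0" for t x y
    by (simp_all add: J23_def tables_def table_alg_mult_coords Let_def basis_prod_def bv_nth psign_def algebra_simps)
  have part: "f \<in> part (?J t) 1 \<longleftrightarrow> f $ E1 = 0 \<and> f $ E2 = 0" and scl: "scl (?J t) = (*s)" for f t
    by (simp_all add: J23_def odd_part_table)
  have "\<forall>f\<in>part (?J s) 1. \<forall>g\<in>part (?J s) 1. mult (?J s) (mult (?J s) (mult (?J s) f g) f) g
      - mult (?J s) (mult (?J s) (mult (?J s) f g) g) f = scl (?J s) s (mult (?J s) (mult (?J s) f g) (mult (?J s) f g))"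
    by (auto simp: part scl vec_gen_eq m algebra_simps)
  note parameter_identities_iso(1)[OF assms this]
  from this[rule_format, of "bv F2" "bv F3"] show ?thesis
    by (simp add: part scl vec_gen_eq m bv_nth)
qed

lemma J23_43_44_mult:
  assumes "k = 43 \<or> k = 44"
  shows "mult (J23 k t) x y $ E2 = x $ E1 * y $ E1 + (if k = 44 then x $ F2 * y $ F3 - x $ F3 * y $ F2 else 0)"
   "mult (J23 k t) x y $ F1 = x $ E2 * y $ F2 + x $ F2 * y $ E2 + t * (x $ E1 * y $ F3 + x $ F3 * y $ E1)"
   "mult (J23 k t) x y $ F3 = x $ E1 * y $ F2 + x $ F2 * y $ E1"
   "mult (J23 k t) x y $ E1 = 0" "mult (J23 k t) x y $ F2 = 0"
proof -
  have "J23 k t = table_alg ([((E1, E1), bv E2), ((E1, F2), bv F3), ((E1, F3), t *s bv F1), ((E2, F2), bv F1)]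
      @ (if k = 44 then [((F2, F3), bv E2)] else []))"
    using assms by (elim disjE; hypsubst) (simp_all add: J23_def tables_def)
  then show "mult (J23 k t) x y $ E2 = x $ E1 * y $ E1 + (if k = 44 then x $ F2 * y $ F3 - x $ F3 * y $ F2 else 0)"
   "mult (J23 k t) x y $ F1 = x $ E2 * y $ F2 + x $ F2 * y $ E2 + t * (x $ E1 * y $ F3 + x $ F3 * y $ E1)"
   "mult (J23 k t) x y $ F3 = x $ E1 * y $ F2 + x $ F2 * y $ E1"
   "mult (J23 k t) x y $ E1 = 0" "mult (J23 k t) x y $ F2 = 0"
    by (simp_all add: table_alg_mult_coords Let_def basis_prod_def bv_nth psign_def algebra_simps)
qed

text \<open>The identity \<open>a (a f) = c (a a) f\<close> for even \<open>a\<close> and odd \<open>f\<close> holds with \<open>c = t\<close>, and \<open>a = e\<^sub>1\<close>,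
  \<open>f = f\<^sub>2\<close> shows that it holds for no other \<open>c\<close>, since then \<open>(a a) f = f\<^sub>1\<close>.\<close>

lemma J23_43_44_iso:
  assumes "k = 43 \<or> k = 44" "J23 k s \<cong>\<^sub>s J23 k t"
  shows "s = t"
proof -
  note m = J23_43_44_mult[OF assms(1)]
  have part: "f \<in> part (J23 k t) 1 \<longleftrightarrow> f $ E1 = 0 \<and> f $ E2 = 0"
    "f \<in> part (J23 k t) 0 \<longleftrightarrow> f $ F1 = 0 \<and> f $ F2 = 0 \<and> f $ F3 = 0" and scl: "scl (J23 k t) = (*s)" for f t
    by (simp_all add: J23_def odd_part_table even_part_table)
  have "\<forall>a\<in>part (J23 k s) 0. \<forall>f\<in>part (J23 k s) 1.
      mult (J23 k s) a (mult (J23 k s) a f) = scl (J23 k s) s (mult (J23 k s) (mult (J23 k s) a a) f)"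
    by (intro ballI) (simp add: part scl vec_gen_eq m J23_43_44_mult[of 44] algebra_simps)
  note parameter_identities_iso(2)[OF assms(2) this]
  from this[rule_format, of "bv E1" "bv F2"] show ?thesis
    by (simp add: part scl vec_gen_eq m bv_nth)
qed

section \<open>Change of basis\<close>

fun new_basis :: "complex \<times> complex \<Rightarrow> complex \<times> complex \<Rightarrow> complex \<times> complex \<times> complex \<Rightarrow>
    complex \<times> complex \<times> complex \<Rightarrow> complex \<times> complex \<times> complex \<Rightarrow> gen \<Rightarrow> complex ^ gen" where
  "new_basis (a, b) (c, d) (x1, x2, x3) (y1, y2, y3) (z1, z2, z3) g =
    (case g of E1 \<Rightarrow> a *s bv E1 + b *s bv E2 | E2 \<Rightarrow> c *s bv E1 + d *s bv E2
     | F1 \<Rightarrow> x1 *s bv F1 + x2 *s bv F2 + x3 *s bv F3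
     | F2 \<Rightarrow> y1 *s bv F1 + y2 *s bv F2 + y3 *s bv F3
     | F3 \<Rightarrow> z1 *s bv F1 + z2 *s bv F2 + z3 *s bv F3)"

fun det2 :: "complex \<times> complex \<Rightarrow> complex \<times> complex \<Rightarrow> complex" where
  "det2 (a, b) (c, d) = a * d - b * c"

fun det3 :: "complex \<times> complex \<times> complex \<Rightarrow> complex \<times> complex \<times> complex \<Rightarrow> complex \<times> complex \<times> complex \<Rightarrow> complex" where
  "det3 (x1, x2, x3) (y1, y2, y3) (z1, z2, z3) =
    x1 * (y2 * z3 - y3 * z2) - x2 * (y1 * z3 - y3 * z1) + x3 * (y1 * z2 - y2 * z1)"

lemma comb_nth: "comb (table_alg T) w x $ k =
    x $ E1 * w E1 $ k + (x $ E2 * w E2 $ k + (x $ F1 * w F1 $ k + (x $ F2 * w F2 $ k + x $ F3 * w F3 $ k)))"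
  by (simp add: comb_def sum_gen)

text \<open>Cramer's rule: the determinants times the coordinates of a vector in the kernel are combinations of the
  linear equations for these coordinates.\<close>

lemma bij_new_basis:
  assumes "det2 u v \<noteq> 0" "det3 x y z \<noteq> 0"
  shows "bij (comb (table_alg T) (new_basis u v x y z))"
proof -
  obtain a b c d where uv: "u = (a, b)" "v = (c, d)" by (cases u; cases v) auto
  obtain x1 x2 x3 y1 y2 y3 z1 z2 z3 where xyz: "x = (x1, x2, x3)" "y = (y1, y2, y3)" "z = (z1, z2, z3)"
    by (cases x; cases y; cases z) auto
  let ?f = "comb (table_alg T) (new_basis u v x y z)"
  have lin: "Vector_Spaces.linear (*s) (*s) ?f"
    by (rule linear_scl_I) (simp_all add: vector_space_vec vec_eq_iff comb_nth algebra_simps)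
  have "s = t" if "?f s = ?f t" for s t
  proof -
    define r where "r = s - t"
    have "?f r = 0" using that unfolding r_def by (simp add: vec_eq_iff comb_nth algebra_simps)
    then have 2: "r $ E1 * a + r $ E2 * c = 0" "r $ E1 * b + r $ E2 * d = 0"
      and 3: "r $ F1 * x1 + r $ F2 * y1 + r $ F3 * z1 = 0" "r $ F1 * x2 + r $ F2 * y2 + r $ F3 * z2 = 0"
        "r $ F1 * x3 + r $ F2 * y3 + r $ F3 * z3 = 0"
      by (simp_all add: uv xyz vec_gen_eq comb_nth bv_nth algebra_simps)
    have "det2 u v * r $ E1 = 0" "det2 u v * r $ E2 = 0"
      using 2 unfolding uv det2.simps by algebra+
    moreover have "det3 x y z * r $ F1 = 0" "det3 x y z * r $ F2 = 0" "det3 x y z * r $ F3 = 0"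
      using 3 unfolding xyz det3.simps by algebra+
    ultimately have "r = 0" using assms by (simp add: vec_gen_eq)
    then show ?thesis by (simp add: r_def)
  qed
  then have "inj ?f" by (auto intro: injI)
  moreover from lin this have "surj ?f" by (rule vec.linear_inj_imp_surj)
  ultimately show ?thesis by (simp add: bij_def)
qed

lemma new_basis_in_part: "new_basis u v x y z g \<in> part (table_alg T) (gen_parity g)"
proof -
  have "u = (fst u, snd u)" "v = (fst v, snd v)" "x = (fst x, fst (snd x), snd (snd x))"
    "y = (fst y, fst (snd y), snd (snd y))" "z = (fst z, fst (snd z), snd (snd z))" by simp_all
  then obtain a b c d x1 x2 x3 y1 y2 y3 z1 z2 z3
    where "u = (a, b)" "v = (c, d)" "x = (x1, x2, x3)" "y = (y1, y2, y3)" "z = (z1, z2, z3)" by blast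
  then show ?thesis by (cases g) (simp_all add: even_part_table odd_part_table bv_nth)
qed

definition upper_pairs :: "(gen \<times> gen) list" where
  "upper_pairs = [(E1, E1), (E1, E2), (E2, E2), (E1, F1), (E1, F2), (E1, F3), (E2, F1), (E2, F2), (E2, F3),
    (F1, F2), (F1, F3), (F2, F3)]"

text \<open>By supercommutativity on both sides, the products of a frame need only be compared for the twelve pairs
  in increasing order.\<close>

lemma frame_isomorphic_upper:
  assumes A: "superalgebra A" and com: "supercommutative A" and wf: "wf_table T"
    and hom: "\<And>g. b g \<in> part A (gen_parity g)" and bij: "bij (comb A b)"
    and prod: "\<And>g h. (g, h) \<in> set upper_pairs \<Longrightarrow> mult A (b g) (b h) = comb A b (basis_prod T g h)"
  shows "A \<cong>\<^sub>s table_alg T"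
proof (rule frame_isomorphic[OF A hom bij])
  interpret vector_space "scl A" using A by (rule superalgebra_vs)
  have scl: "comb A b (c *s x) = scl A c (comb A b x)" for c x
    by (simp add: comb_def scale_sum_right)
  have s: "mult A (b g) (b h) = scl A (psign (gen_parity g * gen_parity h)) (mult A (b h) (b g))" for g h
    using com hom unfolding supercommutative_def by blast
  have t: "basis_prod T g h = psign (gen_parity g * gen_parity h) *s basis_prod T h g" for g h
    using wf unfolding wf_table_def by blast
  have sym: "mult A (b g) (b h) = comb A b (basis_prod T g h)"
    if "mult A (b h) (b g) = comb A b (basis_prod T h g)" for g h
    using s[of g h] t[of g h] that by (simp add: scl)
  have 0: "basis_prod T g g = 0" "mult A (b g) (b g) = 0" if "gen_parity g = 1" for g
  proof -
    show "basis_prod T g g = 0"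
      using arg_cong[OF t[of g g], of "\<lambda>v. v $ k" for k] that by (simp add: psign_def vec_eq_iff)
    let ?m = "mult A (b g) (b g)"
    have neg: "?m = - ?m"
      using s[of g g] that by (simp add: psign_def)
    have "scl A 2 ?m = ?m + ?m"
      using scale_left_distrib[of 1 1] by simp
    also have "\<dots> = 0" by (subst (2) neg) simp
    finally have "scl A 2 ?m = 0" .
    then show "mult A (b g) (b g) = 0" by simp
  qed
  have "(g, h) \<in> set upper_pairs \<or> (h, g) \<in> set upper_pairs \<or> g = h \<and> gen_parity g = 1" for g h
    by (cases g; cases h) (simp_all add: upper_pairs_def)
  then show "mult A (b g) (b h) = comb A b (basis_prod T g h)" for g h
    using prod[of g h] sym[of h g] prod[of h g] 0[of g] scl[of 0 0] by fastforce
qed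

lemma change_of_basis:
  assumes "wf_table S" "wf_table T" "det2 u v \<noteq> 0" "det3 x y z \<noteq> 0"
    and "\<forall>(g, h) \<in> set upper_pairs. mult (table_alg S) (new_basis u v x y z g) (new_basis u v x y z h)
      = comb (table_alg S) (new_basis u v x y z) (basis_prod T g h)"
  shows "table_alg S \<cong>\<^sub>s table_alg T"
proof (rule frame_isomorphic_upper)
  show "new_basis u v x y z g \<in> part (table_alg S) (gen_parity g)" for g by (rule new_basis_in_part)
  show "bij (comb (table_alg S) (new_basis u v x y z))" using assms(3,4) by (rule bij_new_basis)
qed (use assms in \<open>auto intro: superalgebra_table_alg supercommutative_table_alg\<close>)

section \<open>Triangular tables\<close>

text \<open>Strictly upper triangular structure constants: \<open>(a\<^sub>i, b\<^sub>i, c\<^sub>i)\<close> describes the operator \<open>L\<^sub>i\<close>, which maps \<open>f\<^sub>2\<close>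
  to \<open>a\<^sub>i f\<^sub>1\<close> and \<open>f\<^sub>3\<close> to \<open>b\<^sub>i f\<^sub>1 + c\<^sub>i f\<^sub>2\<close>, and \<open>(p\<^sub>i, q\<^sub>i, r\<^sub>i)\<close> is the \<open>e\<^sub>i\<close>-coordinate of the products
  \<open>f\<^sub>1 f\<^sub>2\<close>, \<open>f\<^sub>1 f\<^sub>3\<close>, \<open>f\<^sub>2 f\<^sub>3\<close>.\<close>

fun tri :: "complex \<Rightarrow> complex \<times> complex \<times> complex \<Rightarrow> complex \<times> complex \<times> complex \<Rightarrow>
    complex \<times> complex \<times> complex \<Rightarrow> complex \<times> complex \<times> complex \<Rightarrow> table" where
  "tri m (a1, b1, c1) (a2, b2, c2) (p1, q1, r1) (p2, q2, r2) =
    [((E1, E1), m *s bv E2),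
     ((E1, F2), a1 *s bv F1), ((E1, F3), b1 *s bv F1 + c1 *s bv F2),
     ((E2, F2), a2 *s bv F1), ((E2, F3), b2 *s bv F1 + c2 *s bv F2),
     ((F1, F2), p1 *s bv E1 + p2 *s bv E2), ((F1, F3), q1 *s bv E1 + q2 *s bv E2),
     ((F2, F3), r1 *s bv E1 + r2 *s bv E2)]"

lemma tri_cases:
  fixes T :: table
  assumes "\<And>a1 b1 c1 a2 b2 c2 p1 q1 r1 p2 q2 r2. P (tri m (a1, b1, c1) (a2, b2, c2) (p1, q1, r1) (p2, q2, r2))"
  shows "P (tri m K L u v)"
  using assms by (metis prod_cases3)

lemma wf_tri: "wf_table (tri m K L u v)"
  by (rule tri_cases) (simp add: wf_table_def all_gen basis_prod_def bv_nth psign_def)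

lemma basis_prod_tri:
  "basis_prod (tri m (a1, b1, c1) (a2, b2, c2) (p1, q1, r1) (p2, q2, r2)) =
    gprod (m *s bv E2) 0 0 0 (a1 *s bv F1) (b1 *s bv F1 + c1 *s bv F2) 0 (a2 *s bv F1) (b2 *s bv F1 + c2 *s bv F2)
      (p1 *s bv E1 + p2 *s bv E2) (q1 *s bv E1 + q2 *s bv E2) (r1 *s bv E1 + r2 *s bv E2)"
  by (rule basis_prod_gprod[OF wf_tri]) (simp_all add: basis_prod_def)

declare tri.simps [simp del]

lemma mult_tri:
  assumes "A = table_alg (tri m (a1, b1, c1) (a2, b2, c2) (p1, q1, r1) (p2, q2, r2))"
  shows "mult A x y $ E1 = p1 * (x $ F1 * y $ F2 - x $ F2 * y $ F1) + q1 * (x $ F1 * y $ F3 - x $ F3 * y $ F1)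
      + r1 * (x $ F2 * y $ F3 - x $ F3 * y $ F2)"
    "mult A x y $ E2 = m * x $ E1 * y $ E1 + p2 * (x $ F1 * y $ F2 - x $ F2 * y $ F1)
      + q2 * (x $ F1 * y $ F3 - x $ F3 * y $ F1) + r2 * (x $ F2 * y $ F3 - x $ F3 * y $ F2)"
    "mult A x y $ F1 = a1 * (x $ E1 * y $ F2 + x $ F2 * y $ E1) + b1 * (x $ E1 * y $ F3 + x $ F3 * y $ E1)
      + a2 * (x $ E2 * y $ F2 + x $ F2 * y $ E2) + b2 * (x $ E2 * y $ F3 + x $ F3 * y $ E2)"
    "mult A x y $ F2 = c1 * (x $ E1 * y $ F3 + x $ F3 * y $ E1) + c2 * (x $ E2 * y $ F3 + x $ F3 * y $ E2)"
    "mult A x y $ F3 = 0"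
  unfolding assms table_alg_mult_coords Let_def basis_prod_tri
  by (simp_all add: bv_nth algebra_simps)

text \<open>What remains of the hypotheses on \<open>J\<close> once it is given by a table. Both conditions are invariant under
  isomorphism.\<close>

definition admissible :: "table \<Rightarrow> bool" where
  "admissible T \<longleftrightarrow> jordan_superidentity (table_alg T) \<and> loop_free (table_alg T)"

definition classified :: "table \<Rightarrow> bool" where
  "classified T \<longleftrightarrow> (\<exists>(k, t) \<in> labels. table_alg T \<cong>\<^sub>s J23 k t)"

lemma classified_iso:
  assumes "table_alg S \<cong>\<^sub>s table_alg T" "admissible S" "admissible T \<Longrightarrow> classified T"
  shows "classified S"
proof -
  have "admissible T"
    using assms(1,2) loop_free_iso jordan_superidentity_iso unfolding admissible_def by blast
  then show ?thesis
    using assms(1,3) isomorphic_trans unfolding classified_def by blast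
qed

lemma admissible_jordan:
  assumes "admissible T"
  shows "jordan_expr (bilin (basis_prod T)) (gen_parity w) (gen_parity x) (gen_parity y) (gen_parity z)
      (bv w) (bv x) (bv y) (bv z) = 0"
proof -
  have "jordan_superidentity (table_alg T)" using assms by (simp add: admissible_def)
  from this[unfolded jordan_superidentity_def Let_def mult_table_alg table_alg_scl, rule_format, OF bv_in_part bv_in_part bv_in_part bv_in_part]
  show ?thesis by (simp only: jordan_expr_def)
qed

lemmas jordan_eval = jordan_expr_def bilin_diff basis_prod_tri bilin_bv bilin_simps gprod.simps gen.case gen_parity.simps

lemma admissible_loop:
  assumes "admissible T" "bilin (basis_prod T) (bilin (basis_prod T) x y) z = c *s x" "x \<noteq> 0"
  shows "c = 0"
  using assms unfolding admissible_def loop_free_def mult_table_alg by auto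

lemma labels_iff:
  "(k, t) \<in> labels \<longleftrightarrow> 1 \<le> k \<and> k \<le> 44 \<and> (if k = 31 \<or> k = 43 then t \<noteq> 0 else k = 44 \<or> t = 0)"
  by (auto simp: labels_def)

text \<open>The end of a branch of the case analysis: a basis in which the products are those of table \<open>k\<close>.\<close>

lemma classified_by_basis:
  assumes "map_of (tables t) k = Some S" "(k, t) \<in> labels" "det2 u v \<noteq> 0" "det3 x y z \<noteq> 0" 
    and "\<forall>(g, h) \<in> set upper_pairs. mult (table_alg (tri m K L a b)) (new_basis u v x y z g) (new_basis u v x y z h)
      = comb (table_alg (tri m K L a b)) (new_basis u v x y z) (basis_prod S g h)"
  shows "classified (tri m K L a b)"
proof -
  have "table_alg (tri m K L a b) \<cong>\<^sub>s table_alg S"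
    using wf_tri wf_tables[OF map_of_SomeD[OF assms(1)]] assms(3-5) by (rule change_of_basis)
  moreover have "J23 k t = table_alg S"
    using assms(1) by (simp add: J23_def)
  ultimately show ?thesis
    using assms(2) unfolding classified_def by (intro bexI[of _ "(k, t)"]) simp_all
qed

definition left_pairs :: "(gen \<times> gen) list" where
  "left_pairs = [(E1, E1), (E1, E2), (E2, E2), (E1, F1), (E1, F2), (E1, F3), (E2, F1), (E2, F2), (E2, F3)]"

lemma new_basis_even_span:
  assumes "det2 u v \<noteq> 0" "f $ F1 = 0" "f $ F2 = 0" "f $ F3 = 0"
  shows "\<exists>s t. f = s *s new_basis u v x y z E1 + t *s new_basis u v x y z E2"
proof -
  obtain a b c d where uv: "u = (a, b)" "v = (c, d)" by (cases u; cases v) auto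
  obtain x1 x2 x3 y1 y2 y3 z1 z2 z3 where xyz: "x = (x1, x2, x3)" "y = (y1, y2, y3)" "z = (z1, z2, z3)"
    by (cases x; cases y; cases z) auto
  have det: "a * d - b * c \<noteq> 0" using assms(1) by (simp add: uv)
  let ?D = "a * d - b * c"
  have 1: "(f $ E1 * d - f $ E2 * c) * a + (f $ E2 * a - f $ E1 * b) * c = ?D * f $ E1"
    and 2: "(f $ E1 * d - f $ E2 * c) * b + (f $ E2 * a - f $ E1 * b) * d = ?D * f $ E2"
    by algebra+
  have "f $ E1 = (f $ E1 * d - f $ E2 * c) / ?D * a + (f $ E2 * a - f $ E1 * b) / ?D * c"
    "f $ E2 = (f $ E1 * d - f $ E2 * c) / ?D * b + (f $ E2 * a - f $ E1 * b) / ?D * d"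
    using 1 2 det by (simp_all add: add_divide_distrib[symmetric])
  then show ?thesis
    using assms(2-4)
    by (intro exI[of _ "(f $ E1 * d - f $ E2 * c) / ?D"] exI[of _ "(f $ E2 * a - f $ E1 * b) / ?D"])
       (simp add: uv xyz vec_gen_eq bv_nth)
qed

text \<open>An intermediate step of the case analysis, which normalises \<open>m\<close> and the operators \<open>L\<^sub>1, L\<^sub>2\<close>. The
  products of the new odd vectors are not computed, because every alternating product is covered by the
  general form of a triangular table.\<close>

lemma classified_by_action:
  assumes admissible: "admissible (tri m K L a b)" and det: "det2 u v \<noteq> 0" "det3 x y z \<noteq> 0"
    and prod: "\<forall>(g, h) \<in> set left_pairs. mult (table_alg (tri m K L a b)) (new_basis u v x y z g) (new_basis u v x y z h)
      = comb (table_alg (tri m K L a b)) (new_basis u v x y z) (basis_prod (tri m' K' L' (0, 0, 0) (0, 0, 0)) g h)"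
    and classified: "\<And>a' b'. admissible (tri m' K' L' a' b') \<Longrightarrow> classified (tri m' K' L' a' b')"
  shows "classified (tri m K L a b)"
proof -
  let ?A = "table_alg (tri m K L a b)" and ?w = "new_basis u v x y z"
  obtain a1 b1 c1 a2 b2 c2 where KL: "K' = (a1, b1, c1)" "L' = (a2, b2, c2)"
    by (cases K'; cases L') auto
  have "\<exists>s t. mult ?A (?w g) (?w h) = s *s ?w E1 + t *s ?w E2" if "gen_parity g = 1" "gen_parity h = 1" for g h
  proof -
    have "mult ?A (?w g) (?w h) \<in> part ?A (gen_parity g + gen_parity h)"
      by (intro superalgebra_part(4) superalgebra_table_alg wf_tri new_basis_in_part)
    then have "mult ?A (?w g) (?w h) \<in> part ?A 0" using that by simp
    then show ?thesis
      using det(1) by (intro new_basis_even_span) (simp_all add: even_part_table)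
  qed
  then obtain p1 p2 q1 q2 r1 r2 where w: "mult ?A (?w F1) (?w F2) = p1 *s ?w E1 + p2 *s ?w E2"
    "mult ?A (?w F1) (?w F3) = q1 *s ?w E1 + q2 *s ?w E2" "mult ?A (?w F2) (?w F3) = r1 *s ?w E1 + r2 *s ?w E2"
    by (metis gen_parity.simps(3-5))
  let ?T = "tri m' K' L' (p1, q1, r1) (p2, q2, r2)"
  have "?A \<cong>\<^sub>s table_alg ?T"
  proof (rule change_of_basis[OF wf_tri wf_tri det])
    show "\<forall>(g, h) \<in> set upper_pairs. mult ?A (?w g) (?w h) = comb ?A ?w (basis_prod ?T g h)"
      using prod w
      by (simp add: upper_pairs_def left_pairs_def KL basis_prod_tri del: new_basis.simps) (simp add: vec_eq_iff comb_nth bv_nth del: new_basis.simps)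
  qed
  then show ?thesis using admissible classified by (rule classified_iso)
qed

lemmas table_eval = upper_pairs_def left_pairs_def mult_tri[OF refl] vec_gen_eq comb_nth bv_nth basis_prod_def psign_def
lemmas action_eval = left_pairs_def mult_tri[OF refl] vec_gen_eq comb_nth bv_nth basis_prod_tri

section \<open>One operator, of rank one or two\<close>

text \<open>Here \<open>e\<^sub>1 f\<^sub>2 = f\<^sub>1\<close> is the only product of even with odd vectors. Since \<open>(f\<^sub>1 f\<^sub>2) f\<^sub>2 = p\<^sub>1 f\<^sub>1\<close> and
  \<open>(f\<^sub>1 f\<^sub>3) f\<^sub>2 = q\<^sub>1 f\<^sub>1\<close>, nilpotency leaves the coefficients \<open>r\<^sub>1, p\<^sub>2, q\<^sub>2, r\<^sub>2\<close>. The vector \<open>f\<^sub>1\<close> is tied to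
  \<open>e\<^sub>1 f\<^sub>2\<close>, and for \<open>m = 1\<close> the vector \<open>e\<^sub>2\<close> is tied to \<open>e\<^sub>1\<^sup>2\<close>; apart from that, adding multiples of \<open>f\<^sub>1\<close>
  and \<open>f\<^sub>3\<close> to the other vectors removes \<open>p\<^sub>2\<close> and \<open>r\<^sub>2\<close> when \<open>q\<^sub>2 \<noteq> 0\<close>, and \<open>r\<^sub>2\<close> when \<open>q\<^sub>2 = 0 \<noteq> p\<^sub>2\<close>. If
  \<open>r\<^sub>1 \<noteq> 0\<close>, the product \<open>f\<^sub>2 f\<^sub>3\<close> itself serves as the new \<open>e\<^sub>1\<close>.\<close>

lemma classified_rank_one:
  assumes admissible: "admissible (tri m (1, 0, 0) (0, 0, 0) (p1, q1, r1) (p2, q2, r2))" and m: "m = 0 \<or> m = 1"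
  shows "classified (tri m (1, 0, 0) (0, 0, 0) (p1, q1, r1) (p2, q2, r2))"
proof -
  have p1: "p1 = 0"
    by (rule admissible_loop[OF admissible, of "bv F1" "bv F2" "bv F2"])
       (simp_all add: basis_prod_tri bilin_bv bilin_simps bv_nonzero)
  have q1: "q1 = 0"
    by (rule admissible_loop[OF admissible, of "bv F1" "bv F3" "bv F2"])
       (simp_all add: basis_prod_tri bilin_bv bilin_simps bv_nonzero)
  consider "r1 = 0" "q2 \<noteq> 0" | "r1 = 0" "q2 = 0" "p2 \<noteq> 0" | "r1 = 0" "q2 = 0" "p2 = 0" "r2 \<noteq> 0"
    | "r1 = 0" "q2 = 0" "p2 = 0" "r2 = 0" | "r1 \<noteq> 0" "q2 \<noteq> 0" | "r1 \<noteq> 0" "q2 = 0" "p2 \<noteq> 0"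
    | "r1 \<noteq> 0" "q2 = 0" "p2 = 0" by blast
  then show ?thesis
  proof cases
    case 1
    from m show ?thesis
    proof
      assume m: "m = 0" show ?thesis
        unfolding m by ((rule classified_by_basis[where k = 7 and t = "0" and u = "(1, 0)" and v = "(0, 1)"
        and x = "(1, 0, 0)" and y = "(- r2 / q2, 1, - p2 / q2)" and z = "(0, 0, 1 / q2)"],
        simp add: tables_def, (use p1 q1 1 in \<open>simp_all add: labels_iff table_eval field_simps\<close>)))
    next
      assume m: "m = 1" show ?thesis
        unfolding m by ((rule classified_by_basis[where k = 28 and t = "0" and u = "(1, 0)" and v = "(0, 1)"
        and x = "(1, 0, 0)" and y = "(- r2 / q2, 1, - p2 / q2)" and z = "(0, 0, 1 / q2)"],
        simp add: tables_def, (use p1 q1 1 in \<open>simp_all add: labels_iff table_eval field_simps\<close>)))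
    qed
  next
    case 2
    from m show ?thesis
    proof
      assume m: "m = 0" show ?thesis
        unfolding m by ((rule classified_by_basis[where k = 5 and t = "0" and u = "(p2, 0)" and v = "(0, p2 * p2)"
        and x = "(p2, 0, 0)" and y = "(0, 1, 0)" and z = "(r2 / p2, 0, 1)"],
        simp add: tables_def, (use p1 q1 2 in \<open>simp_all add: labels_iff table_eval field_simps\<close>)))
    next
      assume m: "m = 1" show ?thesis
        unfolding m by ((rule classified_by_basis[where k = 27 and t = "0" and u = "(p2, 0)" and v = "(0, p2 * p2)"
        and x = "(p2, 0, 0)" and y = "(0, 1, 0)" and z = "(r2 / p2, 0, 1)"],
        simp add: tables_def, (use p1 q1 2 in \<open>simp_all add: labels_iff table_eval field_simps\<close>)))
    qed
  next
    case 3
    from m show ?thesis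
    proof
      assume m: "m = 0" show ?thesis
        unfolding m by ((rule classified_by_basis[where k = 6 and t = "0" and u = "(1, 0)" and v = "(0, 1)"
        and x = "(1, 0, 0)" and y = "(0, 1, 0)" and z = "(0, 0, 1 / r2)"],
        simp add: tables_def, (use p1 q1 3 in \<open>simp_all add: labels_iff table_eval field_simps\<close>)))
    next
      assume m: "m = 1" show ?thesis
        unfolding m by ((rule classified_by_basis[where k = 26 and t = "0" and u = "(1, 0)" and v = "(0, 1)"
        and x = "(1, 0, 0)" and y = "(0, 1, 0)" and z = "(0, 0, 1 / r2)"],
        simp add: tables_def, (use p1 q1 3 in \<open>simp_all add: labels_iff table_eval field_simps\<close>)))
    qed
  next
    case 4
    from m show ?thesis
    proof
      assume m: "m = 0" show ?thesis
        unfolding m by ((rule classified_by_basis[where k = 4 and t = "0" and u = "(1, 0)" and v = "(0, 1)"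
        and x = "(1, 0, 0)" and y = "(0, 1, 0)" and z = "(0, 0, 1)"],
        simp add: tables_def, (use p1 q1 4 in \<open>simp_all add: labels_iff table_eval field_simps\<close>)))
    next
      assume m: "m = 1" show ?thesis
        unfolding m by ((rule classified_by_basis[where k = 25 and t = "0" and u = "(1, 0)" and v = "(0, 1)"
        and x = "(1, 0, 0)" and y = "(0, 1, 0)" and z = "(0, 0, 1)"],
        simp add: tables_def, (use p1 q1 4 in \<open>simp_all add: labels_iff table_eval field_simps\<close>)))
    qed
  next
    case 5
    from m show ?thesis
    proof
      assume m: "m = 0" show ?thesis
        unfolding m by ((rule classified_by_basis[where k = 10 and t = "0" and u = "(r1, r2)" and v = "(0, r1 * q2)"
        and x = "(r1, 0, 0)" and y = "(0, 1, - p2 / q2)" and z = "(0, 0, 1)"],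
        simp add: tables_def, (use p1 q1 5 in \<open>simp_all add: labels_iff table_eval field_simps\<close>)))
    next
      assume m: "m = 1" show ?thesis
        unfolding m by ((rule classified_by_basis[where k = 31 and t = "q2 / r1" and u = "(r1, r2)" and v = "(0, r1 * r1)"
        and x = "(r1, 0, 0)" and y = "(0, 1, - p2 / q2)" and z = "(0, 0, 1)"],
        simp add: tables_def, (use p1 q1 5 in \<open>simp_all add: labels_iff table_eval field_simps\<close>)))
    qed
  next
    case 6
    from m show ?thesis
    proof
      assume m: "m = 0" show ?thesis
        unfolding m by ((rule classified_by_basis[where k = 9 and t = "0" and u = "(p2, p2 * r2 / r1)" and v = "(0, p2 * p2)"
        and x = "(p2, 0, 0)" and y = "(0, 1, 0)" and z = "(0, 0, p2 / r1)"],
        simp add: tables_def, (use p1 q1 6 in \<open>simp_all add: labels_iff table_eval field_simps\<close>)))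
    next
      assume m: "m = 1" show ?thesis
        unfolding m by ((rule classified_by_basis[where k = 30 and t = "0" and u = "(p2, p2 * r2 / r1)" and v = "(0, p2 * p2)"
        and x = "(p2, 0, 0)" and y = "(0, 1, 0)" and z = "(0, 0, p2 / r1)"],
        simp add: tables_def, (use p1 q1 6 in \<open>simp_all add: labels_iff table_eval field_simps\<close>)))
    qed
  next
    case 7
    from m show ?thesis
    proof
      assume m: "m = 0" show ?thesis
        unfolding m by ((rule classified_by_basis[where k = 8 and t = "0" and u = "(r1, r2)" and v = "(0, r1 * r1)"
        and x = "(r1, 0, 0)" and y = "(0, 1, 0)" and z = "(0, 0, 1)"],
        simp add: tables_def, (use p1 q1 7 in \<open>simp_all add: labels_iff table_eval field_simps\<close>)))
    next
      assume m: "m = 1" show ?thesis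
        unfolding m by ((rule classified_by_basis[where k = 29 and t = "0" and u = "(r1, r2)" and v = "(0, r1 * r1)"
        and x = "(r1, 0, 0)" and y = "(0, 1, 0)" and z = "(0, 0, 1)"],
        simp add: tables_def, (use p1 q1 7 in \<open>simp_all add: labels_iff table_eval field_simps\<close>)))
    qed
  qed
qed

text \<open>The Jordan identity leaves \<open>q\<^sub>2\<close> and \<open>r\<^sub>2\<close>. Replacing \<open>f\<^sub>3\<close> by \<open>f\<^sub>3 + \<beta> f\<^sub>2\<close>, and hence \<open>f\<^sub>2\<close> by
  \<open>f\<^sub>2 + \<beta> f\<^sub>1\<close>, changes \<open>r\<^sub>2\<close> by \<open>\<beta> q\<^sub>2\<close>. Scaling the odd vectors by \<open>s\<close> multiplies \<open>q\<^sub>2\<close> by \<open>s\<^sup>2\<close>, and scaling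
  \<open>e\<^sub>1\<close> by \<open>r\<^sub>2\<close> (with \<open>f\<^sub>3\<close> fixed) divides \<open>r\<^sub>2\<close> by itself.\<close>

lemma classified_rank_two:
  assumes admissible: "admissible (tri m (1, 0, 1) (0, 0, 0) (p1, q1, r1) (p2, q2, r2))" and m: "m = 0 \<or> m = 1"
  shows "classified (tri m (1, 0, 1) (0, 0, 0) (p1, q1, r1) (p2, q2, r2))"
proof -
  have p: "p1 = 0" "p2 = 0"
    using admissible_jordan[OF admissible, of F2 E1 E1 F3] by (simp_all add: jordan_eval psign_def vec_gen_eq bv_nth)
  have qr: "q1 = 0" "r1 = 0"
    using admissible_jordan[OF admissible, of F3 F3 F2 E1] p by (simp_all add: jordan_eval psign_def vec_gen_eq bv_nth)
  consider "q2 \<noteq> 0" | "q2 = 0" "r2 \<noteq> 0" | "q2 = 0" "r2 = 0" by blast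
  then show ?thesis
  proof cases
    case 1
    \<comment> \<open>chosen so that \<open>s\<^sup>2 q\<^sub>2 = 1\<close>\<close>
    define s where "s = 1 / csqrt q2"
    have s: "s * (s * q2) = 1" "s \<noteq> 0"
      using 1 power2_csqrt[of q2] by (simp_all add: s_def power2_eq_square field_simps)
    from m show ?thesis
    proof
      assume m: "m = 0" show ?thesis
        unfolding m by ((rule classified_by_basis[where k = 18 and t = "0" and u = "(1, 0)" and v = "(0, 1)"
        and x = "(s, 0, 0)" and y = "(- s * r2 / q2, s, 0)" and z = "(0, - s * r2 / q2, s)"],
        simp add: tables_def, (use p qr 1 s in \<open>simp_all add: labels_iff table_eval field_simps\<close>)))
    next
      assume m: "m = 1" show ?thesis
        unfolding m by ((rule classified_by_basis[where k = 33 and t = "0" and u = "(1, 0)" and v = "(0, 1)"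
        and x = "(s, 0, 0)" and y = "(- s * r2 / q2, s, 0)" and z = "(0, - s * r2 / q2, s)"],
        simp add: tables_def, (use p qr 1 s in \<open>simp_all add: labels_iff table_eval field_simps\<close>)))
    qed
  next
    case 2
    from m show ?thesis
    proof
      assume m: "m = 0" show ?thesis
        unfolding m by ((rule classified_by_basis[where k = 17 and t = "0" and u = "(r2, 0)" and v = "(0, r2 * r2)"
        and x = "(r2 * r2, 0, 0)" and y = "(0, r2, 0)" and z = "(0, 0, 1)"],
        simp add: tables_def, (use p qr 2 in \<open>simp_all add: labels_iff table_eval field_simps\<close>)))
    next
      assume m: "m = 1" show ?thesis
        unfolding m by ((rule classified_by_basis[where k = 34 and t = "0" and u = "(r2, 0)" and v = "(0, r2 * r2)"
        and x = "(r2 * r2, 0, 0)" and y = "(0, r2, 0)" and z = "(0, 0, 1)"],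
        simp add: tables_def, (use p qr 2 in \<open>simp_all add: labels_iff table_eval field_simps\<close>)))
    qed
  next
    case 3
    from m show ?thesis
    proof
      assume m: "m = 0" show ?thesis
        unfolding m by ((rule classified_by_basis[where k = 16 and t = "0" and u = "(1, 0)" and v = "(0, 1)"
        and x = "(1, 0, 0)" and y = "(0, 1, 0)" and z = "(0, 0, 1)"],
        simp add: tables_def, (use p qr 3 in \<open>simp_all add: labels_iff table_eval field_simps\<close>)))
    next
      assume m: "m = 1" show ?thesis
        unfolding m by ((rule classified_by_basis[where k = 32 and t = "0" and u = "(1, 0)" and v = "(0, 1)"
        and x = "(1, 0, 0)" and y = "(0, 1, 0)" and z = "(0, 0, 1)"],
        simp add: tables_def, (use p qr 3 in \<open>simp_all add: labels_iff table_eval field_simps\<close>)))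
    qed
  qed
qed

section \<open>Two independent operators on the odd part\<close>

text \<open>Both operators have image spanned by \<open>f\<^sub>1\<close>, so \<open>J\<^sub>0\<close> is identified with the dual of the quotient of \<open>J\<^sub>1\<close>
  by \<open>f\<^sub>1\<close>. The Jordan identity leaves only \<open>f\<^sub>2 f\<^sub>3\<close>, an element \<open>u\<close> of this dual, and if \<open>u \<noteq> 0\<close> the new
  \<open>f\<^sub>2\<close> is taken in the kernel of \<open>u\<close>, the new \<open>f\<^sub>3\<close> with \<open>u f\<^sub>3 = f\<^sub>1\<close>.\<close>

lemma classified_common_image:
  assumes admissible: "admissible (tri 0 (1, 0, 0) (0, 1, 0) (p1, q1, r1) (p2, q2, r2))"
  shows "classified (tri 0 (1, 0, 0) (0, 1, 0) (p1, q1, r1) (p2, q2, r2))"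
proof -
  have pq: "p2 = 0" "q2 = 0" "p1 = 0" "q1 = 0"
    using admissible_jordan[OF admissible, of F2 F3 F2 E1] admissible_jordan[OF admissible, of F3 F3 F2 E1]
      admissible_jordan[OF admissible, of F2 F2 F3 E2] admissible_jordan[OF admissible, of F3 F2 F3 E2]
    by (simp_all add: jordan_eval psign_def vec_gen_eq bv_nth)
  consider "r2 \<noteq> 0" | "r2 = 0" "r1 \<noteq> 0" | "r2 = 0" "r1 = 0" by blast
  then show ?thesis
  proof cases
    case 1
    show ?thesis
      by ((rule classified_by_basis[where k = 12 and t = "0" and u = "(1 / r2, 0)" and v = "(r1, r2)"
        and x = "(1, 0, 0)" and y = "(0, r2, - r1)" and z = "(0, 0, 1 / r2)"],
        simp add: tables_def, (use pq 1 in \<open>simp_all add: labels_iff table_eval field_simps\<close>)))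
  next
    case 2
    show ?thesis
      by ((rule classified_by_basis[where k = 12 and t = "0" and u = "(0, - 1 / r1)" and v = "(r1, 0)"
        and x = "(1, 0, 0)" and y = "(0, 0, - r1)" and z = "(0, 1 / r1, 0)"],
        simp add: tables_def, (use pq 2 in \<open>simp_all add: labels_iff table_eval field_simps\<close>)))
  next
    case 3
    show ?thesis
      by ((rule classified_by_basis[where k = 11 and t = "0" and u = "(1, 0)" and v = "(0, 1)"
        and x = "(1, 0, 0)" and y = "(0, 1, 0)" and z = "(0, 0, 1)"],
        simp add: tables_def, (use pq 3 in \<open>simp_all add: labels_iff table_eval field_simps\<close>)))
  qed
qed

lemma two_by_two_eigenvector:
  fixes a b c d l :: complex
  assumes "l * l - (a + d) * l + (a * d - b * c) = 0"
  shows "\<exists>s t. (s \<noteq> 0 \<or> t \<noteq> 0) \<and> a * s + b * t = l * s \<and> c * s + d * t = l * t"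
proof (cases "b = 0 \<and> l = a")
  case False
  then show ?thesis
    using assms by (intro exI[of _ b] exI[of _ "l - a"]) (auto simp: algebra_simps)
next
  case True
  show ?thesis
  proof (cases "c = 0 \<and> l = d")
    case False
    then show ?thesis
      using True by (intro exI[of _ "l - d"] exI[of _ c]) (auto simp: algebra_simps)
  next
    case True
    with \<open>b = 0 \<and> l = a\<close> show ?thesis
      by (intro exI[of _ 1] exI[of _ 0]) simp
  qed
qed

text \<open>The map \<open>e \<mapsto> e f\<^sub>3\<close> is an isomorphism of \<open>J\<^sub>0\<close> onto \<open>W\<close>, the span of \<open>f\<^sub>1, f\<^sub>2\<close>. So \<open>w \<mapsto> (w f\<^sub>3) f\<^sub>3\<close> is
  an endomorphism of \<open>W\<close> with matrix entries \<open>q\<^sub>i, r\<^sub>i\<close>, and it carries the rest of the odd product once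
  \<open>f\<^sub>1 f\<^sub>2 = 0\<close> is known. Nilpotency makes its eigenvalues vanish; it is zero or a nilpotent Jordan block,
  and a cyclic vector of the block is the new \<open>f\<^sub>1\<close>.\<close>

lemma classified_common_source:
  assumes admissible: "admissible (tri 0 (0, 1, 0) (0, 0, 1) (p1, q1, r1) (p2, q2, r2))"
  shows "classified (tri 0 (0, 1, 0) (0, 0, 1) (p1, q1, r1) (p2, q2, r2))"
proof -
  let ?P = "basis_prod (tri 0 (0, 1, 0) (0, 0, 1) (p1, q1, r1) (p2, q2, r2))"
  have p: "p1 = 0" "p2 = 0"
  proof -
    let ?x = "p1 *s bv E1 + p2 *s bv E2"
    have "bilin ?P (bilin ?P ?x (bv F3)) (bv F1) = (- p2) *s ?x"
      "bilin ?P (bilin ?P ?x (bv F3)) (bv F2) = p1 *s ?x"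
      by (simp_all add: basis_prod_tri bilin_bv bilin_simps bilin_diff vec_gen_eq bv_nth)
    from this[THEN admissible_loop[OF admissible]] have "?x = 0 \<or> - p2 = 0 \<and> p1 = 0" by blast
    then show "p1 = 0" "p2 = 0" by (auto simp: vec_gen_eq bv_nth)
  qed
  have eigenvalue: "l = 0" if root: "l * l - (q1 + r2) * l + (q1 * r2 - r1 * q2) = 0" for l
  proof -
    obtain s t where st: "s \<noteq> 0 \<or> t \<noteq> 0" "q1 * s + r1 * t = l * s" "q2 * s + r2 * t = l * t"
      using two_by_two_eigenvector[OF root] by blast
    let ?x = "s *s bv F1 + t *s bv F2"
    have "bilin ?P (bilin ?P ?x (bv F3)) (bv F3) = l *s ?x"
      using st(2,3) by (simp add: basis_prod_tri bilin_bv bilin_simps bilin_diff vec_gen_eq bv_nth algebra_simps)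
    moreover have "?x \<noteq> 0" using st(1) by (auto simp: vec_gen_eq bv_nth)
    ultimately show ?thesis by (rule admissible_loop[OF admissible])
  qed
  \<comment> \<open>Both roots of the characteristic polynomial are eigenvalues, so trace and determinant vanish.\<close>
  define D where "D = csqrt ((q1 + r2) * (q1 + r2) - 4 * (q1 * r2 - r1 * q2))"
  have D: "D * D = (q1 + r2) * (q1 + r2) - 4 * (q1 * r2 - r1 * q2)"
    unfolding D_def using power2_csqrt by (simp add: power2_eq_square)
  have "(q1 + r2 + d) / 2 = 0" if "d * d = D * D" for d
  proof (rule eigenvalue)
    have "(q1 + r2 + d) / 2 * ((q1 + r2 + d) / 2) - (q1 + r2) * ((q1 + r2 + d) / 2) + (q1 * r2 - r1 * q2)
        = (d * d - ((q1 + r2) * (q1 + r2) - 4 * (q1 * r2 - r1 * q2))) / 4"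
      by (simp add: field_simps)
    then show "(q1 + r2 + d) / 2 * ((q1 + r2 + d) / 2) - (q1 + r2) * ((q1 + r2 + d) / 2) + (q1 * r2 - r1 * q2) = 0"
      using that D by simp
  qed
  from this[of D] this[of "- D"] have sum: "q1 + r2 + D = 0" "q1 + r2 - D = 0" by simp_all
  then have "2 * (q1 + r2) = 0" by algebra
  then have tr: "r2 = - q1" by (simp add: add_eq_0_iff)
  then have "D = 0" using sum by simp
  then have "4 * (q1 * q1 + r1 * q2) = 0"
    using D tr by (simp add: algebra_simps)
  then have "q1 * q1 + r1 * q2 = 0" unfolding mult_eq_0_iff by simp
  with tr have nil: "r2 = - q1" "q1 * q1 + r1 * q2 = 0" .
  consider "q2 \<noteq> 0" | "q2 = 0" "r1 \<noteq> 0" | "q2 = 0" "r1 = 0" by blast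
  then show ?thesis
  proof cases
    case 1
    have r1: "r1 = - (q1 * q1 / q2)" using 1 nil(2) by (simp add: field_simps add_eq_0_iff)
    show ?thesis
      by ((rule classified_by_basis[where k = 14 and t = "0" and u = "(1, 0)" and v = "(q1, q2)"
        and x = "(1, 0, 0)" and y = "(0, 0, 1)" and z = "(q1, q2, 0)"],
        simp add: tables_def, (use p nil(1) r1 1 in \<open>simp_all add: labels_iff table_eval field_simps\<close>)))
  next
    case 2
    have q1: "q1 = 0" using 2 nil(2) by simp
    show ?thesis
      by ((rule classified_by_basis[where k = 14 and t = "0" and u = "(0, 1)" and v = "(r1, 0)"
        and x = "(0, 1, 0)" and y = "(0, 0, 1)" and z = "(r1, 0, 0)"],
        simp add: tables_def, (use p nil(1) q1 2 in \<open>simp_all add: labels_iff table_eval field_simps\<close>)))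
  next
    case 3
    have q1: "q1 = 0" using 3 nil(2) by simp
    show ?thesis
      by ((rule classified_by_basis[where k = 13 and t = "0" and u = "(1, 0)" and v = "(0, 1)"
        and x = "(1, 0, 0)" and y = "(0, 0, 1)" and z = "(0, 1, 0)"],
        simp add: tables_def, (use p nil(1) q1 3 in \<open>simp_all add: labels_iff table_eval field_simps\<close>)))
  qed
qed

lemma classified_composable:
  assumes admissible: "admissible (tri 0 (1, 0, 0) (0, 0, 1) (p1, q1, r1) (p2, q2, r2))"
  shows "classified (tri 0 (1, 0, 0) (0, 0, 1) (p1, q1, r1) (p2, q2, r2))"
proof -
  have p: "p1 = 0" "p2 = 0"
    using admissible_jordan[OF admissible, of F2 E1 E2 F3] by (simp_all add: jordan_eval psign_def vec_gen_eq bv_nth)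
  have qr: "q2 = 0" "r2 = 0" "r1 = 0"
    using admissible_jordan[OF admissible, of F3 F3 F2 E1] admissible_jordan[OF admissible, of F3 F2 F3 E2] p
    by (simp_all add: jordan_eval psign_def vec_gen_eq bv_nth)
  have q1: "q1 = 0"
    by (rule admissible_loop[OF admissible, of "bv F1" "bv F3" "bv F2"])
       (use qr in \<open>simp_all add: basis_prod_tri bilin_bv bilin_simps bilin_diff bv_nonzero\<close>)
  show ?thesis
    by ((rule classified_by_basis[where k = 15 and t = "0" and u = "(1, 0)" and v = "(0, 1)"
        and x = "(1, 0, 0)" and y = "(0, 1, 0)" and z = "(0, 0, 1)"],
        simp add: tables_def, (use p qr q1 in \<open>simp_all add: labels_iff table_eval field_simps\<close>)))
qed

text \<open>The second operator is the square of the first. The Jordan identity leaves \<open>q\<^sub>2 = 2 r\<^sub>1\<close> and \<open>r\<^sub>2\<close>; for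
  \<open>r\<^sub>1 \<noteq> 0\<close> a suitable combination \<open>x\<close> of \<open>f\<^sub>2\<close> and \<open>f\<^sub>1\<close> would satisfy \<open>(x f\<^sub>3) f\<^sub>3 = r\<^sub>1 x\<close>.\<close>

lemma classified_regular_and_square:
  assumes admissible: "admissible (tri 0 (1, 0, 1) (0, 1, 0) (p1, q1, r1) (p2, q2, r2))"
  shows "classified (tri 0 (1, 0, 1) (0, 1, 0) (p1, q1, r1) (p2, q2, r2))"
proof -
  have p: "p1 = 0" "p2 = 0"
    using admissible_jordan[OF admissible, of F3 E1 E1 F2] by (simp_all add: jordan_eval psign_def vec_gen_eq bv_nth)
  have q: "q1 = 0" "q2 = 2 * r1"
    using admissible_jordan[OF admissible, of F3 F3 F2 E1] p
    by (simp_all add: jordan_eval psign_def vec_gen_eq bv_nth)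
  have r1: "r1 = 0"
  proof (rule ccontr)
    assume "r1 \<noteq> 0"
    \<comment> \<open>the eigenvector of \<open>x \<mapsto> (x f\<^sub>3) f\<^sub>3\<close> on the span of \<open>f\<^sub>1, f\<^sub>2\<close> for the eigenvalue \<open>r\<^sub>1\<close>\<close>
    let ?x = "bv F2 + (- r2 / r1) *s bv F1"
    have "r1 = 0"
      by (rule admissible_loop[OF admissible, of ?x "bv F3" "bv F3"])
         (use p q \<open>r1 \<noteq> 0\<close> in \<open>simp_all add: basis_prod_tri bilin_bv bilin_simps bilin_diff vec_gen_eq bv_nth field_simps\<close>)
    with \<open>r1 \<noteq> 0\<close> show False by simp
  qed
  consider "r2 \<noteq> 0" | "r2 = 0" by blast
  then show ?thesis
  proof cases
    case 1
    show ?thesis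
      by ((rule classified_by_basis[where k = 20 and t = "0" and u = "(r2, 0)" and v = "(0, r2 * r2)"
        and x = "(r2 * r2, 0, 0)" and y = "(0, r2, 0)" and z = "(0, 0, 1)"],
        simp add: tables_def, (use p q r1 1 in \<open>simp_all add: labels_iff table_eval field_simps\<close>)))
  next
    case 2
    show ?thesis
      by ((rule classified_by_basis[where k = 19 and t = "0" and u = "(1, 0)" and v = "(0, 1)"
        and x = "(1, 0, 0)" and y = "(0, 1, 0)" and z = "(0, 0, 1)"],
        simp add: tables_def, (use p q r1 2 in \<open>simp_all add: labels_iff table_eval field_simps\<close>)))
  qed
qed

text \<open>Here \<open>e\<^sub>1\<^sup>2 = e\<^sub>2\<close> acts by \<open>e\<^sub>2 f\<^sub>3 = f\<^sub>1\<close>, so that the triangular \<open>f\<^sub>3\<close> plays the role of \<open>f\<^sub>2\<close> in the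
  tables 35 to 44. The Jordan identity leaves \<open>r\<^sub>1\<close>, \<open>r\<^sub>2\<close> and \<open>q\<^sub>2 = 2 y r\<^sub>1\<close>, and \<open>(f\<^sub>1 f\<^sub>3) f\<^sub>3 = q\<^sub>2 f\<^sub>1\<close> forces
  \<open>y r\<^sub>1 = 0\<close>. For \<open>y \<noteq> 0\<close> the vector \<open>e\<^sub>1 f\<^sub>3\<close> becomes the \<open>f\<^sub>3\<close> of the table, and the
  parameter is \<open>y c\<close>, because \<open>e\<^sub>1 (e\<^sub>1 f\<^sub>3) = y c f\<^sub>1\<close>.\<close>

lemma classified_square_acts:
  assumes admissible: "admissible (tri 1 (c, 0, y) (0, 1, 0) (p1, q1, r1) (p2, q2, r2))"
  shows "classified (tri 1 (c, 0, y) (0, 1, 0) (p1, q1, r1) (p2, q2, r2))"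
proof -
  have 1: "p1 = 0" "q1 = 0"
    using admissible_jordan[OF admissible, of F2 E1 E2 F3] admissible_jordan[OF admissible, of F3 E1 E2 F3] by (simp_all add: jordan_eval psign_def vec_gen_eq bv_nth)
  have 2: "q2 = 2 * y * r1" "p2 = 0"
    using admissible_jordan[OF admissible, of F3 E1 E1 F3] admissible_jordan[OF admissible, of F2 E1 E1 F3] admissible_jordan[OF admissible, of F3 E1 E1 F2] 1
    by (auto simp: jordan_eval psign_def vec_gen_eq bv_nth mult.assoc)
  have "2 * y * r1 = 0"
    by (rule admissible_loop[OF admissible, of "bv F1" "bv F3" "bv F3"])
       (use 1 2 in \<open>simp_all add: basis_prod_tri bilin_bv bilin_simps bilin_diff vec_gen_eq bv_nth\<close>)
  then have yr: "y = 0 \<or> r1 = 0" by simp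
  note pq = 1 2
  consider "y = 0" "c = 0" "r1 = 0" "r2 = 0" | "y = 0" "c = 0" "r1 = 0" "r2 \<noteq> 0"
    | "y = 0" "c = 0" "r1 \<noteq> 0" "r2 = 0" | "y = 0" "c = 0" "r1 \<noteq> 0" "r2 \<noteq> 0"
    | "y = 0" "c \<noteq> 0" "r1 = 0" "r2 = 0" | "y = 0" "c \<noteq> 0" "r1 = 0" "r2 \<noteq> 0" | "y = 0" "c \<noteq> 0" "r1 \<noteq> 0"
    | "y \<noteq> 0" "r1 = 0" "c = 0" "r2 = 0" | "y \<noteq> 0" "r1 = 0" "c \<noteq> 0" "r2 = 0" | "y \<noteq> 0" "r1 = 0" "r2 \<noteq> 0"
    using yr by blast
  then show ?thesis
  proof cases
    case 1
    show ?thesis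
      by ((rule classified_by_basis[where k = 35 and t = "0" and u = "(1, 0)" and v = "(0, 1)"
        and x = "(1, 0, 0)" and y = "(0, 0, 1)" and z = "(0, 1, 0)"],
        simp add: tables_def, (use pq 1 in \<open>simp_all add: labels_iff table_eval field_simps\<close>)))
  next
    case 2
    show ?thesis
      by ((rule classified_by_basis[where k = 36 and t = "0" and u = "(1, 0)" and v = "(0, 1)"
        and x = "(1, 0, 0)" and y = "(0, 0, 1)" and z = "(0, - 1 / r2, 0)"],
        simp add: tables_def, (use pq 2 in \<open>simp_all add: labels_iff table_eval field_simps\<close>)))
  next
    case 3
    show ?thesis
      by ((rule classified_by_basis[where k = 37 and t = "0" and u = "(1, 0)" and v = "(0, 1)"
        and x = "(1, 0, 0)" and y = "(0, 0, 1)" and z = "(0, - 1 / r1, 0)"],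
        simp add: tables_def, (use pq 3 in \<open>simp_all add: labels_iff table_eval field_simps\<close>)))
  next
    case 4
    show ?thesis
      by ((rule classified_by_basis[where k = 38 and t = "0" and u = "(r2 / r1, (r2 / r1) * (r2 / r1))" and v = "(0, (r2 / r1) * (r2 / r1))"
        and x = "((r2 / r1) * (r2 / r1), 0, 0)" and y = "(0, 0, 1)" and z = "(0, - r2 / (r1 * r1), 0)"],
        simp add: tables_def, (use pq 4 in \<open>simp_all add: labels_iff table_eval field_simps\<close>)))
  next
    case 5
    show ?thesis
      by ((rule classified_by_basis[where k = 39 and t = "0" and u = "(1, 0)" and v = "(0, 1)"
        and x = "(1, 0, 0)" and y = "(0, 0, 1)" and z = "(0, 1 / c, 0)"],
        simp add: tables_def, (use pq 5 in \<open>simp_all add: labels_iff table_eval field_simps\<close>)))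
  next
    case 6
    show ?thesis
      by ((rule classified_by_basis[where k = 40 and t = "0" and u = "(- r2 / c, 0)" and v = "(0, (r2 / c) * (r2 / c))"
        and x = "((r2 / c) * (r2 / c), 0, 0)" and y = "(0, 0, 1)" and z = "(0, - r2 / (c * c), 0)"],
        simp add: tables_def, (use pq 6 in \<open>simp_all add: labels_iff table_eval field_simps\<close>)))
  next
    case 7
    \<comment> \<open>With \<open>f\<^sub>2' = s f\<^sub>3 + \<dots>\<close> and \<open>f\<^sub>3' = (s / c) f\<^sub>2\<close>, the \<open>e\<^sub>1\<close>-coordinate of \<open>f\<^sub>2' f\<^sub>3'\<close> is \<open>- s\<^sup>2 r\<^sub>1 / c\<close>.\<close>
    define s where "s = csqrt (- c / r1)"
    have "s * s = - c / r1" unfolding s_def using power2_csqrt by (simp add: power2_eq_square)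
    then have "s * s * r1 = - c" using 7 by simp
    then have c: "c = - (s * s * r1)" "s \<noteq> 0" using 7 by auto
    show ?thesis
      by ((rule classified_by_basis[where k = 41 and t = "0" and u = "(1, r2 / r1)" and v = "(0, 1)"
        and x = "(s, 0, 0)" and y = "(0, - (r2 / r1) * s / c, s)" and z = "(0, s / c, 0)"],
        simp add: tables_def, (use pq 7(1) 7(3) c in \<open>simp_all add: labels_iff table_eval field_simps\<close>)))
  next
    case 8
    show ?thesis
      by ((rule classified_by_basis[where k = 42 and t = "0" and u = "(1, 0)" and v = "(0, 1)"
        and x = "(1, 0, 0)" and y = "(0, 0, 1)" and z = "(0, y, 0)"],
        simp add: tables_def, (use pq 8 in \<open>simp_all add: labels_iff table_eval field_simps\<close>)))
  next
    case 9
    show ?thesis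
      by ((rule classified_by_basis[where k = 43 and t = "y * c" and u = "(1, 0)" and v = "(0, 1)"
        and x = "(1, 0, 0)" and y = "(0, 0, 1)" and z = "(0, y, 0)"],
        simp add: tables_def, (use pq 9 in \<open>simp_all add: labels_iff table_eval field_simps\<close>)))
  next
    case 10
    show ?thesis
      by ((rule classified_by_basis[where k = 44 and t = "y * c" and u = "(- y * r2, 0)" and v = "(0, (y * r2) * (y * r2))"
        and x = "((y * r2) * (y * r2), 0, 0)" and y = "(0, 0, 1)" and z = "(0, - y * r2 * y, 0)"],
        simp add: tables_def, (use pq 10 in \<open>simp_all add: labels_iff table_eval field_simps\<close>)))
  qed
qed

section \<open>The even part annihilates the odd part\<close>

text \<open>The coordinates of the odd product are alternating forms on \<open>J\<^sub>1\<close>, and the \<open>e\<^sub>1\<close>-form is already the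
  exterior product of the first two coordinate functions. Any two independent alternating forms on a
  three-dimensional space have a common factor, which is what the new \<open>f\<^sub>1, f\<^sub>2\<close> make visible.\<close>

lemma classified_no_action_pencil:
  assumes m: "m = 0 \<or> m = 1"
  shows "classified (tri m (0, 0, 0) (0, 0, 0) (1, 0, 0) (p2, q2, r2))"
proof -
  consider "q2 = 0" "r2 = 0" | "q2 \<noteq> 0" | "q2 = 0" "r2 \<noteq> 0" by blast
  then show ?thesis
  proof cases
    case 1
    from m show ?thesis
    proof
      assume m: "m = 0" show ?thesis
        unfolding m by ((rule classified_by_basis[where k = 2 and t = "0" and u = "(1, p2)" and v = "(0, 1)"
        and x = "(1, 0, 0)" and y = "(0, 1, 0)" and z = "(0, 0, 1)"],
        simp add: tables_def, (use 1 in \<open>simp_all add: labels_iff table_eval field_simps\<close>)))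
    next
      assume m: "m = 1" show ?thesis
        unfolding m by ((rule classified_by_basis[where k = 22 and t = "0" and u = "(1, p2)" and v = "(0, 1)"
        and x = "(1, 0, 0)" and y = "(0, 1, 0)" and z = "(0, 0, 1)"],
        simp add: tables_def, (use 1 in \<open>simp_all add: labels_iff table_eval field_simps\<close>)))
    qed
  next
    case 2
    from m show ?thesis
    proof
      assume m: "m = 0" show ?thesis
        unfolding m by ((rule classified_by_basis[where k = 3 and t = "0" and u = "(1, p2)" and v = "(0, 1)"
        and x = "(1 / q2, 0, 0)" and y = "(- r2, q2, 0)" and z = "(0, 0, 1)"],
        simp add: tables_def, (use 2 in \<open>simp_all add: labels_iff table_eval field_simps\<close>)))
    next
      assume m: "m = 1" show ?thesis
        unfolding m by ((rule classified_by_basis[where k = 24 and t = "0" and u = "(1, p2)" and v = "(0, 1)"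
        and x = "(1 / q2, 0, 0)" and y = "(- r2, q2, 0)" and z = "(0, 0, 1)"],
        simp add: tables_def, (use 2 in \<open>simp_all add: labels_iff table_eval field_simps\<close>)))
    qed
  next
    case 3
    from m show ?thesis
    proof
      assume m: "m = 0" show ?thesis
        unfolding m by ((rule classified_by_basis[where k = 3 and t = "0" and u = "(1, p2)" and v = "(0, 1)"
        and x = "(0, 1 / r2, 0)" and y = "(- r2, q2, 0)" and z = "(0, 0, 1)"],
        simp add: tables_def, (use 3 in \<open>simp_all add: labels_iff table_eval field_simps\<close>)))
    next
      assume m: "m = 1" show ?thesis
        unfolding m by ((rule classified_by_basis[where k = 24 and t = "0" and u = "(1, p2)" and v = "(0, 1)"
        and x = "(0, 1 / r2, 0)" and y = "(- r2, q2, 0)" and z = "(0, 0, 1)"],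
        simp add: tables_def, (use 3 in \<open>simp_all add: labels_iff table_eval field_simps\<close>)))
    qed
  qed
qed

text \<open>An alternating form with coefficients \<open>(p, q, r)\<close> on \<open>J\<^sub>1\<close> has the vector with coordinates
  \<open>(r, -q, p)\<close> in its kernel. Taking it as the new \<open>f\<^sub>3\<close> turns the \<open>e\<^sub>1\<close>-form into \<open>(1, 0, 0)\<close>.\<close>

lemma classified_no_action_nonzero:
  assumes admissible: "admissible (tri m (0, 0, 0) (0, 0, 0) (p1, q1, r1) (p2, q2, r2))"
    and m: "m = 0 \<or> m = 1" and nz: "p1 \<noteq> 0 \<or> q1 \<noteq> 0 \<or> r1 \<noteq> 0"
  shows "classified (tri m (0, 0, 0) (0, 0, 0) (p1, q1, r1) (p2, q2, r2))"
proof -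
  consider "p1 \<noteq> 0" | "q1 \<noteq> 0" | "r1 \<noteq> 0" using nz by blast
  then show ?thesis
  proof cases
    case 1
    have "table_alg (tri m (0, 0, 0) (0, 0, 0) (p1, q1, r1) (p2, q2, r2)) \<cong>\<^sub>s table_alg (tri m (0, 0, 0) (0, 0, 0) (1, 0, 0) (p2 / p1, q2 - q1 * p2 / p1, p1 * r2 - r1 * p2))"
      by (rule change_of_basis[OF wf_tri wf_tri, where u = "(1, 0)" and v = "(0, 1)" and x = "(1 / p1, 0, 0)" and y = "(0, 1, 0)" and z = "(r1, - q1, p1)"])
         (use 1 in \<open>simp_all add: upper_pairs_def action_eval field_simps\<close>)
    then show ?thesis using admissible classified_no_action_pencil[OF m] by (rule classified_iso)
  next
    case 2
    have "table_alg (tri m (0, 0, 0) (0, 0, 0) (p1, q1, r1) (p2, q2, r2)) \<cong>\<^sub>s table_alg (tri m (0, 0, 0) (0, 0, 0) (1, 0, 0) (q2 / q1, p1 * q2 / q1 - p2, q1 * r2 - r1 * q2))"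
      by (rule change_of_basis[OF wf_tri wf_tri, where u = "(1, 0)" and v = "(0, 1)" and x = "(1 / q1, 0, 0)" and y = "(0, 0, 1)" and z = "(r1, - q1, p1)"])
         (use 2 in \<open>simp_all add: upper_pairs_def action_eval field_simps\<close>)
    then show ?thesis using admissible classified_no_action_pencil[OF m] by (rule classified_iso)
  next
    case 3
    have "table_alg (tri m (0, 0, 0) (0, 0, 0) (p1, q1, r1) (p2, q2, r2)) \<cong>\<^sub>s table_alg (tri m (0, 0, 0) (0, 0, 0) (1, 0, 0) (r2 / r1, p1 * r2 / r1 - p2, q1 * r2 - r1 * q2))"
      by (rule change_of_basis[OF wf_tri wf_tri, where u = "(1, 0)" and v = "(0, 1)" and x = "(0, 1 / r1, 0)" and y = "(0, 0, 1)" and z = "(r1, - q1, p1)"])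
         (use 3 in \<open>simp_all add: upper_pairs_def action_eval field_simps\<close>)
    then show ?thesis using admissible classified_no_action_pencil[OF m] by (rule classified_iso)
  qed
qed

lemma classified_no_action:
  assumes admissible: "admissible (tri m (0, 0, 0) (0, 0, 0) (p1, q1, r1) (p2, q2, r2))" and m: "m = 0 \<or> m = 1"
  shows "classified (tri m (0, 0, 0) (0, 0, 0) (p1, q1, r1) (p2, q2, r2))"
proof (cases "p1 \<noteq> 0 \<or> q1 \<noteq> 0 \<or> r1 \<noteq> 0")
  case True
  with admissible m show ?thesis by (rule classified_no_action_nonzero)
next
  case False
  then have 0: "p1 = 0" "q1 = 0" "r1 = 0" by simp_all
  consider "p2 = 0" "q2 = 0" "r2 = 0" | "m = 0" "p2 \<noteq> 0 \<or> q2 \<noteq> 0 \<or> r2 \<noteq> 0"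
    | "m = 1" "p2 \<noteq> 0" | "m = 1" "q2 \<noteq> 0" | "m = 1" "r2 \<noteq> 0" using m by blast
  then show ?thesis
  proof cases
    case 1
    from m show ?thesis
    proof
      assume m: "m = 0" show ?thesis
        unfolding m by ((rule classified_by_basis[where k = 1 and t = "0" and u = "(1, 0)" and v = "(0, 1)"
        and x = "(1, 0, 0)" and y = "(0, 1, 0)" and z = "(0, 0, 1)"],
        simp add: tables_def, (use 0 1 in \<open>simp_all add: labels_iff table_eval field_simps\<close>)))
    next
      assume m: "m = 1" show ?thesis
        unfolding m by ((rule classified_by_basis[where k = 21 and t = "0" and u = "(1, 0)" and v = "(0, 1)"
        and x = "(1, 0, 0)" and y = "(0, 1, 0)" and z = "(0, 0, 1)"],
        simp add: tables_def, (use 0 1 in \<open>simp_all add: labels_iff table_eval field_simps\<close>)))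
    qed
  next
    case 2
    have "table_alg (tri m (0, 0, 0) (0, 0, 0) (p1, q1, r1) (p2, q2, r2)) \<cong>\<^sub>s table_alg (tri m (0, 0, 0) (0, 0, 0) (p2, q2, r2) (0, 0, 0))"
      by (rule change_of_basis[OF wf_tri wf_tri, where u = "(0, 1)" and v = "(1, 0)" and x = "(1, 0, 0)" and y = "(0, 1, 0)" and z = "(0, 0, 1)"])
         (use 0 2 in \<open>simp_all add: upper_pairs_def action_eval\<close>)
    then show ?thesis using admissible classified_no_action_nonzero[OF _ m 2(2)] by (rule classified_iso)
  next
    case 3
    show ?thesis
      by ((rule classified_by_basis[where k = 23 and t = "0" and u = "(1, 0)" and v = "(0, 1)"
        and x = "(1 / p2, 0, 0)" and y = "(0, 1, 0)" and z = "(r2, - q2, p2)"],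
        simp add: tables_def, (use 0 3 in \<open>simp_all add: labels_iff table_eval field_simps\<close>)))
  next
    case 4
    show ?thesis
      by ((rule classified_by_basis[where k = 23 and t = "0" and u = "(1, 0)" and v = "(0, 1)"
        and x = "(1 / q2, 0, 0)" and y = "(0, 0, 1)" and z = "(r2, - q2, p2)"],
        simp add: tables_def, (use 0 4 in \<open>simp_all add: labels_iff table_eval field_simps\<close>)))
  next
    case 5
    show ?thesis
      by ((rule classified_by_basis[where k = 23 and t = "0" and u = "(1, 0)" and v = "(0, 1)"
        and x = "(0, 1 / r2, 0)" and y = "(0, 0, 1)" and z = "(r2, - q2, p2)"],
        simp add: tables_def, (use 0 5 in \<open>simp_all add: labels_iff table_eval field_simps\<close>)))
  qed
qed

section \<open>Normalising the action\<close>

text \<open>The rules for the normal forms speak of explicit coefficients; this lets them be applied to the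
  unspecified odd product that \<open>classified_by_action\<close> produces.\<close>

lemma classified_componentwise:
  fixes a b :: "complex \<times> complex \<times> complex"
  assumes "\<And>p1 q1 r1 p2 q2 r2. admissible (tri m K L (p1, q1, r1) (p2, q2, r2)) \<Longrightarrow> classified (tri m K L (p1, q1, r1) (p2, q2, r2))"
    and "admissible (tri m K L a b)"
  shows "classified (tri m K L a b)"
  using assms by (metis prod_cases3)

text \<open>An operator with \<open>a c \<noteq> 0\<close> is a nilpotent Jordan block; otherwise it has rank at most one and square
  zero. The new \<open>f\<^sub>1\<close> and \<open>f\<^sub>2\<close> are images under the operator, or a preimage of \<open>f\<^sub>1\<close> in the case of \<open>f\<^sub>2\<close>.\<close>

lemma classified_single_operator:
  assumes admissible: "admissible (tri m (a, b, c) (0, 0, 0) (p1, q1, r1) (p2, q2, r2))" and m: "m = 0 \<or> m = 1"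
  shows "classified (tri m (a, b, c) (0, 0, 0) (p1, q1, r1) (p2, q2, r2))"
proof -
  consider "a = 0" "b = 0" "c = 0" | "a \<noteq> 0" "c \<noteq> 0" | "a \<noteq> 0" "c = 0" | "a = 0" "c \<noteq> 0" | "a = 0" "b \<noteq> 0" "c = 0"
    by blast
  then show ?thesis
  proof cases
    case 1
    with admissible show ?thesis using classified_no_action[OF _ m] classified_componentwise by metis
  next
    case 2
    show ?thesis
    proof (rule classified_by_action[OF admissible, where m' = "m" and K' = "(1, 0, 1)" and L' = "(0, 0, 0)"
      and u = "(1, 0)" and v = "(0, 1)" and x = "(a * c, 0, 0)" and y = "(b, c, 0)" and z = "(0, 0, 1)"])
    qed (use 2 in \<open>simp_all add: action_eval field_simps\<close>, erule classified_componentwise[rotated], erule classified_rank_two[OF _ m])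
  next
    case 3
    show ?thesis
    proof (rule classified_by_action[OF admissible, where m' = "m" and K' = "(1, 0, 0)" and L' = "(0, 0, 0)"
      and u = "(1, 0)" and v = "(0, 1)" and x = "(a, 0, 0)" and y = "(0, 1, 0)" and z = "(0, - b / a, 1)"])
    qed (use 3 in \<open>simp_all add: action_eval field_simps\<close>, erule classified_componentwise[rotated], erule classified_rank_one[OF _ m])
  next
    case 4
    show ?thesis
    proof (rule classified_by_action[OF admissible, where m' = "m" and K' = "(1, 0, 0)" and L' = "(0, 0, 0)"
      and u = "(1, 0)" and v = "(0, 1)" and x = "(b, c, 0)" and y = "(0, 0, 1)" and z = "(1, 0, 0)"])
    qed (use 4 in \<open>simp_all add: action_eval field_simps\<close>, erule classified_componentwise[rotated], erule classified_rank_one[OF _ m])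
  next
    case 5
    show ?thesis
    proof (rule classified_by_action[OF admissible, where m' = "m" and K' = "(1, 0, 0)" and L' = "(0, 0, 0)"
      and u = "(1, 0)" and v = "(0, 1)" and x = "(b, 0, 0)" and y = "(0, 0, 1)" and z = "(0, 1, 0)"])
    qed (use 5 in \<open>simp_all add: action_eval field_simps\<close>, erule classified_componentwise[rotated], erule classified_rank_one[OF _ m])
  qed
qed

lemma classified_proportional:
  assumes admissible: "admissible (tri 0 (a, b, c) (k * a, k * b, k * c) (p1, q1, r1) (p2, q2, r2))"
  shows "classified (tri 0 (a, b, c) (k * a, k * b, k * c) (p1, q1, r1) (p2, q2, r2))"
proof -
  show ?thesis
  proof (rule classified_by_action[OF admissible, where m' = "0" and K' = "(a, b, c)" and L' = "(0, 0, 0)"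
      and u = "(1, 0)" and v = "(- k, 1)" and x = "(1, 0, 0)" and y = "(0, 1, 0)" and z = "(0, 0, 1)"])
  qed (use TrueI in \<open>simp_all add: action_eval field_simps\<close>, erule classified_componentwise[rotated], erule classified_single_operator, simp)
qed

text \<open>If the superdiagonals \<open>(a\<^sub>i, c\<^sub>i)\<close> are independent, inverting their matrix makes them unit vectors. The
  remaining corner entries \<open>s, t\<close> are removed by a unipotent change of the odd basis.\<close>

lemma classified_transversal:
  assumes admissible: "admissible (tri 0 (a1, b1, c1) (a2, b2, c2) (p1, q1, r1) (p2, q2, r2))" and "a1 * c2 - a2 * c1 \<noteq> 0"
  shows "classified (tri 0 (a1, b1, c1) (a2, b2, c2) (p1, q1, r1) (p2, q2, r2))"
proof -
  define D where "D = a1 * c2 - a2 * c1"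
  have D: "D \<noteq> 0" using assms(2) by (simp add: D_def)
  \<comment> \<open>the inverse of the matrix of superdiagonals, up to signs\<close>
  define i j k l where ijkl: "i = c2 / D" "j = c1 / D" "k = a2 / D" "l = a1 / D"
  have inv: "i * a1 - j * a2 = 1" "i * c1 - j * c2 = 0" "l * c2 - k * c1 = 1" "l * a2 - k * a1 = 0" "i * l - j * k \<noteq> 0"
    using D by (simp_all add: ijkl field_simps) (simp_all add: D_def algebra_simps)
  define s where "s = i * b1 - j * b2"
  define t where "t = l * b2 - k * b1"
  show ?thesis
  proof (rule classified_by_action[OF admissible, where m' = 0 and K' = "(1, 0, 0)" and L' = "(0, 0, 1)"
      and u = "(i, - j)" and v = "(- k, l)" and x = "(1, 0, 0)" and y = "(t, 1, 0)" and z = "(0, - s, 1)"])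
    show "det2 (i, - j) (- k, l) \<noteq> 0" using inv(5) by simp
    show "det3 (1, 0, 0) (t, 1, 0) (0, - s, 1) \<noteq> 0" by simp
    have "a1 * i = 1 + a2 * j" "c1 * i = c2 * j" "c2 * l = 1 + c1 * k" "a1 * k = a2 * l"
      using inv by (simp_all add: algebra_simps)
    then show "\<forall>(g, h)\<in>set left_pairs. mult (table_alg (tri 0 (a1, b1, c1) (a2, b2, c2) (p1, q1, r1) (p2, q2, r2))) (new_basis (i, - j) (- k, l) (1, 0, 0) (t, 1, 0) (0, - s, 1) g)
         (new_basis (i, - j) (- k, l) (1, 0, 0) (t, 1, 0) (0, - s, 1) h) =
        comb (table_alg (tri 0 (a1, b1, c1) (a2, b2, c2) (p1, q1, r1) (p2, q2, r2))) (new_basis (i, - j) (- k, l) (1, 0, 0) (t, 1, 0) (0, - s, 1))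
         (basis_prod (tri 0 (1, 0, 0) (0, 0, 1) (0, 0, 0) (0, 0, 0)) g h)"
      by (simp add: action_eval s_def t_def) algebra
  qed (erule classified_componentwise[rotated], erule classified_composable)
qed

text \<open>If the superdiagonals are dependent, a combination of \<open>e\<^sub>1, e\<^sub>2\<close> acts by the corner entry \<open>d\<close> alone. When
  \<open>d \<noteq> 0\<close>, the other operator can be freed of its corner entry, and the shape of its superdiagonal
  decides which plane of operators arises.\<close>

lemma classified_square_zero_aux:
  assumes admissible: "admissible (tri 0 (a1, b1, c1) (a2, b2, c2) (p1, q1, r1) (p2, q2, r2))" and nz: "a1 \<noteq> 0 \<or> c1 \<noteq> 0"
  shows "classified (tri 0 (a1, b1, c1) (a2, b2, c2) (p1, q1, r1) (p2, q2, r2))"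
proof (cases "a1 * c2 - a2 * c1 = 0")
  case False
  with admissible show ?thesis by (rule classified_transversal)
next
  case True
  \<comment> \<open>the factor by which the superdiagonal of \<open>L\<^sub>2\<close> is proportional to that of \<open>L\<^sub>1\<close>\<close>
  define k where "k = (if a1 \<noteq> 0 then a2 / a1 else c2 / c1)"
  have k: "a2 = k * a1" "c2 = k * c1" using True nz by (auto simp: k_def field_simps)
  define d where "d = b2 - k * b1"
  have b2: "b2 = d + k * b1" by (simp add: d_def)
  consider "d = 0" | "d \<noteq> 0" "a1 \<noteq> 0" "c1 \<noteq> 0" | "d \<noteq> 0" "a1 \<noteq> 0" "c1 = 0" | "d \<noteq> 0" "a1 = 0" "c1 \<noteq> 0" using nz by blast
  then show ?thesis
  proof cases
    case 1
    then show ?thesis using admissible classified_proportional by (simp add: k b2)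
  next
    case 2
    show ?thesis
    proof (rule classified_by_action[OF admissible, where m' = "0" and K' = "(1, 0, 1)" and L' = "(0, 1, 0)"
      and u = "(1 + k * b1 / d, - b1 / d)" and v = "(- k * (a1 * c1 / d), a1 * c1 / d)" and x = "(a1 * c1, 0, 0)" and y = "(0, c1, 0)" and z = "(0, 0, 1)"])
    qed (use 2 k b2 in \<open>simp_all add: action_eval field_simps\<close>, erule classified_componentwise[rotated], erule classified_regular_and_square)
  next
    case 3
    show ?thesis
    proof (rule classified_by_action[OF admissible, where m' = "0" and K' = "(1, 0, 0)" and L' = "(0, 1, 0)"
      and u = "(1 + k * b1 / d, - b1 / d)" and v = "(- k * (a1 / d), a1 / d)" and x = "(a1, 0, 0)" and y = "(0, 1, 0)" and z = "(0, 0, 1)"])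
    qed (use 3 k b2 in \<open>simp_all add: action_eval field_simps\<close>, erule classified_componentwise[rotated], erule classified_common_image)
  next
    case 4
    show ?thesis
    proof (rule classified_by_action[OF admissible, where m' = "0" and K' = "(0, 1, 0)" and L' = "(0, 0, 1)"
      and u = "(- k / d, 1 / d)" and v = "(1 + k * b1 / d, - b1 / d)" and x = "(1, 0, 0)" and y = "(0, c1, 0)" and z = "(0, 0, 1)"])
    qed (use 4 k b2 in \<open>simp_all add: action_eval field_simps\<close>, erule classified_componentwise[rotated], erule classified_common_source)
  qed
qed

lemma classified_square_zero:
  assumes admissible: "admissible (tri 0 (a1, b1, c1) (a2, b2, c2) (p1, q1, r1) (p2, q2, r2))"
  shows "classified (tri 0 (a1, b1, c1) (a2, b2, c2) (p1, q1, r1) (p2, q2, r2))"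
proof -
  consider "a1 \<noteq> 0 \<or> c1 \<noteq> 0" | "a2 \<noteq> 0 \<or> c2 \<noteq> 0" | "a1 = 0" "c1 = 0" "a2 = 0" "c2 = 0" "b1 \<noteq> 0"
    | "a1 = 0" "c1 = 0" "a2 = 0" "c2 = 0" "b1 = 0" by blast
  then show ?thesis
  proof cases
    case 1
    with admissible show ?thesis by (rule classified_square_zero_aux)
  next
    case 2
    show ?thesis
    proof (rule classified_by_action[OF admissible, where m' = "0" and K' = "(a2, b2, c2)" and L' = "(a1, b1, c1)"
      and u = "(0, 1)" and v = "(1, 0)" and x = "(1, 0, 0)" and y = "(0, 1, 0)" and z = "(0, 0, 1)"])
    qed (use TrueI in \<open>simp_all add: action_eval field_simps\<close>, erule classified_componentwise[rotated], erule classified_square_zero_aux, use 2 in blast)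
  next
    case 3
    then show ?thesis using admissible classified_proportional[of 0 b1 0 "b2 / b1"] by simp
  next
    case 4
    show ?thesis
    proof (rule classified_by_action[OF admissible, where m' = "0" and K' = "(a2, b2, c2)" and L' = "(0, 0, 0)"
      and u = "(0, 1)" and v = "(1, 0)" and x = "(1, 0, 0)" and y = "(0, 1, 0)" and z = "(0, 0, 1)"])
    qed (use 4 in \<open>simp_all add: action_eval field_simps\<close>, erule classified_componentwise[rotated], erule classified_single_operator, simp)
  qed
qed

text \<open>The three instances of the Jordan identity amount to \<open>L\<^sub>1 L\<^sub>2 = L\<^sub>2 L\<^sub>1\<close>, \<open>L\<^sub>1 L\<^sub>2 = 0\<close> and \<open>L\<^sub>2\<^sup>2 = 0\<close> for strictly
  upper triangular matrices. If \<open>L\<^sub>2 \<noteq> 0\<close>, the new basis makes \<open>L\<^sub>2\<close> an elementary matrix, and since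
  \<open>(e\<^sub>1 + \<mu> e\<^sub>2)\<^sup>2 = e\<^sub>2\<close>, a multiple of \<open>e\<^sub>2\<close> can be added to \<open>e\<^sub>1\<close> to clear the same entry of \<open>L\<^sub>1\<close>.\<close>

lemma classified_square_nonzero:
  assumes admissible: "admissible (tri 1 (a1, b1, c1) (a2, b2, c2) (p1, q1, r1) (p2, q2, r2))"
  shows "classified (tri 1 (a1, b1, c1) (a2, b2, c2) (p1, q1, r1) (p2, q2, r2))"
proof -
  have rel: "c2 * a1 = 0" "c1 * a2 = 0" "a2 * c2 = 0"
    using admissible_jordan[OF admissible, of F3 E1 E1 E1] admissible_jordan[OF admissible, of E1 E1 E1 F3] admissible_jordan[OF admissible, of E2 E1 E1 F3]
    by (auto simp: jordan_eval psign_def vec_gen_eq bv_nth)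
  consider "a2 \<noteq> 0" "c1 = 0" "c2 = 0" | "c2 \<noteq> 0" "a1 = 0" "a2 = 0" | "a2 = 0" "c2 = 0" "b2 \<noteq> 0" | "a2 = 0" "c2 = 0" "b2 = 0"
    using rel by auto
  then show ?thesis
  proof cases
    case 1
    show ?thesis
    proof (rule classified_by_action[OF admissible, where m' = "1" and K' = "((b1 - b2 * a1 / a2) / a2, 0, 0)" and L' = "(0, 1, 0)"
      and u = "(1, - a1 / a2)" and v = "(0, 1)" and x = "(a2, 0, 0)" and y = "(0, - b2 / a2, 1)" and z = "(0, 1, 0)"])
    qed (use 1 in \<open>simp_all add: action_eval field_simps\<close>, erule classified_componentwise[rotated], erule classified_square_acts)
  next
    case 2
    show ?thesis
    proof (rule classified_by_action[OF admissible, where m' = "1" and K' = "(0, 0, b1 - c1 * b2 / c2)" and L' = "(0, 1, 0)"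
      and u = "(1, - c1 / c2)" and v = "(0, 1)" and x = "(b2, c2, 0)" and y = "(1, 0, 0)" and z = "(0, 0, 1)"])
    qed (use 2 in \<open>simp_all add: action_eval field_simps\<close>, erule classified_componentwise[rotated], erule classified_square_acts)
  next
    case 3
    show ?thesis
    proof (rule classified_by_action[OF admissible, where m' = "1" and K' = "(a1 / b2, 0, c1)" and L' = "(0, 1, 0)"
      and u = "(1, - b1 / b2)" and v = "(0, 1)" and x = "(b2, 0, 0)" and y = "(0, 1, 0)" and z = "(0, 0, 1)"])
    qed (use 3 in \<open>simp_all add: action_eval field_simps\<close>, erule classified_componentwise[rotated], erule classified_square_acts)
  next
    case 4
    with admissible show ?thesis using classified_single_operator[of 1] by simp
  qed
qed

lemma classified_tri:
  assumes admissible: "admissible (tri m K L v w)"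
  shows "classified (tri m K L v w)"
proof -
  obtain a1 b1 c1 a2 b2 c2 where KL: "K = (a1, b1, c1)" "L = (a2, b2, c2)" by (cases K; cases L) auto
  obtain p1 q1 r1 p2 q2 r2 where vw: "v = (p1, q1, r1)" "w = (p2, q2, r2)" by (cases v; cases w) auto
  note admissible = admissible[unfolded KL vw]
  show ?thesis
  proof (cases "m = 0")
    case True
    then show ?thesis using admissible classified_square_zero by (simp add: KL vw)
  next
    case False
    have "classified (tri m (a1, b1, c1) (a2, b2, c2) (p1, q1, r1) (p2, q2, r2))"
    proof (rule classified_by_action[OF admissible, where m' = 1 and K' = "(a1, b1, c1)" and L' = "(m * a2, m * b2, m * c2)"
        and u = "(1, 0)" and v = "(0, m)" and x = "(1, 0, 0)" and y = "(0, 1, 0)" and z = "(0, 0, 1)"])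
    qed (use False in \<open>simp_all add: action_eval\<close>, erule classified_componentwise[rotated], erule classified_square_nonzero)
    then show ?thesis by (simp add: KL vw)
  qed
qed

section \<open>Every nilpotent Jordan superalgebra of type (2,3) has a triangular table\<close>

text \<open>Carrying a finite basis along keeps clear of the convention that \<open>dim\<close> is \<open>0\<close> in infinite dimension.\<close>

definition basis_of_size :: "(complex \<Rightarrow> 'a::ab_group_add \<Rightarrow> 'a) \<Rightarrow> 'a set \<Rightarrow> nat \<Rightarrow> bool" where
  "basis_of_size s S n \<longleftrightarrow> (\<exists>B. finite B \<and> \<not> module.dependent s B \<and> card B = n \<and> module.span s B = S)"

lemma basis_of_size_subspace:
  assumes "vector_space s" "basis_of_size s S n"
  shows "module.subspace s S"
proof -
  interpret vector_space s by fact
  show ?thesis using assms(2) by (auto simp: basis_of_size_def)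
qed

lemma basis_of_size_0:
  assumes "vector_space s" "basis_of_size s S 0"
  shows "S = {0}"
proof -
  interpret vector_space s by fact
  show ?thesis using assms(2) by (auto simp: basis_of_size_def)
qed

lemma basis_of_size_Suc:
  assumes "vector_space s" "basis_of_size s S (Suc n)"
  shows "\<exists>x\<in>S. x \<noteq> 0"
proof -
  interpret vector_space s by fact
  obtain B where B: "independent B" "card B = Suc n" "span B = S"
    using assms(2) by (auto simp: basis_of_size_def)
  then obtain x where "x \<in> B" by fastforce
  then show ?thesis using B dependent_zero span_base by metis
qed

text \<open>A basis of \<open>T\<close> is extended to one of \<open>S\<close>, and one of the new basis vectors is left out.\<close>

lemma hyperplane_containing:
  assumes s: "vector_space s" and S: "basis_of_size s S (Suc n)"
    and T: "module.subspace s T" "T \<subseteq> S" "T \<noteq> S"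
  shows "\<exists>W f. basis_of_size s W n \<and> T \<subseteq> W \<and> W \<subseteq> S \<and> f \<in> S \<and> f \<notin> W \<and> S = module.span s (insert f W)"
proof -
  interpret vector_space s by fact
  obtain B where B: "finite B" "independent B" "card B = Suc n" "span B = S"
    using S unfolding basis_of_size_def by blast
  obtain C where C: "C \<subseteq> T" "independent C" "T \<subseteq> span C"
    using maximal_independent_subset[of T] by blast
  have "C \<subseteq> S" using C T by blast
  then obtain D where D: "C \<subseteq> D" "D \<subseteq> S" "independent D" "S \<subseteq> span D"
    using maximal_independent_subset_extend[OF _ C(2)] by blast
  have spanD: "span D = S"
    using D B(4) by (metis span_minimal span_subspace subspace_span)
  have "finite D"
    using independent_span_bound[OF B(1) D(3)] D(2) B(4) by blast
  have "card D = Suc n"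
    using B D(3) spanD by (metis dim_span_eq_card_independent)
  have "span C \<subseteq> T" using C(1) T(1) by (simp add: span_minimal)
  then have "C \<noteq> D" using C(3) T(3) spanD by blast
  then obtain f where f: "f \<in> D" "f \<notin> C" using D(1) by blast
  let ?W = "span (D - {f})"
  have "basis_of_size s ?W n"
    unfolding basis_of_size_def using f \<open>finite D\<close> \<open>card D = Suc n\<close> D(3)
    independent_mono[OF D(3), of "D - {f}"]
    by (intro exI[of _ "D - {f}"]) auto
  moreover have "T \<subseteq> ?W" using C(3) span_mono[of C "D - {f}"] D(1) f(2) by blast
  moreover have "?W \<subseteq> S" using span_mono[of "D - {f}" D] spanD by blast
  moreover have "f \<in> S" using f(1) D(2) by blast
  moreover have "f \<notin> ?W" using D(3) f(1) by (auto simp: dependent_def)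
  moreover have "S = span (insert f ?W)"
  proof
    have "D \<subseteq> insert f ?W" by (auto intro: span_base)
    then have "span D \<subseteq> span (insert f ?W)" by (rule span_mono)
    then show "S \<subseteq> span (insert f ?W)" unfolding spanD .
    show "span (insert f ?W) \<subseteq> S"
      using \<open>f \<in> S\<close> \<open>?W \<subseteq> S\<close> B(4) by (intro span_minimal) auto
  qed
  ultimately show ?thesis by blast
qed

lemma in_span_insert_subspace:
  assumes "vector_space s" "module.subspace s W" "x \<in> module.span s (insert f W)"
  shows "\<exists>c. \<exists>w\<in>W. x = s c f + w"
proof -
  interpret vector_space s by fact
  obtain c where "x - s c f \<in> span W" using assms(3) by (auto simp: span_breakdown_eq)
  then have "x - s c f \<in> W" using span_minimal[OF subset_refl assms(2)] by blast
  then show ?thesis by (intro exI[of _ c] bexI[of _ "x - s c f"]) simp_all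
qed

text \<open>One step of the descent to a triangular basis: \<open>S J\<^sub>0\<close> is a proper subspace of \<open>S\<close> by nilpotency, hence
  lies in a hyperplane, which is again \<open>J\<^sub>0\<close>-stable.\<close>

lemma invariant_hyperplane:
  fixes A :: "'a::ab_group_add superalgebra"
  assumes A: "superalgebra A" and n: "nilpotent_alg A" and S: "basis_of_size (scl A) S (Suc n)"
    and inv: "\<And>s a. s \<in> S \<Longrightarrow> a \<in> part A 0 \<Longrightarrow> mult A s a \<in> S"
  shows "\<exists>W f. basis_of_size (scl A) W n \<and> W \<subseteq> S \<and> f \<in> S \<and> f \<notin> W \<and> S = module.span (scl A) (insert f W)
    \<and> (\<forall>s\<in>S. \<forall>a\<in>part A 0. mult A s a \<in> W)"
proof -
  interpret vector_space "scl A" using A by (rule superalgebra_vs)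
  let ?T = "span {mult A s a |s a. s \<in> S \<and> a \<in> part A 0}"
  have sub: "subspace S" using vector_space_axioms S by (rule basis_of_size_subspace)
  have "?T \<subseteq> S" using inv sub by (intro span_minimal) auto
  moreover have "?T \<noteq> S"
  proof
    assume "?T = S"
    moreover have "?T \<subseteq> span {mult A s y |s y. s \<in> S}" by (intro span_mono) blast
    ultimately have "S \<subseteq> {0}" by (intro nilpotent_no_fixed_set[OF A n]) simp
    then show False using basis_of_size_Suc[OF vector_space_axioms S] by blast
  qed
  ultimately obtain W f where "basis_of_size (scl A) W n" "?T \<subseteq> W" "W \<subseteq> S" "f \<in> S" "f \<notin> W" "S = span (insert f W)"
    using hyperplane_containing[OF vector_space_axioms S subspace_span] by blast
  moreover have "mult A s a \<in> ?T" if "s \<in> S" "a \<in> part A 0" for s a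
    using that by (intro span_base) blast
  ultimately show ?thesis by (intro exI[of _ W] exI[of _ f]) (simp add: subset_iff)
qed

lemma part_basis_of_size:
  assumes A: "superalgebra A" and fin: "finite B" "module.span (scl A) B = UNIV"
  shows "basis_of_size (scl A) (part A i) (vector_space.dim (scl A) (part A i))"
proof -
  interpret vector_space "scl A" using A by (rule superalgebra_vs)
  obtain C where C: "C \<subseteq> part A i" "independent C" "part A i \<subseteq> span C" "card C = dim (part A i)"
    using basis_exists by blast
  have "finite C" using independent_span_bound[OF fin(1) C(2)] fin(2) by simp
  moreover have "span C = part A i" using C superalgebra_part(1)[OF A] by (metis span_subspace)
  ultimately show ?thesis unfolding basis_of_size_def using C by blast
qed

text \<open>The descent is carried out twice in \<open>J\<^sub>0\<close> and three times in \<open>J\<^sub>1\<close>; the vectors outside the successive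
  hyperplanes form the basis, in the order from the top of the flag to the bottom.\<close>

lemma triangular_frame:
  fixes A :: "'a::ab_group_add superalgebra"
  assumes A: "superalgebra A" and com: "supercommutative A" and n: "nilpotent_alg A" and type: "has_type A 2 3"
  shows "\<exists>m K L v w. A \<cong>\<^sub>s table_alg (tri m K L v w)"
proof -
  interpret vector_space "scl A" using A by (rule superalgebra_vs)
  obtain B where B: "finite B" "span B = UNIV" using type unfolding has_type_def by blast
  have U: "basis_of_size (scl A) (part A 0) (Suc (Suc 0))" and V: "basis_of_size (scl A) (part A 1) (Suc (Suc (Suc 0)))"
    using part_basis_of_size[OF A B, of 0] part_basis_of_size[OF A B, of 1] type
    by (simp_all add: has_type_def numeral_2_eq_2 numeral_3_eq_3)
  have part: "mult A x y \<in> part A k" if "x \<in> part A i" "y \<in> part A j" "k = i + j" for x y i j k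
    using superalgebra_part(4)[OF A] that by simp
  obtain U1 e1 where U1: "basis_of_size (scl A) U1 (Suc 0)" "U1 \<subseteq> part A 0" "e1 \<in> part A 0" "e1 \<notin> U1"
    "part A 0 = span (insert e1 U1)" "\<And>s a. s \<in> part A 0 \<Longrightarrow> a \<in> part A 0 \<Longrightarrow> mult A s a \<in> U1"
    using invariant_hyperplane[OF A n U] part[of _ 0 _ 0 0] by auto
  obtain U0 e2 where U0: "basis_of_size (scl A) U0 0" "e2 \<in> U1" "e2 \<notin> U0" "U1 = span (insert e2 U0)"
      "\<And>s a. s \<in> U1 \<Longrightarrow> a \<in> part A 0 \<Longrightarrow> mult A s a \<in> U0"
    using invariant_hyperplane[OF A n U1(1)] U1(2,6) by blast
  obtain W2 f3 where W2: "basis_of_size (scl A) W2 (Suc (Suc 0))" "W2 \<subseteq> part A 1" "f3 \<in> part A 1" "f3 \<notin> W2"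
    "part A 1 = span (insert f3 W2)" "\<And>s a. s \<in> part A 1 \<Longrightarrow> a \<in> part A 0 \<Longrightarrow> mult A s a \<in> W2"
    using invariant_hyperplane[OF A n V] part[of _ 1 _ 0 1] by auto
  obtain W1 f2 where W1: "basis_of_size (scl A) W1 (Suc 0)" "W1 \<subseteq> W2" "f2 \<in> W2" "f2 \<notin> W1" "W2 = span (insert f2 W1)"
      "\<And>s a. s \<in> W2 \<Longrightarrow> a \<in> part A 0 \<Longrightarrow> mult A s a \<in> W1"
    using invariant_hyperplane[OF A n W2(1)] W2(2,6) by blast
  obtain W0 f1 where W0: "basis_of_size (scl A) W0 0" "f1 \<in> W1" "f1 \<notin> W0" "W1 = span (insert f1 W0)"
      "\<And>s a. s \<in> W1 \<Longrightarrow> a \<in> part A 0 \<Longrightarrow> mult A s a \<in> W0"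
    using invariant_hyperplane[OF A n W1(1)] W1(2,6) by blast
  have zero: "U0 = {0}" "W0 = {0}" using U0(1) W0(1) basis_of_size_0[OF vector_space_axioms] by blast+
  have U1_span: "\<exists>c. x = scl A c e2" if "x \<in> U1" for x
    using in_span_insert_subspace[OF vector_space_axioms, of U0 x e2] that U0(4) zero by (auto simp: subspace_single_0)
  have U_span: "\<exists>c d. x = scl A c e1 + scl A d e2" if "x \<in> part A 0" for x
    using in_span_insert_subspace[OF vector_space_axioms basis_of_size_subspace[OF vector_space_axioms U1(1)], of x e1] that U1(5) U1_span by metis
  have W1_span: "\<exists>c. x = scl A c f1" if "x \<in> W1" for x
    using in_span_insert_subspace[OF vector_space_axioms, of W0 x f1] that W0(4) zero by (auto simp: subspace_single_0)
  have W2_span: "\<exists>c d. x = scl A c f2 + scl A d f1" if "x \<in> W2" for x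
    using in_span_insert_subspace[OF vector_space_axioms basis_of_size_subspace[OF vector_space_axioms W1(1)], of x f2] that W1(5) W1_span by metis
  have W_span: "\<exists>b c d. x = scl A b f3 + (scl A c f2 + scl A d f1)" if "x \<in> part A 1" for x
    using in_span_insert_subspace[OF vector_space_axioms basis_of_size_subspace[OF vector_space_axioms W2(1)], of x f3] that W2(5) W2_span by metis
  have even: "e2 \<in> part A 0" using U0(2) U1(2) by blast
  have odd: "f1 \<in> part A 1" "f2 \<in> part A 1" using W0(2) W1(2,3) W2(2) by blast+
  have comm: "mult A a f = mult A f a" if "a \<in> part A 0" "f \<in> part A i" for a f i
  proof -
    have "mult A a f = scl A (psign (0 * i)) (mult A f a)"
      using com that unfolding supercommutative_def by blast
    then show ?thesis by (simp add: psign_def)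
  qed
  obtain m where m: "mult A e1 e1 = scl A m e2" using U1_span U1(6)[OF U1(3) U1(3)] by blast
  have e: "mult A e1 e2 = 0" "mult A e2 e2 = 0"
    using U0(5)[OF U0(2)] U1(3) even comm[OF U1(3) even] zero by auto
  have f1: "mult A a f1 = 0" if "a \<in> part A 0" for a
    using W0(5)[OF W0(2) that] comm[OF that odd(1)] zero by simp
  have f2: "\<exists>c. mult A a f2 = scl A c f1" if "a \<in> part A 0" for a
    using W1_span[OF W1(6)[OF W1(3) that]] comm[OF that odd(2)] by simp
  have f3: "\<exists>c d. mult A a f3 = scl A c f2 + scl A d f1" if "a \<in> part A 0" for a
    using W2_span[OF W2(6)[OF W2(3) that]] comm[OF that W2(3)] by simp
  have ff: "\<exists>c d. mult A f g = scl A c e1 + scl A d e2" if "f \<in> part A 1" "g \<in> part A 1" for f g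
    using U_span part[OF that, of 0] by simp
  obtain a1 a2 where a: "mult A e1 f2 = scl A a1 f1" "mult A e2 f2 = scl A a2 f1"
    using f2 U1(3) even by metis
  obtain b1 c1 b2 c2 where bc: "mult A e1 f3 = scl A c1 f2 + scl A b1 f1" "mult A e2 f3 = scl A c2 f2 + scl A b2 f1"
    using f3 U1(3) even by metis
  obtain p1 p2 q1 q2 r1 r2 where pqr: "mult A f1 f2 = scl A p1 e1 + scl A p2 e2"
    "mult A f1 f3 = scl A q1 e1 + scl A q2 e2" "mult A f2 f3 = scl A r1 e1 + scl A r2 e2"
    using ff odd W2(3) by metis
  let ?T = "tri m (a1, b1, c1) (a2, b2, c2) (p1, q1, r1) (p2, q2, r2)"
  let ?b = "\<lambda>g. case g of E1 \<Rightarrow> e1 | E2 \<Rightarrow> e2 | F1 \<Rightarrow> f1 | F2 \<Rightarrow> f2 | F3 \<Rightarrow> f3"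
  have comb: "comb A ?b x = (scl A (x $ E1) e1 + scl A (x $ E2) e2)
      + (scl A (x $ F3) f3 + (scl A (x $ F2) f2 + scl A (x $ F1) f1))" for x
    by (simp add: comb_def sum_gen algebra_simps)
  have "inj (comb A ?b)"
  proof (rule injI)
    fix x y assume eq: "comb A ?b x = comb A ?b y"
    define z where "z = x - y"
    let ?u = "scl A (z $ E1) e1 + scl A (z $ E2) e2"
    let ?v = "scl A (z $ F3) f3 + (scl A (z $ F2) f2 + scl A (z $ F1) f1)"
    have uv: "?u + ?v = 0"
      using eq unfolding comb z_def by (simp add: scale_left_diff_distrib algebra_simps)
    have u: "?u \<in> part A 0" and v: "?v \<in> part A 1"
      using even odd U1(3) W2(3) superalgebra_part(1)[OF A] by (simp_all add: subspace_add subspace_scale)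
    from uv have "?u = - ?v" by (rule eq_neg_iff_add_eq_0[THEN iffD2])
    then have "?u \<in> part A 1" using subspace_neg[OF superalgebra_part(1)[OF A] v] by (simp only:)
    then have u0: "?u = 0" using u superalgebra_part(2)[OF A] by blast
    then have v0: "?v = 0" using uv by simp
    \<comment> \<open>coordinates are read off from the top of the flag downwards\<close>
    have solve: "c = 0" if "scl A c g + w = 0" "w \<in> W" "subspace W" "g \<notin> W" for c g w W
    proof (rule ccontr)
      assume "c \<noteq> 0"
      have "scl A c g = - w" using that(1) by (rule eq_neg_iff_add_eq_0[THEN iffD2])
      then have "scl A c g \<in> W" using that(2,3) by (simp add: subspace_neg)
      then have "scl A (1 / c) (scl A c g) \<in> W" using that(3) by (simp add: subspace_scale del: scale_scale)
      then show False using \<open>c \<noteq> 0\<close> that(4) by simp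
    qed
    have s: "subspace U1" "subspace W2" "subspace W1"
      using U1(1) W2(1) W1(1) by (auto intro: basis_of_size_subspace[OF vector_space_axioms])
    have E1: "z $ E1 = 0"
      by (rule solve[OF u0 _ s(1) U1(4)]) (simp add: s subspace_scale U0(2))
    have F3: "z $ F3 = 0"
      using W0(2) W1(2,3) s by (intro solve[OF v0 _ s(2) W2(4)]) (auto intro!: subspace_add subspace_scale)
    have v1: "scl A (z $ F2) f2 + scl A (z $ F1) f1 = 0" using v0 F3 by simp
    have F2: "z $ F2 = 0"
      by (rule solve[OF v1 _ s(3) W1(4)]) (simp add: s subspace_scale W0(2))
    have "z $ E2 = 0" "z $ F1 = 0"
      using u0 v1 E1 F2 U0(3) W0(3) zero by auto
    with E1 F3 F2 have "z = 0" by (simp add: vec_gen_eq)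
    then show "x = y" by (simp add: z_def)
  qed
  moreover have "surj (comb A ?b)"
    unfolding surj_def
  proof
    fix x
    obtain y z where yz: "y \<in> part A 0" "z \<in> part A 1" "x = y + z" using superalgebra_part(3)[OF A] by blast
    obtain s t where "y = scl A s e1 + scl A t e2" using U_span yz(1) by blast
    moreover obtain a b c where "z = scl A a f3 + (scl A b f2 + scl A c f1)" using W_span yz(2) by blast
    ultimately have "comb A ?b (s *s bv E1 + t *s bv E2 + c *s bv F1 + b *s bv F2 + a *s bv F3) = x"
      unfolding comb yz(3) by (simp add: bv_nth)
    then show "\<exists>y. x = comb A ?b y" by blast
  qed
  ultimately have bij: "bij (comb A ?b)" by (simp add: bij_def)
  have "A \<cong>\<^sub>s table_alg ?T"
  proof (rule frame_isomorphic_upper[OF A com wf_tri _ bij])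
    show "?b g \<in> part A (gen_parity g)" for g
      using even odd U1(3) W2(3) by (cases g) simp_all
    have "mult A e1 f1 = 0" "mult A e2 f1 = 0" using f1 U1(3) even by blast+
    then have "\<forall>(g, h) \<in> set upper_pairs. mult A (?b g) (?b h) = comb A ?b (basis_prod ?T g h)"
      unfolding comb upper_pairs_def
      by (simp add: basis_prod_tri bv_nth m e a bc pqr)
    then show "mult A (?b g) (?b h) = comb A ?b (basis_prod ?T g h)" if "(g, h) \<in> set upper_pairs" for g h
      using that by blast
  qed
  then show ?thesis by blast
qed

lemma admissible_tri_of_jordan:
  assumes "jordan_superalgebra J" "nilpotent_alg J" "has_type J 2 3"
  shows "\<exists>m K L v w. J \<cong>\<^sub>s table_alg (tri m K L v w) \<and> admissible (tri m K L v w)"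
proof -
  have J: "superalgebra J" "supercommutative J" "jordan_superidentity J"
    using assms(1) by (auto simp: jordan_superalgebra_def)
  obtain m K L v w where "J \<cong>\<^sub>s table_alg (tri m K L v w)"
    using triangular_frame[OF J(1,2) assms(2,3)] by blast
  moreover from this have "admissible (tri m K L v w)"
    unfolding admissible_def using jordan_superidentity_iso J(3) loop_free_iso nilpotent_loop_free[OF J(1) assms(2)] by blast
  ultimately show ?thesis by blast
qed

theorem theorem3p4:
  shows
    "(\<forall>(k, t) \<in> labels.
        jordan_superalgebra (J23 k t) \<and> nilpotent_alg (J23 k t) \<and> has_type (J23 k t) 2 3) \<and>
     (\<forall>J :: 'a::ab_group_add superalgebra.
        jordan_superalgebra J \<and> nilpotent_alg J \<and> has_type J 2 3 \<longrightarrow>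
        (\<exists>(k, t) \<in> labels. J \<cong>\<^sub>s J23 k t)) \<and>
     (\<forall>(k, t) \<in> labels. \<forall>(l, u) \<in> labels. k \<noteq> l \<longrightarrow> \<not> J23 k t \<cong>\<^sub>s J23 l u) \<and>
     (\<forall>l1 l2. l1 \<noteq> 0 \<longrightarrow> l2 \<noteq> 0 \<longrightarrow> (J23 31 l1 \<cong>\<^sub>s J23 31 l2 \<longleftrightarrow> l1 = l2)) \<and>
     (\<forall>g1 g2. g1 \<noteq> 0 \<longrightarrow> g2 \<noteq> 0 \<longrightarrow> (J23 43 g1 \<cong>\<^sub>s J23 43 g2 \<longleftrightarrow> g1 = g2)) \<and>
     (\<forall>p1 p2. J23 44 p1 \<cong>\<^sub>s J23 44 p2 \<longleftrightarrow> p1 = p2)"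
proof (intro conjI)
  show "\<forall>(k, t) \<in> labels.
      jordan_superalgebra (J23 k t) \<and> nilpotent_alg (J23 k t) \<and> has_type (J23 k t) 2 3"
  proof clarify
    fix k t assume "(k, t) \<in> labels"
    then obtain T where T: "(k, T) \<in> set (tables t)" "J23 k t = table_alg T" by (rule J23_table)
    show "jordan_superalgebra (J23 k t) \<and> nilpotent_alg (J23 k t) \<and> has_type (J23 k t) 2 3"
      unfolding T(2) jordan_superalgebra_def
      by (intro conjI superalgebra_table_alg supercommutative_table_alg wf_tables[OF T(1)] jordan_tables[OF T(1)]
          nilpotent_tables[OF T(1)] has_type_table_alg)
  qed
  show "\<forall>J :: 'a superalgebra. jordan_superalgebra J \<and> nilpotent_alg J \<and> has_type J 2 3 \<longrightarrow>
      (\<exists>(k, t) \<in> labels. J \<cong>\<^sub>s J23 k t)"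
  proof (intro allI impI)
    fix J :: "'a superalgebra"
    assume "jordan_superalgebra J \<and> nilpotent_alg J \<and> has_type J 2 3"
    then obtain m K L v w where J: "J \<cong>\<^sub>s table_alg (tri m K L v w)" and "admissible (tri m K L v w)"
      using admissible_tri_of_jordan by blast
    then have "classified (tri m K L v w)" by (intro classified_tri)
    then show "\<exists>(k, t) \<in> labels. J \<cong>\<^sub>s J23 k t"
      unfolding classified_def using isomorphic_trans[OF J] by fast
  qed
  show "\<forall>(k, t) \<in> labels. \<forall>(l, u) \<in> labels. k \<noteq> l \<longrightarrow> \<not> J23 k t \<cong>\<^sub>s J23 l u"
    using J23_nonisomorphic by fast
  have refl: "J23 k t \<cong>\<^sub>s J23 k t" if "(k, t) \<in> labels" for k t
    using J23_table[OF that] wf_tables superalgebra_table_alg isomorphic_refl by metis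
  show "\<forall>l1 l2. l1 \<noteq> 0 \<longrightarrow> l2 \<noteq> 0 \<longrightarrow> (J23 31 l1 \<cong>\<^sub>s J23 31 l2 \<longleftrightarrow> l1 = l2)"
    using J23_31_iso refl by (auto simp: labels_iff)
  show "\<forall>g1 g2. g1 \<noteq> 0 \<longrightarrow> g2 \<noteq> 0 \<longrightarrow> (J23 43 g1 \<cong>\<^sub>s J23 43 g2 \<longleftrightarrow> g1 = g2)"
    using J23_43_44_iso[of 43] refl by (auto simp: labels_iff)
  show "\<forall>p1 p2. J23 44 p1 \<cong>\<^sub>s J23 44 p2 \<longleftrightarrow> p1 = p2"
    using J23_43_44_iso[of 44] refl by (auto simp: labels_iff)
qed

end
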